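(* Let $\omega=(\alpha,\beta)\in\Omega$ be a point of the Thoma simplex, and let $\sigma^{(1)},\ldots,\sigma^{(r)}\in\mathfrak{S}_\infty$ be permutations of cycle types $\mu^{(1)},\ldots,\mu^{(r)}$ (integer partitions, defined up to parts of size $1$). For $n$ large enough let $\lambda$ be a random partition of size $n$ with law $\mathbb{P}_{n,\omega}$, and for $\sigma\in\mathfrak{S}_n$ put $$\Delta_{n,\omega}(\sigma)=\sqrt{n}\,\bigl(\chi^{\lambda}(\sigma)-\chi^{\omega}(\sigma)\bigr).$$ As $n\to\infty$, the random vector $(\Delta_{n,\omega}(\sigma^{(1)}),\ldots,\Delta_{n,\omega}(\sigma^{(r)}))$ converges in law to a centered Gaussian vector $(\Delta_{\infty,\omega}(\sigma^{(1)}),\ldots,\Delta_{\infty,\omega}(\sigma^{(r)}))$ with covariances $$\mathrm{Cov}\bigl(\Delta_{\infty,\omega}(\sigma^{(i)}),\Delta_{\infty,\omega}(\sigma^{(j)})\bigr)=\sum_{a\in\mu^{(i)},\,b\in\mu^{(j)}}ab\;p_{(\mu^{(i)}\sqcup\mu^{(j)})\setminus\{a,b\}}(\omega)\,\bigl(p_{a+b-1}(\omega)-p_a(\omega)\,p_b(\omega)\bigr),$$ where the sum runs over the parts $a$ of $\mu^{(i)}$ and $b$ of $\mu^{(j)}$, counted with multiplicity. In particular, if $\sigma$ and $\tau$ are cycles of lengths $l$ and $m$, then $\mathrm{Cov}(\Delta_{\infty,\omega}(\sigma),\Delta_{\infty,\omega}(\tau))=lm\,(p_{l+m-1}(\ome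ga)-p_l(\omega)\,p_m(\omega))$.
   Context: $\mathfrak{S}_n$ is the symmetric group, $\mathfrak{S}_\infty=\bigcup_n\mathfrak{S}_n$ the group of finitely supported permutations of $\{1,2,\ldots\}$, $\mathfrak{Y}_n$ the set of integer partitions of $n$. The Thoma simplex $\Omega$ is the set of pairs $\omega=(\alpha,\beta)$ of non-increasing sequences of non-negative reals $\alpha=(\alpha_1\ge\alpha_2\ge\cdots)$, $\beta=(\beta_1\ge\beta_2\ge\cdots)$ with $\sum_i\alpha_i+\sum_i\beta_i\le 1$. Put $p_1(\omega)=1$, $p_k(\omega)=\sum_i\alpha_i^k+(-1)^{k-1}\sum_i\beta_i^k$ for $k\ge2$, and $p_\mu(\omega)=\prod_i p_{\mu_i}(\omega)$ for a partition $\mu$. For $\sigma\in\mathfrak{S}_\infty$ of cycle type $\mu$, $\chi^\omega(\sigma)=p_\mu(\omega)$ (the value does not depend on the number of parts $1$); these are the extremal normalized characters of $\mathfrak{S}_\infty$ (Thoma). For $\lambda\in\mathfrak{Y}_n$, $\chi^\lambda$ is the normalized ($\chi^\lambda(\mathrm{id})=1$) irreducible character of $\mathfrak{S}_n$ labelled by $\lambda$ (with $(n)$ labelling the trivial representation). The probability measure $\mathbb{P}_{n,\omega}$ on $\mathfrak{Y}_n$ is defined by $\chi^{\omega}|_{\mathfrak{S}_n}=\sum_{\lambda\in\mathfrak{Y}_n}\mathbb{P}_{n,\omega}[\lambda]\,\chi^\lambda$. The symbol $\sqcup$ denotes multiset union of parts of partitions, and $\setminus\{a,b\}$ removes one part $a$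 and one part $b$. *)

theory Defs
  imports
    "HOL-Probability.Probability"
    "HOL-Combinatorics.Combinatorics"
    "HOL-Library.Function_Algebras"
begin

section \<open>Permutations, partitions and cycle types\<close>

definition sym_group :: "nat \<Rightarrow> (nat \<Rightarrow> nat) set" where
  "sym_group n = {p. p permutes {1..n}}"

definition sym_inf :: "(nat \<Rightarrow> nat) set" where
  "sym_inf = (\<Union>n. sym_group n)"

text \<open>An integer partition is the multiset of its (positive) parts; the number it partitions is
  the sum of the multiset, whereas \<open>size\<close> would be the number of parts.\<close>

definition partitions :: "nat \<Rightarrow> nat multiset set" where
  "partitions n = {\<mu>. 0 \<notin># \<mu> \<and> \<Sum>\<^sub># \<mu> = n}"

definition nontrivial_cycle_type :: "(nat \<Rightarrow> nat) \<Rightarrow> nat multiset" where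
  "nontrivial_cycle_type \<sigma> = image_mset card (mset_set (orbit \<sigma> ` {x. \<sigma> x \<noteq> x}))"

text \<open>Cycle types of elements of \<open>sym_inf\<close> are only defined up to parts equal to 1, so \<open>\<mu>\<close> may
  contain any number of these.\<close>

definition has_cycle_type :: "(nat \<Rightarrow> nat) \<Rightarrow> nat multiset \<Rightarrow> bool" where
  "has_cycle_type \<sigma> \<mu> \<longleftrightarrow> 0 \<notin># \<mu> \<and> filter_mset (\<lambda>k. k \<noteq> 1) \<mu> = nontrivial_cycle_type \<sigma>"


section \<open>The Thoma simplex and the extremal characters of the infinite symmetric group\<close>

text \<open>Sequences are indexed from 0.\<close>

definition thoma_simplex :: "((nat \<Rightarrow> real) \<times> (nat \<Rightarrow> real)) set" where
  "thoma_simplex = {(\<alpha>, \<beta>). decseq \<alpha> \<and> decseq \<beta> \<and> (\<forall>i. \<alpha> i \<ge> 0) \<and> (\<forall>i. \<beta> i \<ge> 0) \<and>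
     summable \<alpha> \<and> summable \<beta> \<and> (\<Sum>i. \<alpha> i) + (\<Sum>i. \<beta> i) \<le> 1}"

text \<open>Only indices \<open>k \<ge> 1\<close> are meaningful.\<close>

definition thoma_p :: "(nat \<Rightarrow> real) \<times> (nat \<Rightarrow> real) \<Rightarrow> nat \<Rightarrow> real" where
  "thoma_p \<omega> k = (if k = 1 then 1
     else (\<Sum>i. fst \<omega> i ^ k) + (- 1) ^ (k - 1) * (\<Sum>i. snd \<omega> i ^ k))"

definition thoma_p_part :: "(nat \<Rightarrow> real) \<times> (nat \<Rightarrow> real) \<Rightarrow> nat multiset \<Rightarrow> real" where
  "thoma_p_part \<omega> \<mu> = (\<Prod>k\<in>#\<mu>. thoma_p \<omega> k)"

definition thoma_character :: "(nat \<Rightarrow> real) \<times> (nat \<Rightarrow> real) \<Rightarrow> (nat \<Rightarrow> nat) \<Rightarrow> real" where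
  "thoma_character \<omega> \<sigma> = thoma_p_part \<omega> (nontrivial_cycle_type \<sigma>)"


section \<open>Irreducible characters of the symmetric groups\<close>

subsection \<open>Complex vector spaces of functions and the trace\<close>

definition cscale :: "complex \<Rightarrow> ('a \<Rightarrow> complex) \<Rightarrow> 'a \<Rightarrow> complex" where
  "cscale c f = (\<lambda>x. c * f x)"

global_interpretation cfun: vector_space "cscale :: complex \<Rightarrow> ('a \<Rightarrow> complex) \<Rightarrow> 'a \<Rightarrow> complex"
  by unfold_locales (auto simp: cscale_def fun_eq_iff algebra_simps)

text \<open>Trace of a linear endomorphism of a finite-dimensional subspace \<open>V\<close>, computed in an arbitrary
  basis of \<open>V\<close> (on which it does not depend).\<close>

definition trace_on :: "('a \<Rightarrow> complex) set \<Rightarrow> (('a \<Rightarrow> complex) \<Rightarrow> ('a \<Rightarrow> complex)) \<Rightarrow> complex" where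
  "trace_on V T = (let B = (SOME B. cfun.independent B \<and> B \<subseteq> V \<and> V \<subseteq> cfun.span B)
     in \<Sum>b\<in>B. cfun.representation B (T b) b)"

subsection \<open>Young symmetrizers\<close>

text \<open>Elements of the complex group algebra of \<open>sym_group n\<close> are functions vanishing outside \<open>sym_group n\<close>;
  \<open>gprod\<close> is its (convolution) product, not to be confused with the pointwise product.\<close>

definition group_algebra :: "nat \<Rightarrow> ((nat \<Rightarrow> nat) \<Rightarrow> complex) set" where
  "group_algebra n = {f. \<forall>p. p \<notin> sym_group n \<longrightarrow> f p = 0}"

definition gprod :: "nat \<Rightarrow> ((nat \<Rightarrow> nat) \<Rightarrow> complex) \<Rightarrow> ((nat \<Rightarrow> nat) \<Rightarrow> complex)
    \<Rightarrow> (nat \<Rightarrow> nat) \<Rightarrow> complex" where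
  "gprod n f g = (\<lambda>s. \<Sum>p\<in>sym_group n. f p * g (inv p \<circ> s))"

definition left_mult :: "(nat \<Rightarrow> nat) \<Rightarrow> ((nat \<Rightarrow> nat) \<Rightarrow> complex) \<Rightarrow> (nat \<Rightarrow> nat) \<Rightarrow> complex" where
  "left_mult \<sigma> f = (\<lambda>s. f (inv \<sigma> \<circ> s))"

definition row_lengths :: "nat multiset \<Rightarrow> nat list" where
  "row_lengths lam = rev (sorted_list_of_multiset lam)"

definition young_diagram :: "nat multiset \<Rightarrow> (nat \<times> nat) set" where
  "young_diagram lam = {(i, j). i < length (row_lengths lam) \<and> j < row_lengths lam ! i}"

text \<open>The Young tableau of shape \<open>lam\<close> filled with \<open>1, \<dots>, n\<close> row by row.\<close>

definition tableau :: "nat multiset \<Rightarrow> nat \<times> nat \<Rightarrow> nat" where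
  "tableau lam = (\<lambda>(i, j). sum_list (take i (row_lengths lam)) + j + 1)"

definition row_group :: "nat multiset \<Rightarrow> (nat \<Rightarrow> nat) set" where
  "row_group lam = {p \<in> sym_group (\<Sum>\<^sub># lam). \<forall>(i, j) \<in> young_diagram lam.
     \<exists>j'. (i, j') \<in> young_diagram lam \<and> p (tableau lam (i, j)) = tableau lam (i, j')}"

definition column_group :: "nat multiset \<Rightarrow> (nat \<Rightarrow> nat) set" where
  "column_group lam = {p \<in> sym_group (\<Sum>\<^sub># lam). \<forall>(i, j) \<in> young_diagram lam.
     \<exists>i'. (i', j) \<in> young_diagram lam \<and> p (tableau lam (i, j)) = tableau lam (i', j)}"

definition row_symmetrizer :: "nat multiset \<Rightarrow> (nat \<Rightarrow> nat) \<Rightarrow> complex" where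
  "row_symmetrizer lam = (\<lambda>p. if p \<in> row_group lam then 1 else 0)"

definition column_antisymmetrizer :: "nat multiset \<Rightarrow> (nat \<Rightarrow> nat) \<Rightarrow> complex" where
  "column_antisymmetrizer lam = (\<lambda>p. if p \<in> column_group lam then of_int (sign p) else 0)"

definition young_symmetrizer :: "nat multiset \<Rightarrow> (nat \<Rightarrow> nat) \<Rightarrow> complex" where
  "young_symmetrizer lam = gprod (\<Sum>\<^sub># lam) (row_symmetrizer lam) (column_antisymmetrizer lam)"

subsection \<open>Specht modules and their characters\<close>

text \<open>The irreducible representation labelled by \<open>lam\<close> is the left ideal generated by the Young
  symmetrizer. For a single row this is the trivial representation.\<close>

definition specht_module :: "nat multiset \<Rightarrow> ((nat \<Rightarrow> nat) \<Rightarrow> complex) set" where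
  "specht_module lam = (\<lambda>f. gprod (\<Sum>\<^sub># lam) f (young_symmetrizer lam)) ` group_algebra (\<Sum>\<^sub># lam)"

definition irr_character :: "nat multiset \<Rightarrow> (nat \<Rightarrow> nat) \<Rightarrow> complex" where
  "irr_character lam \<sigma> = trace_on (specht_module lam) (left_mult \<sigma>)"

definition norm_character :: "nat multiset \<Rightarrow> (nat \<Rightarrow> nat) \<Rightarrow> complex" where
  "norm_character lam \<sigma> = irr_character lam \<sigma> / irr_character lam id"


section \<open>Central measures and the rescaled fluctuations of characters\<close>

definition is_central_measure ::
  "nat \<Rightarrow> (nat \<Rightarrow> real) \<times> (nat \<Rightarrow> real) \<Rightarrow> nat multiset pmf \<Rightarrow> bool" where
  "is_central_measure n \<omega> P \<longleftrightarrow> set_pmf P \<subseteq> partitions n \<and>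
     (\<forall>\<sigma> \<in> sym_group n. complex_of_real (thoma_character \<omega> \<sigma>) =
        (\<Sum>lam \<in> partitions n. complex_of_real (pmf P lam) * norm_character lam \<sigma>))"

text \<open>The characters of the symmetric groups are real-valued, so \<open>Re\<close> is only a change of type.\<close>

definition Delta :: "nat \<Rightarrow> (nat \<Rightarrow> real) \<times> (nat \<Rightarrow> real) \<Rightarrow> nat multiset \<Rightarrow> (nat \<Rightarrow> nat) \<Rightarrow> real" where
  "Delta n \<omega> lam \<sigma> = sqrt (real n) * (Re (norm_character lam \<sigma>) - thoma_character \<omega> \<sigma>)"


section \<open>Convergence in law and Gaussian vectors\<close>

text \<open>The library's \<open>weak_conv_m\<close> only covers measures on the real line.\<close>

definition converges_in_law :: "(nat \<Rightarrow> 'a::euclidean_space measure) \<Rightarrow> 'a measure \<Rightarrow> bool" where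
  "converges_in_law M N \<longleftrightarrow> (\<forall>f :: 'a \<Rightarrow> real. continuous_on UNIV f \<and> bounded (range f) \<longrightarrow>
     (\<lambda>n. LINT x|M n. f x) \<longlonglongrightarrow> (LINT x|N. f x))"

text \<open>A centered Gaussian vector is one all of whose linear functionals are centered Gaussian
  variables, the constant 0 counting as the Gaussian variable with variance 0.\<close>

definition centered_gaussian :: "real measure \<Rightarrow> bool" where
  "centered_gaussian D \<longleftrightarrow>
     D = return borel 0 \<or> (\<exists>s>0. D = density lborel (\<lambda>x. ennreal (normal_density 0 s x)))"

definition centered_gaussian_vector :: "'a::euclidean_space measure \<Rightarrow> bool" where
  "centered_gaussian_vector N \<longleftrightarrow> prob_space N \<and> sets N = sets borel \<and>
     (\<forall>u. centered_gaussian (distr N borel (\<lambda>x. u \<bullet> x)))"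

definition covariance :: "'a measure \<Rightarrow> ('a \<Rightarrow> real) \<Rightarrow> ('a \<Rightarrow> real) \<Rightarrow> real" where
  "covariance M X Y = (LINT x|M. (X x - (LINT y|M. X y)) * (Y x - (LINT y|M. Y y)))"

end

theory Submission
  imports Defs
begin

text \<open>
  The row and column groups of a tableau show that \<open>a x b\<close>, for the row symmetrizer \<open>a\<close> and the column
  antisymmetrizer \<open>b\<close>, is a real multiple of the Young symmetrizer. Hence averages over conjugacy
  classes act on the Specht module by real scalars, which are the normalized characters; so these are real and
  satisfy \<open>\<chi>(\<sigma>) \<chi>(\<tau>) = avg\<^sub>g \<chi>(\<sigma> g \<tau> g\<inverse>)\<close>. Consequently the expectation of a product of characters of a
  random partition is the average of the Thoma character over products of random conjugates.

  For a linear combination \<open>Z\<close> of the centered characters this writes the \<open>k\<close>-th moment as an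
  average of centered products over \<open>k\<close> random conjugates. The Thoma character is multiplicative on disjoint
  supports, so a centered product vanishes if one of the supports is disjoint from all others, and a pair of supports
  which meet only each other splits off. As supports meet with probability \<open>O(1/n)\<close>, this gives
  \<open>E Z^k = (k - 1) E Z^2 E Z^(k - 2) + O(n^(-(k + 1)/2))\<close>: after rescaling, the recursion of the Gaussian moments.
  The covariance comes from pairs of supports with a single common point, where a cycle of length \<open>a\<close> and one of
  length \<open>b\<close> merge into one of length \<open>a + b - 1\<close>.
\<close>

section \<open>The central characters of the symmetric group\<close>

text \<open>The difficulty is the rate: the \<open>k\<close>-th moment must be known up to an error
  smaller than \<open>n^(-k/2)\<close>. A graph without isolated vertices on \<open>k\<close> random
  supports has at least \<open>k/2\<close> edges, each of probability \<open>O(1/n)\<close>. The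
  order \<open>n^(-k/2)\<close> is therefore reached only if all components are pairs, and a third
  support attached to a pair costs a further factor \<open>n^(-1/2)\<close>. Splitting off one fixed
  support with its partner is enough: it yields the recursion, and the count of all pairings is left
  to the recursion. The weights of the conjugates carry the coefficients of \<open>Z\<close> and may
  be negative, so the graph estimates are made for absolute values. For vectors, the moments of all
  linear functionals give the characteristic functions, hence the limits of integrals of
  trigonometric polynomials; bounded second moments control the mass far from the origin, which
  extends this to bounded continuous functions. The covariance formula is seen to be positive
  semidefinite because it is a limit of second moments, and this is what produces the Gaussian
  vector.\<close>

lemma finite_sym_group: "finite (sym_group n)"
  by (simp add: sym_group_def finite_permutations)

lemma sym_group_id: "id \<in> sym_group n"
  by (simp add: sym_group_def permutes_id)

lemma sym_group_comp: "p \<in> sym_group n \<Longrightarrow> q \<in> sym_group n \<Longrightarrow> p \<circ> q \<in> sym_group n"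
  by (simp add: sym_group_def permutes_compose)

lemma sym_group_inv: "p \<in> sym_group n \<Longrightarrow> inv p \<in> sym_group n"
  by (simp add: sym_group_def permutes_inv)

lemma sym_group_bij: "p \<in> sym_group n \<Longrightarrow> bij p"
  by (auto simp: sym_group_def permutes_bij)

lemma card_sym_group: "card (sym_group n) = fact n"
  using card_permutations[of "{1..n}" n] by (simp add: sym_group_def)

lemma bij_inv_comp: "bij p \<Longrightarrow> inv p \<circ> p = id" "bij p \<Longrightarrow> p \<circ> inv p = id"
  by (auto simp: bij_is_inj bij_is_surj surj_iff[symmetric])

lemma bij_inv_comp_assoc: "bij p \<Longrightarrow> inv p \<circ> (p \<circ> q) = q" "bij p \<Longrightarrow> p \<circ> (inv p \<circ> q) = q"
  by (metis bij_inv_comp comp_assoc id_comp)+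

definition conj_by :: "('a \<Rightarrow> 'a) \<Rightarrow> ('a \<Rightarrow> 'a) \<Rightarrow> 'a \<Rightarrow> 'a" where
  "conj_by g s = g \<circ> s \<circ> inv g"

lemma conj_by_comp: "bij x \<Longrightarrow> bij g \<Longrightarrow> conj_by (x \<circ> g) s = conj_by x (conj_by g s)"
  by (simp add: conj_by_def o_inv_distrib comp_assoc)

lemma conj_by_mult: "bij g \<Longrightarrow> conj_by g (s \<circ> t) = conj_by g s \<circ> conj_by g t"
  by (simp add: conj_by_def comp_assoc bij_inv_comp_assoc)

lemma sym_group_conj: "g \<in> sym_group n \<Longrightarrow> s \<in> sym_group n \<Longrightarrow> conj_by g s \<in> sym_group n"
  by (simp add: conj_by_def sym_group_comp sym_group_inv)

lemma sum_sym_group_left: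
  assumes "x \<in> sym_group n"
  shows "(\<Sum>g\<in>sym_group n. F (x \<circ> g)) = (\<Sum>g\<in>sym_group n. F g)"
  by (rule sum.reindex_bij_witness[of _ "\<lambda>g. inv x \<circ> g" "\<lambda>g. x \<circ> g"])
     (use assms in \<open>auto simp: bij_inv_comp_assoc sym_group_bij sym_group_comp sym_group_inv\<close>)

lemma sum_sym_group_right:
  assumes "x \<in> sym_group n"
  shows "(\<Sum>g\<in>sym_group n. F (g \<circ> x)) = (\<Sum>g\<in>sym_group n. F g)"
  by (rule sum.reindex_bij_witness[of _ "\<lambda>g. g \<circ> inv x" "\<lambda>g. g \<circ> x"])
     (use assms in \<open>auto simp: comp_assoc bij_inv_comp sym_group_bij sym_group_comp sym_group_inv\<close>)


subsection \<open>The tableau\<close>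

text \<open>Adding a last row leaves the numbers of the earlier cells as they are, and the new cells
  take the next interval; hence the induction from the end of the list.\<close>

lemma bij_betw_list_cells:
  "bij_betw (\<lambda>(i, j). sum_list (take i xs) + j + 1) {(i, j). i < length xs \<and> j < xs ! i} {1..sum_list (xs::nat list)}"
proof (induction xs rule: rev_induct)
  case Nil
  then show ?case by (simp add: bij_betw_def)
next
  case (snoc y xs)
  let ?f = "\<lambda>xs (i, j). sum_list (take i xs) + j + (1::nat)"
  let ?A = "{(i, j). i < length xs \<and> j < xs ! i}"
  have A: "{(i, j). i < length (xs @ [y]) \<and> j < (xs @ [y]) ! i} = ?A \<union> {length xs} \<times> {..<y}"
    by (auto simp: nth_append less_Suc_eq)
  have 1: "bij_betw (?f (xs @ [y])) ?A {1..sum_list xs}"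
    using snoc by (rule bij_betw_cong[THEN iffD1, rotated]) auto
  have 2: "bij_betw (?f (xs @ [y])) ({length xs} \<times> {..<y}) {sum_list xs + 1..sum_list xs + y}"
    by (rule bij_betw_byWitness[where f' = "\<lambda>k. (length xs, k - sum_list xs - 1)"]) auto
  have "{1..sum_list (xs @ [y])} = {1..sum_list xs} \<union> {sum_list xs + 1..sum_list xs + y}"
    by auto
  then show ?case
    unfolding A using bij_betw_combine[OF 1 2] by auto
qed

lemma sum_list_row_lengths: "sum_list (row_lengths lam) = \<Sum>\<^sub># lam"
  by (simp add: row_lengths_def sum_mset_sum_list[symmetric])

lemma bij_betw_tableau: "bij_betw (tableau lam) (young_diagram lam) {1..\<Sum>\<^sub># lam}"
  using bij_betw_list_cells[of "row_lengths lam"]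
  by (simp add: tableau_def young_diagram_def sum_list_row_lengths)

text \<open>Coordinates as functions of the entry rather than of the cell: the row and column groups
  become the permutations that preserve \<open>tab_row\<close> or \<open>tab_col\<close>, and their
  closure under products and inverses can be read off.\<close>

definition tab_row :: "nat multiset \<Rightarrow> nat \<Rightarrow> nat" where
  "tab_row lam k = fst (inv_into (young_diagram lam) (tableau lam) k)"

definition tab_col :: "nat multiset \<Rightarrow> nat \<Rightarrow> nat" where
  "tab_col lam k = snd (inv_into (young_diagram lam) (tableau lam) k)"

lemma tab_cell:
  assumes "k \<in> {1..\<Sum>\<^sub># lam}"
  shows "(tab_row lam k, tab_col lam k) \<in> young_diagram lam"
    and "tableau lam (tab_row lam k, tab_col lam k) = k"
  using assms bij_betw_tableau[of lam]
  by (auto simp: tab_row_def tab_col_def bij_betw_def intro: inv_into_into f_inv_into_f)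

lemma tab_tableau:
  assumes "(i, j) \<in> young_diagram lam"
  shows "tableau lam (i, j) \<in> {1..\<Sum>\<^sub># lam}" "tab_row lam (tableau lam (i, j)) = i" "tab_col lam (tableau lam (i, j)) = j"
  using assms bij_betw_tableau[of lam] inv_into_f_f[of "tableau lam" "young_diagram lam" "(i, j)"]
  unfolding tab_row_def tab_col_def bij_betw_def by auto

lemma row_group_iff:
  "p \<in> row_group lam \<longleftrightarrow> p \<in> sym_group (\<Sum>\<^sub># lam) \<and> (\<forall>k\<in>{1..\<Sum>\<^sub># lam}. tab_row lam (p k) = tab_row lam k)"
    (is "?l \<longleftrightarrow> ?r")
proof
  assume l: ?l
  have "tab_row lam (p k) = tab_row lam k" if k: "k \<in> {1..\<Sum>\<^sub># lam}" for k
  proof -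
    have "\<forall>(i, j) \<in> young_diagram lam. \<exists>j'. (i, j') \<in> young_diagram lam \<and> p (tableau lam (i, j)) = tableau lam (i, j')"
      using l by (simp add: row_group_def)
    from bspec[OF this tab_cell(1)[OF k]]
    obtain j' where "(tab_row lam k, j') \<in> young_diagram lam" "p k = tableau lam (tab_row lam k, j')"
      using tab_cell(2)[OF k] by auto
    then show ?thesis using tab_tableau(2) by metis
  qed
  then show ?r using l by (auto simp: row_group_def)
next
  assume r: ?r
  have "\<exists>j'. (i, j') \<in> young_diagram lam \<and> p (tableau lam (i, j)) = tableau lam (i, j')"
    if ij: "(i, j) \<in> young_diagram lam" for i j
  proof -
    let ?k = "tableau lam (i, j)"
    have k: "?k \<in> {1..\<Sum>\<^sub># lam}" by (rule tab_tableau[OF ij])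
    then have pk: "p ?k \<in> {1..\<Sum>\<^sub># lam}"
      using r permutes_in_image[of p "{1..\<Sum>\<^sub># lam}"] by (auto simp: sym_group_def)
    have "tab_row lam (p ?k) = i" using r k tab_tableau[OF ij] by auto
    then show ?thesis using tab_cell[OF pk] by metis
  qed
  then show ?l using r by (auto simp: row_group_def)
qed

lemma column_group_iff:
  "p \<in> column_group lam \<longleftrightarrow> p \<in> sym_group (\<Sum>\<^sub># lam) \<and> (\<forall>k\<in>{1..\<Sum>\<^sub># lam}. tab_col lam (p k) = tab_col lam k)"
    (is "?l \<longleftrightarrow> ?r")
proof
  assume l: ?l
  have "tab_col lam (p k) = tab_col lam k" if k: "k \<in> {1..\<Sum>\<^sub># lam}" for k
  proof -
    have "\<forall>(i, j) \<in> young_diagram lam. \<exists>i'. (i', j) \<in> young_diagram lam \<and> p (tableau lam (i, j)) = tableau lam (i', j)"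
      using l by (simp add: column_group_def)
    from bspec[OF this tab_cell(1)[OF k]]
    obtain j' where "(j', tab_col lam k) \<in> young_diagram lam" "p k = tableau lam (j', tab_col lam k)"
      using tab_cell(2)[OF k] by auto
    then show ?thesis using tab_tableau(3) by metis
  qed
  then show ?r using l by (auto simp: column_group_def)
next
  assume r: ?r
  have "\<exists>j'. (j', j) \<in> young_diagram lam \<and> p (tableau lam (i, j)) = tableau lam (j', j)"
    if ij: "(i, j) \<in> young_diagram lam" for i j
  proof -
    let ?k = "tableau lam (i, j)"
    have k: "?k \<in> {1..\<Sum>\<^sub># lam}" by (rule tab_tableau[OF ij])
    then have pk: "p ?k \<in> {1..\<Sum>\<^sub># lam}"
      using r permutes_in_image[of p "{1..\<Sum>\<^sub># lam}"] by (auto simp: sym_group_def)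
    have "tab_col lam (p ?k) = j" using r k tab_tableau[OF ij] by auto
    then show ?thesis using tab_cell[OF pk] by metis
  qed
  then show ?l using r by (auto simp: column_group_def)
qed

lemma tab_inj:
  assumes "k \<in> {1..\<Sum>\<^sub># lam}" "l \<in> {1..\<Sum>\<^sub># lam}" "tab_row lam k = tab_row lam l" "tab_col lam k = tab_col lam l"
  shows "k = l"
  using assms tab_cell by metis

lemma sym_group_mem: "p \<in> sym_group n \<Longrightarrow> p k \<in> {1..n} \<longleftrightarrow> k \<in> {1..n}"
  using permutes_in_image[of p "{1..n}" k] by (simp only: sym_group_def mem_Collect_eq)

lemma row_group_comp: "p \<in> row_group lam \<Longrightarrow> q \<in> row_group lam \<Longrightarrow> p \<circ> q \<in> row_group lam"
  by (auto simp: row_group_iff sym_group_comp sym_group_mem simp del: atLeastAtMost_iff One_nat_def)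

lemma row_group_inv:
  assumes "p \<in> row_group lam" shows "inv p \<in> row_group lam"
proof -
  have p: "p \<in> sym_group (\<Sum>\<^sub># lam)" using assms by (simp add: row_group_iff)
  have "tab_row lam (inv p k) = tab_row lam k" if "k \<in> {1..\<Sum>\<^sub># lam}" for k
  proof -
    have "inv p k \<in> {1..\<Sum>\<^sub># lam}" using sym_group_mem[OF sym_group_inv[OF p]] that by blast
    then have "tab_row lam (p (inv p k)) = tab_row lam (inv p k)" using assms by (simp only: row_group_iff)
    then show ?thesis using sym_group_bij[OF p] by (simp add: bij_is_surj surj_f_inv_f)
  qed
  then show ?thesis using p by (simp add: row_group_iff sym_group_inv)
qed

lemma column_group_comp: "p \<in> column_group lam \<Longrightarrow> q \<in> column_group lam \<Longrightarrow> p \<circ> q \<in> column_group lam"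
  by (auto simp: column_group_iff sym_group_comp sym_group_mem simp del: atLeastAtMost_iff One_nat_def)

lemma column_group_inv:
  assumes "p \<in> column_group lam" shows "inv p \<in> column_group lam"
proof -
  have p: "p \<in> sym_group (\<Sum>\<^sub># lam)" using assms by (simp add: column_group_iff)
  have "tab_col lam (inv p k) = tab_col lam k" if "k \<in> {1..\<Sum>\<^sub># lam}" for k
  proof -
    have "inv p k \<in> {1..\<Sum>\<^sub># lam}" using sym_group_mem[OF sym_group_inv[OF p]] that by blast
    then have "tab_col lam (p (inv p k)) = tab_col lam (inv p k)" using assms by (simp only: column_group_iff)
    then show ?thesis using sym_group_bij[OF p] by (simp add: bij_is_surj surj_f_inv_f)
  qed
  then show ?thesis using p by (simp add: column_group_iff sym_group_inv)
qed

lemma row_group_sym_group: "p \<in> row_group lam \<Longrightarrow> p \<in> sym_group (\<Sum>\<^sub># lam)"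
  by (simp add: row_group_def)

lemma column_group_sym_group: "p \<in> column_group lam \<Longrightarrow> p \<in> sym_group (\<Sum>\<^sub># lam)"
  by (simp add: column_group_def)

text \<open>By \<open>tab_inj\<close> an entry is determined by its row and its column, so a
  permutation that preserves both fixes it.\<close>

lemma row_column_group_id:
  assumes "p \<in> row_group lam" "p \<in> column_group lam" shows "p = id"
proof
  fix k
  show "p k = id k"
  proof (cases "k \<in> {1..\<Sum>\<^sub># lam}")
    case True
    then show ?thesis
      using assms tab_inj[of "p k" lam k] sym_group_mem[of p "\<Sum>\<^sub># lam" k] by (auto simp: row_group_iff column_group_iff)
  next
    case False
    then show ?thesis
      using assms permutes_not_in[of p "{1..\<Sum>\<^sub># lam}" k] by (auto simp: row_group_iff sym_group_def)
  qed
qed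

lemma card_row:
  assumes "i < length (row_lengths lam)"
  shows "card {m\<in>{1..\<Sum>\<^sub># lam}. tab_row lam m = i \<and> tab_col lam m < j} = min (row_lengths lam ! i) j"
proof -
  have "bij_betw (tab_col lam) {m\<in>{1..\<Sum>\<^sub># lam}. tab_row lam m = i \<and> tab_col lam m < j} {..<min (row_lengths lam ! i) j}"
  proof (rule bij_betw_byWitness[where f' = "\<lambda>c. tableau lam (i, c)"])
    show "\<forall>a\<in>{m\<in>{1..\<Sum>\<^sub># lam}. tab_row lam m = i \<and> tab_col lam m < j}. tableau lam (i, tab_col lam a) = a"
      using tab_cell by blast
    show "\<forall>a'\<in>{..<min (row_lengths lam ! i) j}. tab_col lam (tableau lam (i, a')) = a'"
      using assms by (auto intro!: tab_tableau(3) simp: young_diagram_def)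
    show "tab_col lam ` {m \<in> {1..\<Sum>\<^sub># lam}. tab_row lam m = i \<and> tab_col lam m < j} \<subseteq> {..<min (row_lengths lam ! i) j}"
      using tab_cell(1)[of _ lam] by (auto simp: young_diagram_def)
    have "c < j \<Longrightarrow> c < row_lengths lam ! i \<Longrightarrow> (i, c) \<in> young_diagram lam" for c
      using assms by (auto simp: young_diagram_def)
    then show "(\<lambda>c. tableau lam (i, c)) ` {..<min (row_lengths lam ! i) j} \<subseteq> {m \<in> {1..\<Sum>\<^sub># lam}. tab_row lam m = i \<and> tab_col lam m < j}"
      using tab_tableau[of i _ lam] by fastforce
  qed
  then show ?thesis by (simp add: bij_betw_same_card)
qed

text \<open>Counting the cells in the first columns shows that a filling with the row and column counts of a
  diagram and no repeated cell has the shape of that diagram.\<close>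

lemma col_less_row_length:
  assumes x: "x \<in> sym_group (\<Sum>\<^sub># lam)"
    and inj: "\<And>k l. k \<in> {1..\<Sum>\<^sub># lam} \<Longrightarrow> l \<in> {1..\<Sum>\<^sub># lam} \<Longrightarrow> tab_row lam k = tab_row lam l \<Longrightarrow>
      tab_col lam (x k) = tab_col lam (x l) \<Longrightarrow> k = l"
    and m: "m \<in> {1..\<Sum>\<^sub># lam}"
  shows "tab_col lam (x m) < row_lengths lam ! tab_row lam m"
proof -
  let ?N = "{1..\<Sum>\<^sub># lam}" let ?r = "tab_row lam" let ?c = "tab_col lam" let ?L = "length (row_lengths lam)"
  define i0 where "i0 = tab_row lam m"
  \<comment> \<open>The columns below the length of the row of \<open>m\<close> are tested: the
    claim follows once \<open>x\<close> sends this whole row there.\<close>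
  define j where "j = row_lengths lam ! i0"
  have row: "?r k < ?L" if "k \<in> ?N" for k
    using tab_cell(1)[OF that] by (auto simp: young_diagram_def)
  have split: "card {k\<in>?N. R k} = (\<Sum>i<?L. card {k\<in>?N. ?r k = i \<and> R k})" for R
  proof -
    have "{k\<in>?N. R k} = (\<Union>i<?L. {k\<in>?N. ?r k = i \<and> R k})" using row by auto
    then show ?thesis by (simp only:) (subst card_UN_disjoint; auto)
  qed
  \<comment> \<open>Distinct columns within a row allow at most \<open>j\<close> of them below
    \<open>j\<close>, and the row length is another bound; the minimum of the two is the count for
    the diagram itself.\<close>
  have le: "card {k\<in>?N. ?r k = i \<and> ?c (x k) < j} \<le> card {k\<in>?N. ?r k = i \<and> ?c k < j}" if i: "i < ?L" for i
  proof -
    have "inj_on (\<lambda>k. ?c (x k)) {k\<in>?N. ?r k = i \<and> ?c (x k) < j}"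
    proof (rule inj_onI)
      fix k l assume "k \<in> {k\<in>?N. ?r k = i \<and> ?c (x k) < j}" "l \<in> {k\<in>?N. ?r k = i \<and> ?c (x k) < j}"
        and e: "?c (x k) = ?c (x l)"
      then have "k \<in> ?N" "l \<in> ?N" "?r k = ?r l" by simp_all
      then show "k = l" using e by (rule inj)
    qed
    then have a: "card {k\<in>?N. ?r k = i \<and> ?c (x k) < j} \<le> card {..<j}"
      by (rule card_inj_on_le) auto
    have "{k\<in>?N. ?r k = i \<and> ?c (x k) < j} \<subseteq> {k\<in>?N. ?r k = i \<and> ?c k < row_lengths lam ! i}"
      using tab_cell(1)[of _ lam] by (auto simp: young_diagram_def)
    then have "card {k\<in>?N. ?r k = i \<and> ?c (x k) < j} \<le> row_lengths lam ! i"
      using card_mono[of "{k\<in>?N. ?r k = i \<and> ?c k < row_lengths lam ! i}" "{k\<in>?N. ?r k = i \<and> ?c (x k) < j}"]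
        card_row[OF i, of "row_lengths lam ! i"] by simp
    then show ?thesis using a card_row[OF i] by simp
  qed
  have "card {k\<in>?N. ?c (x k) < j} = card {k\<in>?N. ?c k < j}"
  proof -
    have "bij_betw x {k\<in>?N. ?c (x k) < j} {k\<in>?N. ?c k < j}"
    proof (rule bij_betw_byWitness[where f' = "inv x"])
      have xx: "inv x (x k) = k" "x (inv x k) = k" for k
        using sym_group_bij[OF x] by (simp_all add: bij_is_inj bij_is_surj surj_f_inv_f)
      show "\<forall>a\<in>{k\<in>?N. ?c (x k) < j}. inv x (x a) = a" "\<forall>a'\<in>{k\<in>?N. ?c k < j}. x (inv x a') = a'"
        using xx by blast+
      show "x ` {k\<in>?N. ?c (x k) < j} \<subseteq> {k\<in>?N. ?c k < j}"
        using sym_group_mem[OF x] by blast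
      show "inv x ` {k\<in>?N. ?c k < j} \<subseteq> {k\<in>?N. ?c (x k) < j}"
      proof
        fix k assume "k \<in> inv x ` {k\<in>?N. ?c k < j}"
        then obtain l where "k = inv x l" "l \<in> ?N" "?c l < j" by blast
        then show "k \<in> {k\<in>?N. ?c (x k) < j}"
          using xx(2)[of l] sym_group_mem[OF sym_group_inv[OF x], of l] by (simp del: One_nat_def)
      qed
    qed
    then show ?thesis by (rule bij_betw_same_card)
  qed
  then have eq: "(\<Sum>i<?L. card {k\<in>?N. ?r k = i \<and> ?c (x k) < j}) = (\<Sum>i<?L. card {k\<in>?N. ?r k = i \<and> ?c k < j})"
    using split[of "\<lambda>k. ?c (x k) < j"] split[of "\<lambda>k. ?c k < j"] by simp
  have i0: "i0 < ?L" using row m by (simp add: i0_def)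
  \<comment> \<open>The totals over all rows agree because \<open>x\<close> is a bijection, so each
    of the rowwise inequalities is an equality.\<close>
  have "card {k\<in>?N. ?r k = i0 \<and> ?c (x k) < j} = card {k\<in>?N. ?r k = i0 \<and> ?c k < j}"
    by (rule sum_mono_inv[OF eq]) (use le i0 in auto)
  also have "{k\<in>?N. ?r k = i0 \<and> ?c k < j} = {k\<in>?N. ?r k = i0}"
    using tab_cell(1)[of _ lam] by (auto simp: young_diagram_def j_def)
  finally have "{k\<in>?N. ?r k = i0 \<and> ?c (x k) < j} = {k\<in>?N. ?r k = i0}"
    by (intro card_subset_eq) auto
  then show ?thesis using m by (auto simp: i0_def j_def)
qed

text \<open>\<open>p\<close> carries each entry \<open>k\<close>, within its row, to the column in
  which \<open>inv x k\<close> stands. That cell exists by \<open>col_less_row_length\<close>, and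
  the hypothesis makes \<open>p\<close> injective. Then \<open>p \<circ> x\<close> preserves
  columns, and \<open>x = inv p \<circ> (p \<circ> x)\<close>.\<close>

lemma row_column_decomp:
  assumes x: "x \<in> sym_group (\<Sum>\<^sub># lam)"
    and inj: "\<And>k l. k \<in> {1..\<Sum>\<^sub># lam} \<Longrightarrow> l \<in> {1..\<Sum>\<^sub># lam} \<Longrightarrow> tab_row lam k = tab_row lam l \<Longrightarrow>
      tab_col lam (inv x k) = tab_col lam (inv x l) \<Longrightarrow> k = l"
  shows "\<exists>p\<in>row_group lam. \<exists>q\<in>column_group lam. x = p \<circ> q"
proof -
  let ?N = "{1..\<Sum>\<^sub># lam}" let ?r = "tab_row lam" let ?c = "tab_col lam"
  define p where "p k = (if k \<in> ?N then tableau lam (?r k, ?c (inv x k)) else k)" for k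
  have Y: "(?r k, ?c (inv x k)) \<in> young_diagram lam" if "k \<in> ?N" for k
  proof -
    have "?c (inv x k) < row_lengths lam ! ?r k"
      by (rule col_less_row_length[OF sym_group_inv[OF x] _ that]) (erule (3) inj)
    then show ?thesis using tab_cell(1)[OF that] by (simp add: young_diagram_def)
  qed
  have pN: "p k \<in> ?N" and pr: "?r (p k) = ?r k" and pc: "?c (p k) = ?c (inv x k)" if "k \<in> ?N" for k
    using tab_tableau[OF Y[OF that]] that by (simp_all add: p_def)
  have "inj_on p ?N"
  proof (rule inj_onI)
    fix k l assume kl: "k \<in> ?N" "l \<in> ?N" and e: "p k = p l"
    have "?r k = ?r l" using pr[OF kl(1)] pr[OF kl(2)] e by simp
    moreover have "?c (inv x k) = ?c (inv x l)" using pc[OF kl(1)] pc[OF kl(2)] e by simp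
    ultimately show "k = l" by (rule inj[OF kl])
  qed
  then have "bij_betw p ?N ?N"
    using pN by (intro bij_betw_imageI endo_inj_surj) auto
  then have "p permutes ?N" by (rule bij_imp_permutes) (auto simp: p_def)
  then have p: "p \<in> row_group lam" using pr by (auto simp: row_group_iff sym_group_def)
  have ps: "p \<in> sym_group (\<Sum>\<^sub># lam)" using p by (simp add: row_group_sym_group)
  have "p \<circ> x \<in> column_group lam"
    using pc sym_group_comp[OF ps x] sym_group_mem[OF x] sym_group_bij[OF x]
    by (auto simp: column_group_iff bij_is_inj)
  moreover have "x = inv p \<circ> (p \<circ> x)" using ps by (simp add: bij_inv_comp_assoc sym_group_bij)
  ultimately show ?thesis using row_group_inv[OF p] by blast
qed

subsection \<open>The Young symmetrizer\<close>

lemma sym_group_permutation: "p \<in> sym_group n \<Longrightarrow> permutation p"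
  by (auto simp: sym_group_def permutation_permutes)

lemma comp_mem_iff_right:
  assumes "p0 \<in> H" "bij p0" "\<And>p q. p \<in> H \<Longrightarrow> q \<in> H \<Longrightarrow> p \<circ> q \<in> H" "\<And>p. p \<in> H \<Longrightarrow> inv p \<in> H"
  shows "p \<circ> p0 \<in> H \<longleftrightarrow> p \<in> H"
proof
  assume "p \<circ> p0 \<in> H"
  then have "(p \<circ> p0) \<circ> inv p0 \<in> H" using assms by blast
  then show "p \<in> H" using assms(2) by (simp add: comp_assoc bij_inv_comp)
qed (use assms in blast)

lemma comp_mem_iff_left:
  assumes "p0 \<in> H" "bij p0" "\<And>p q. p \<in> H \<Longrightarrow> q \<in> H \<Longrightarrow> p \<circ> q \<in> H" "\<And>p. p \<in> H \<Longrightarrow> inv p \<in> H"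
  shows "p0 \<circ> p \<in> H \<longleftrightarrow> p \<in> H"
proof
  assume "p0 \<circ> p \<in> H"
  then have "inv p0 \<circ> (p0 \<circ> p) \<in> H" using assms by blast
  then show "p \<in> H" using assms(2) by (simp add: bij_inv_comp_assoc)
qed (use assms in blast)

lemma row_symmetrizer_right:
  assumes "p0 \<in> row_group lam"
  shows "row_symmetrizer lam (p \<circ> p0) = row_symmetrizer lam p"
  unfolding row_symmetrizer_def
  using comp_mem_iff_right[OF assms sym_group_bij[OF row_group_sym_group[OF assms]] row_group_comp row_group_inv]
  by simp

lemma column_antisymmetrizer_left:
  assumes "q0 \<in> column_group lam"
  shows "column_antisymmetrizer lam (q0 \<circ> s) = of_int (sign q0) * column_antisymmetrizer lam s"
proof (cases "s \<in> column_group lam")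
  case True
  then have "sign (q0 \<circ> s) = sign q0 * sign s"
    using assms by (intro sign_compose) (auto intro: sym_group_permutation column_group_sym_group)
  then show ?thesis using True assms by (simp add: column_antisymmetrizer_def column_group_comp)
next
  case False
  then show ?thesis unfolding column_antisymmetrizer_def
    using comp_mem_iff_left[OF assms sym_group_bij[OF column_group_sym_group[OF assms]] column_group_comp column_group_inv]
    by simp
qed

text \<open>The dichotomy behind Young symmetrizers, for \<open>a x b\<close>. If
  \<open>x = p0 \<circ> q0\<close>, both factors are absorbed up to the sign of \<open>q0\<close>.
  Otherwise \<open>x\<close> sends two entries of one column into one row; the transposition of
  their images lies in the row group and is conjugate under \<open>x\<close> to one in the column
  group, which forces \<open>a x b = - a x b\<close>.\<close>

lemma row_young_symmetrizer:
  assumes x: "x \<in> sym_group (\<Sum>\<^sub># lam)"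
  shows "\<exists>k::real. \<forall>s. gprod (\<Sum>\<^sub># lam) (row_symmetrizer lam) (left_mult x (column_antisymmetrizer lam)) s =
    of_real k * young_symmetrizer lam s"
proof -
  let ?G = "sym_group (\<Sum>\<^sub># lam)"
  let ?a = "row_symmetrizer lam" let ?b = "column_antisymmetrizer lam"
  have S: "gprod (\<Sum>\<^sub># lam) ?a (left_mult x ?b) s = (\<Sum>p\<in>?G. ?a p * ?b (inv x \<circ> (inv p \<circ> s)))" for s
    by (simp add: gprod_def left_mult_def)
  have C: "young_symmetrizer lam s = (\<Sum>p\<in>?G. ?a p * ?b (inv p \<circ> s))" for s
    by (simp add: young_symmetrizer_def gprod_def)
  show ?thesis
  proof (cases "\<exists>k\<in>{1..\<Sum>\<^sub># lam}. \<exists>l\<in>{1..\<Sum>\<^sub># lam}. tab_row lam k = tab_row lam l \<and>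
      tab_col lam (inv x k) = tab_col lam (inv x l) \<and> k \<noteq> l")
    case False
    then obtain p0 q0 where pq: "p0 \<in> row_group lam" "q0 \<in> column_group lam" "x = p0 \<circ> q0"
      using row_column_decomp[OF x] by metis
    have b: "bij p0" "bij q0" using pq row_group_sym_group column_group_sym_group sym_group_bij by metis+
    have "gprod (\<Sum>\<^sub># lam) ?a (left_mult x ?b) s = of_int (sign (inv q0)) * young_symmetrizer lam s" for s
    proof -
      have "(\<Sum>p\<in>?G. ?a p * ?b (inv x \<circ> (inv p \<circ> s)))
        = (\<Sum>p\<in>?G. ?a (p \<circ> p0) * ?b (inv q0 \<circ> (inv (p \<circ> p0) \<circ> s)))"
        by (intro sum.cong) (simp_all add: row_symmetrizer_right pq(1,3) o_inv_distrib b sym_group_bij comp_assoc)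
      also have "\<dots> = (\<Sum>p\<in>?G. ?a p * ?b (inv q0 \<circ> (inv p \<circ> s)))"
        by (rule sum_sym_group_right[OF row_group_sym_group[OF pq(1)]])
      also have "\<dots> = of_int (sign (inv q0)) * (\<Sum>p\<in>?G. ?a p * ?b (inv p \<circ> s))"
        by (simp add: column_antisymmetrizer_left[OF column_group_inv[OF pq(2)]] sum_distrib_left ac_simps)
      finally show ?thesis by (simp add: S C)
    qed
    then show ?thesis by (intro exI[of _ "of_int (sign (inv q0))"]) simp
  next
    case True
    then obtain k l where kl: "k \<in> {1..\<Sum>\<^sub># lam}" "l \<in> {1..\<Sum>\<^sub># lam}" "tab_row lam k = tab_row lam l"
      "tab_col lam (inv x k) = tab_col lam (inv x l)" "k \<noteq> l" by blast
    \<comment> \<open>These satisfy \<open>t \<circ> x = x \<circ> q\<close>: the row symmetrizer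
      absorbs \<open>t\<close>, while \<open>q\<close> changes the sign of the column
      antisymmetrizer.\<close>
    define t where "t = Transposition.transpose k l"
    define q where "q = Transposition.transpose (inv x k) (inv x l)"
    have xb: "bij x" using x by (rule sym_group_bij)
    have ixb: "inv x k \<noteq> inv x l" using kl(5) xb by (metis bij_inv_eq_iff)
    have ix: "inv x k \<in> {1..\<Sum>\<^sub># lam}" "inv x l \<in> {1..\<Sum>\<^sub># lam}"
      using kl(1,2) sym_group_mem[OF sym_group_inv[OF x]] by blast+
    have t: "t \<in> row_group lam"
      using kl(1-3) by (auto simp: row_group_iff t_def sym_group_def permutes_swap_id Transposition.transpose_def)
    have q: "q \<in> column_group lam"
      using ix kl(4) by (auto simp: column_group_iff q_def sym_group_def permutes_swap_id Transposition.transpose_def)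
    have tx: "t \<circ> x = x \<circ> q" using transpose_comp_eq[OF xb] by (simp add: t_def q_def)
    have "inv x \<circ> t = inv x \<circ> (t \<circ> x) \<circ> inv x" using xb by (simp add: comp_assoc bij_inv_comp)
    also have "\<dots> = q \<circ> inv x" unfolding tx using xb by (simp add: bij_inv_comp_assoc)
    finally have xt: "inv x \<circ> t = q \<circ> inv x" .
    have bt: "bij t" using t row_group_sym_group sym_group_bij by metis
    have it: "inv t = t" by (simp add: t_def)
    have sq: "sign q = -1" using ixb by (simp add: q_def sign_swap_id)
    have "gprod (\<Sum>\<^sub># lam) ?a (left_mult x ?b) s = 0" for s
    proof -
      have "(\<Sum>p\<in>?G. ?a p * ?b (inv x \<circ> (inv p \<circ> s))) = (\<Sum>p\<in>?G. ?a (p \<circ> t) * ?b (inv x \<circ> (inv (p \<circ> t) \<circ> s)))"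
        by (rule sum_sym_group_right[OF row_group_sym_group[OF t], symmetric])
      also have "\<dots> = (\<Sum>p\<in>?G. ?a p * ?b (q \<circ> (inv x \<circ> (inv p \<circ> s))))"
      proof (intro sum.cong refl)
        fix p assume "p \<in> ?G"
        then have "inv (p \<circ> t) = t \<circ> inv p" by (simp add: o_inv_distrib bt sym_group_bij it)
        then have "inv x \<circ> (inv (p \<circ> t) \<circ> s) = (inv x \<circ> t) \<circ> (inv p \<circ> s)" by (simp add: comp_assoc)
        also have "\<dots> = q \<circ> (inv x \<circ> (inv p \<circ> s))" unfolding xt by (simp add: comp_assoc)
        finally show "?a (p \<circ> t) * ?b (inv x \<circ> (inv (p \<circ> t) \<circ> s)) = ?a p * ?b (q \<circ> (inv x \<circ> (inv p \<circ> s)))"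
          by (simp add: row_symmetrizer_right[OF t])
      qed
      also have "\<dots> = - (\<Sum>p\<in>?G. ?a p * ?b (inv x \<circ> (inv p \<circ> s)))"
        by (simp add: column_antisymmetrizer_left[OF q] sq sum_negf)
      finally show ?thesis by (simp add: S)
    qed
    then show ?thesis by (intro exI[of _ 0]) simp
  qed
qed

text \<open>Row and column group meet only in the identity, so a single term survives. The value 1
  lets identities between multiples of the Young symmetrizer be read off at \<open>id\<close>, and
  shows that the Specht module is not zero.\<close>

lemma young_symmetrizer_id: "young_symmetrizer lam id = 1"
proof -
  have "young_symmetrizer lam id = (\<Sum>p\<in>sym_group (\<Sum>\<^sub># lam). if p = id then 1 else 0)"
    unfolding young_symmetrizer_def gprod_def
  proof (intro sum.cong refl)
    fix p assume p: "p \<in> sym_group (\<Sum>\<^sub># lam)"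
    show "row_symmetrizer lam p * column_antisymmetrizer lam (inv p \<circ> id) = (if p = id then 1 else 0)"
    proof (cases "p \<in> row_group lam \<and> inv p \<in> column_group lam")
      case True
      then have "p = id"
        using row_column_group_id[of "inv p" lam] row_group_inv[of p lam] sym_group_bij[OF p]
        by (metis inv_id inv_inv_eq)
      then show ?thesis using True
        by (simp add: row_symmetrizer_def column_antisymmetrizer_def)
    next
      case False
      have "id \<in> row_group lam" "id \<in> column_group lam"
        by (simp_all add: row_group_iff column_group_iff sym_group_id)
      then have "p \<noteq> id" using False by auto
      then show ?thesis using False by (auto simp: row_symmetrizer_def column_antisymmetrizer_def)
    qed
  qed
  also have "\<dots> = 1" by (simp add: finite_sym_group sym_group_id)
  finally show ?thesis .
qed

section \<open>Class sums act on the Young symmetrizer by real scalars\<close>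

definition kappa :: "nat multiset \<Rightarrow> (nat \<Rightarrow> nat) \<Rightarrow> real" where
  "kappa lam x = (SOME k. \<forall>s. gprod (\<Sum>\<^sub># lam) (row_symmetrizer lam) (left_mult x (column_antisymmetrizer lam)) s =
    of_real k * young_symmetrizer lam s)"

lemma kappa:
  "x \<in> sym_group (\<Sum>\<^sub># lam) \<Longrightarrow>
    gprod (\<Sum>\<^sub># lam) (row_symmetrizer lam) (left_mult x (column_antisymmetrizer lam)) s =
    of_real (kappa lam x) * young_symmetrizer lam s"
  using someI_ex[OF row_young_symmetrizer] unfolding kappa_def by blast

text \<open>A sum over the whole group, not over the conjugacy class: it is the group order times
  the normalized character, by \<open>norm_character_eq\<close>.\<close>

definition class_scalar :: "nat multiset \<Rightarrow> (nat \<Rightarrow> nat) \<Rightarrow> real" where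
  "class_scalar lam \<sigma> = (\<Sum>g\<in>sym_group (\<Sum>\<^sub># lam). kappa lam (conj_by g \<sigma>))"

lemma inv_conj_by: "bij p \<Longrightarrow> bij y \<Longrightarrow> inv p \<circ> inv (conj_by p y) = inv y \<circ> inv p"
  by (simp add: conj_by_def o_inv_distrib bij_imp_bij_inv inv_inv_eq bij_comp comp_assoc bij_inv_comp_assoc)

lemma bij_conj_by: "bij p \<Longrightarrow> bij y \<Longrightarrow> bij (conj_by p y)"
  by (simp add: conj_by_def bij_comp bij_imp_bij_inv)

text \<open>Replacing \<open>g\<close> by \<open>p \<circ> g\<close> moves \<open>p\<close> past the
  conjugates: the class sum is central, so it can be applied to the right factor of a
  product.\<close>

lemma sum_conj_left_mult_gprod:
  assumes \<sigma>: "\<sigma> \<in> sym_group n"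
  shows "(\<Sum>g\<in>sym_group n. left_mult (conj_by g \<sigma>) (gprod n h f) s) =
    (\<Sum>p\<in>sym_group n. h p * (\<Sum>g\<in>sym_group n. left_mult (conj_by g \<sigma>) f (inv p \<circ> s)))"
proof -
  have "(\<Sum>g\<in>sym_group n. left_mult (conj_by g \<sigma>) (gprod n h f) s) =
    (\<Sum>g\<in>sym_group n. \<Sum>p\<in>sym_group n. h p * f (inv p \<circ> (inv (conj_by g \<sigma>) \<circ> s)))"
    by (simp add: left_mult_def gprod_def)
  also have "\<dots> = (\<Sum>p\<in>sym_group n. h p * (\<Sum>g\<in>sym_group n. f (inv p \<circ> (inv (conj_by g \<sigma>) \<circ> s))))"
    by (subst sum.swap) (simp add: sum_distrib_left)
  also have "\<dots> = (\<Sum>p\<in>sym_group n. h p * (\<Sum>g\<in>sym_group n. f (inv (conj_by g \<sigma>) \<circ> (inv p \<circ> s))))"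
  proof (rule sum.cong[OF refl])
    fix p assume p: "p \<in> sym_group n"
    have "(\<Sum>g\<in>sym_group n. f (inv p \<circ> (inv (conj_by g \<sigma>) \<circ> s))) =
      (\<Sum>g\<in>sym_group n. f (inv p \<circ> (inv (conj_by (p \<circ> g) \<sigma>) \<circ> s)))"
      by (rule sum_sym_group_left[OF p, symmetric])
    also have "\<dots> = (\<Sum>g\<in>sym_group n. f (inv (conj_by g \<sigma>) \<circ> (inv p \<circ> s)))"
    proof (intro sum.cong refl arg_cong[where f = f])
      fix g assume g: "g \<in> sym_group n"
      have "inv p \<circ> inv (conj_by (p \<circ> g) \<sigma>) = inv (conj_by g \<sigma>) \<circ> inv p"
        using p g \<sigma> by (simp add: conj_by_comp inv_conj_by bij_conj_by sym_group_bij)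
      then show "inv p \<circ> (inv (conj_by (p \<circ> g) \<sigma>) \<circ> s) = inv (conj_by g \<sigma>) \<circ> (inv p \<circ> s)"
        by (simp add: comp_assoc[symmetric])
    qed
    finally show "h p * (\<Sum>g\<in>sym_group n. f (inv p \<circ> (inv (conj_by g \<sigma>) \<circ> s))) =
      h p * (\<Sum>g\<in>sym_group n. f (inv (conj_by g \<sigma>) \<circ> (inv p \<circ> s)))" by simp
  qed
  finally show ?thesis by (simp add: left_mult_def)
qed

text \<open>Centrality lets the class sum pass the row symmetrizer, so that each conjugate stands
  between it and the column antisymmetrizer, where \<open>kappa\<close> applies.\<close>

lemma sum_conj_young_symmetrizer:
  assumes \<sigma>: "\<sigma> \<in> sym_group (\<Sum>\<^sub># lam)"
  shows "(\<Sum>g\<in>sym_group (\<Sum>\<^sub># lam). left_mult (conj_by g \<sigma>) (young_symmetrizer lam) s) =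
    of_real (class_scalar lam \<sigma>) * young_symmetrizer lam s"
proof -
  let ?G = "sym_group (\<Sum>\<^sub># lam)"
  have "(\<Sum>g\<in>?G. left_mult (conj_by g \<sigma>) (young_symmetrizer lam) s) =
    (\<Sum>p\<in>?G. row_symmetrizer lam p * (\<Sum>g\<in>?G. left_mult (conj_by g \<sigma>) (column_antisymmetrizer lam) (inv p \<circ> s)))"
    unfolding young_symmetrizer_def by (rule sum_conj_left_mult_gprod[OF \<sigma>])
  also have "\<dots> = (\<Sum>g\<in>?G. gprod (\<Sum>\<^sub># lam) (row_symmetrizer lam) (left_mult (conj_by g \<sigma>) (column_antisymmetrizer lam)) s)"
    unfolding gprod_def by (subst sum.swap) (simp add: sum_distrib_left)
  also have "\<dots> = (\<Sum>g\<in>?G. of_real (kappa lam (conj_by g \<sigma>)) * young_symmetrizer lam s)"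
    by (intro sum.cong refl kappa sym_group_conj \<sigma>)
  finally show ?thesis by (simp add: class_scalar_def sum_distrib_right)
qed

lemma sum_conj_specht:
  assumes \<sigma>: "\<sigma> \<in> sym_group (\<Sum>\<^sub># lam)" and f: "f \<in> specht_module lam"
  shows "(\<Sum>g\<in>sym_group (\<Sum>\<^sub># lam). left_mult (conj_by g \<sigma>) f s) = of_real (class_scalar lam \<sigma>) * f s"
proof -
  obtain h where h: "f = gprod (\<Sum>\<^sub># lam) h (young_symmetrizer lam)"
    using f by (auto simp: specht_module_def)
  show ?thesis
    unfolding h sum_conj_left_mult_gprod[OF \<sigma>] sum_conj_young_symmetrizer[OF \<sigma>]
    by (simp add: gprod_def sum_distrib_left ac_simps)
qed

lemma left_mult_comp: "bij x \<Longrightarrow> bij y \<Longrightarrow> left_mult (x \<circ> y) f = left_mult x (left_mult y f)"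
  by (simp add: left_mult_def o_inv_distrib comp_assoc)

text \<open>Two class sums are applied in succession to the Young symmetrizer, and the coefficients
  at \<open>id\<close> are compared.\<close>

lemma class_scalar_mult:
  assumes \<sigma>: "\<sigma> \<in> sym_group (\<Sum>\<^sub># lam)" and \<tau>: "\<tau> \<in> sym_group (\<Sum>\<^sub># lam)"
  shows "class_scalar lam \<sigma> * class_scalar lam \<tau> = (\<Sum>g\<in>sym_group (\<Sum>\<^sub># lam). class_scalar lam (\<sigma> \<circ> conj_by g \<tau>))"
proof -
  let ?G = "sym_group (\<Sum>\<^sub># lam)" let ?c = "young_symmetrizer lam"
  have "(\<Sum>g\<in>?G. \<Sum>h\<in>?G. left_mult (conj_by g \<sigma>) (left_mult (conj_by h \<tau>) ?c) id) =
    (\<Sum>g\<in>?G. (\<Sum>h\<in>?G. left_mult (conj_by h \<tau>) ?c (inv (conj_by g \<sigma>))))"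
    by (simp add: left_mult_def)
  also have "\<dots> = of_real (class_scalar lam \<tau>) * (\<Sum>g\<in>?G. left_mult (conj_by g \<sigma>) ?c id)"
    unfolding sum_conj_young_symmetrizer[OF \<tau>] by (simp add: left_mult_def sum_distrib_left)
  also have "\<dots> = of_real (class_scalar lam \<sigma> * class_scalar lam \<tau>)"
    unfolding sum_conj_young_symmetrizer[OF \<sigma>] by (simp add: young_symmetrizer_id)
  finally have 1: "(\<Sum>g\<in>?G. \<Sum>h\<in>?G. left_mult (conj_by g \<sigma>) (left_mult (conj_by h \<tau>) ?c) id) =
    of_real (class_scalar lam \<sigma> * class_scalar lam \<tau>)" .
  have "(\<Sum>g\<in>?G. \<Sum>h\<in>?G. left_mult (conj_by g \<sigma>) (left_mult (conj_by h \<tau>) ?c) id) =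
    (\<Sum>g\<in>?G. \<Sum>h\<in>?G. left_mult (conj_by g (\<sigma> \<circ> conj_by h \<tau>)) ?c id)"
  proof (rule sum.cong[OF refl])
    fix g assume g: "g \<in> ?G"
    \<comment> \<open>With \<open>g \<circ> h\<close> in place of \<open>h\<close>, the product of
      the two conjugates is itself the conjugate by \<open>g\<close> of
      \<open>\<sigma> \<circ> conj_by h \<tau>\<close>.\<close>
    have "(\<Sum>h\<in>?G. left_mult (conj_by g \<sigma>) (left_mult (conj_by h \<tau>) ?c) id) =
      (\<Sum>h\<in>?G. left_mult (conj_by g \<sigma>) (left_mult (conj_by (g \<circ> h) \<tau>) ?c) id)"
      by (rule sum_sym_group_left[OF g, symmetric])
    also have "\<dots> = (\<Sum>h\<in>?G. left_mult (conj_by g (\<sigma> \<circ> conj_by h \<tau>)) ?c id)"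
    proof (intro sum.cong refl)
      fix h assume h: "h \<in> ?G"
      have b: "bij g" "bij h" "bij \<sigma>" "bij \<tau>" using g h \<sigma> \<tau> by (auto intro: sym_group_bij)
      show "left_mult (conj_by g \<sigma>) (left_mult (conj_by (g \<circ> h) \<tau>) ?c) id =
        left_mult (conj_by g (\<sigma> \<circ> conj_by h \<tau>)) ?c id"
        using b by (simp add: conj_by_comp conj_by_mult left_mult_comp[symmetric] bij_conj_by)
    qed
    finally show "(\<Sum>h\<in>?G. left_mult (conj_by g \<sigma>) (left_mult (conj_by h \<tau>) ?c) id) =
      (\<Sum>h\<in>?G. left_mult (conj_by g (\<sigma> \<circ> conj_by h \<tau>)) ?c id)" .
  qed
  also have "\<dots> = (\<Sum>h\<in>?G. \<Sum>g\<in>?G. left_mult (conj_by g (\<sigma> \<circ> conj_by h \<tau>)) ?c id)"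
    by (rule sum.swap)
  also have "\<dots> = (\<Sum>h\<in>?G. of_real (class_scalar lam (\<sigma> \<circ> conj_by h \<tau>)))"
    by (intro sum.cong refl, subst sum_conj_young_symmetrizer)
       (auto simp: young_symmetrizer_id intro: sym_group_comp sym_group_conj \<sigma> \<tau>)
  finally have "complex_of_real (class_scalar lam \<sigma> * class_scalar lam \<tau>) =
    of_real (\<Sum>g\<in>?G. class_scalar lam (\<sigma> \<circ> conj_by g \<tau>))"
    using 1 by simp
  then show ?thesis by (simp only: of_real_eq_iff)
qed


subsection \<open>Traces on the Specht module\<close>

lemma sum_fun_apply: "(\<Sum>i\<in>I. F i) x = (\<Sum>i\<in>I. (F i :: 'a \<Rightarrow> complex) x)"
  by (induction I rule: infinite_finite_induct) auto

text \<open>Point masses span the group algebra, which makes every basis of a Specht module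
  finite.\<close>

lemma group_algebra_span: "group_algebra n \<subseteq> cfun.span ((\<lambda>p q. if q = p then 1 else 0) ` sym_group n)"
proof
  fix f assume f: "f \<in> group_algebra n"
  let ?d = "\<lambda>p q. if q = p then 1 else (0::complex)"
  have "f = (\<Sum>p\<in>sym_group n. cscale (f p) (?d p))"
  proof
    fix s
    have "(\<Sum>p\<in>sym_group n. cscale (f p) (?d p)) s = (\<Sum>p\<in>sym_group n. if s = p then f s else 0)"
      unfolding sum_fun_apply by (intro sum.cong) (auto simp: cscale_def)
    then show "f s = (\<Sum>p\<in>sym_group n. cscale (f p) (?d p)) s"
      using f by (simp add: finite_sym_group group_algebra_def)
  qed
  also have "\<dots> \<in> cfun.span (?d ` sym_group n)"
    by (intro cfun.span_sum cfun.span_scale cfun.span_base) auto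
  finally show "f \<in> cfun.span (?d ` sym_group n)" .
qed

lemma left_mult_lincomb: "left_mult x (\<Sum>b\<in>B. cscale (r b) b) = (\<Sum>b\<in>B. cscale (r b) (left_mult x b))"
  by (rule ext) (simp add: left_mult_def sum_fun_apply cscale_def)

text \<open>The identity tr(x y) = tr(y x), by the matrix product in the basis
  \<open>B\<close>.\<close>

lemma representation_left_mult_commute:
  assumes B: "cfun.independent B" "finite B"
    and x: "\<And>b. b \<in> B \<Longrightarrow> left_mult x b \<in> cfun.span B" and y: "\<And>b. b \<in> B \<Longrightarrow> left_mult y b \<in> cfun.span B"
  shows "(\<Sum>b\<in>B. cfun.representation B (left_mult x (left_mult y b)) b) =
    (\<Sum>b\<in>B. cfun.representation B (left_mult y (left_mult x b)) b)"
proof -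
  let ?r = "cfun.representation B"
  have e: "(\<Sum>b\<in>B. ?r (left_mult x (left_mult y b)) b) = (\<Sum>b\<in>B. \<Sum>b'\<in>B. ?r (left_mult y b) b' * ?r (left_mult x b') b)"
    if x: "\<And>b. b \<in> B \<Longrightarrow> left_mult x b \<in> cfun.span B" and y: "\<And>b. b \<in> B \<Longrightarrow> left_mult y b \<in> cfun.span B" for x y
  proof (intro sum.cong refl)
    fix b assume b: "b \<in> B"
    have "left_mult x (left_mult y b) = left_mult x (\<Sum>b'\<in>B. cscale (?r (left_mult y b) b') b')"
      by (subst cfun.sum_representation_eq[OF B(1) y[OF b] B(2)]) simp_all
    also have "\<dots> = (\<Sum>b'\<in>B. cscale (?r (left_mult y b) b') (left_mult x b'))"
      by (rule left_mult_lincomb)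
    finally have "?r (left_mult x (left_mult y b)) = ?r (\<Sum>b'\<in>B. cscale (?r (left_mult y b) b') (left_mult x b'))"
      by simp
    also have "\<dots> = (\<lambda>c. \<Sum>b'\<in>B. ?r (cscale (?r (left_mult y b) b') (left_mult x b')) c)"
      by (rule cfun.representation_sum[OF B(1)]) (intro cfun.span_scale x)
    finally show "?r (left_mult x (left_mult y b)) b = (\<Sum>b'\<in>B. ?r (left_mult y b) b' * ?r (left_mult x b') b)"
      by (simp add: cfun.representation_scale[OF B(1) x])
  qed
  have "(\<Sum>b\<in>B. ?r (left_mult x (left_mult y b)) b) = (\<Sum>b\<in>B. \<Sum>b'\<in>B. ?r (left_mult y b) b' * ?r (left_mult x b') b)"
    by (rule e) (use x y in auto)
  also have "\<dots> = (\<Sum>b'\<in>B. \<Sum>b\<in>B. ?r (left_mult x b') b * ?r (left_mult y b) b')"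
    by (subst sum.swap) (simp add: mult.commute)
  also have "\<dots> = (\<Sum>b\<in>B. ?r (left_mult y (left_mult x b)) b)"
    by (rule e[symmetric]) (use x y in auto)
  finally show ?thesis .
qed

lemma left_mult_specht:
  assumes x: "x \<in> sym_group (\<Sum>\<^sub># lam)" and f: "f \<in> specht_module lam"
  shows "left_mult x f \<in> specht_module lam"
proof -
  let ?n = "\<Sum>\<^sub># lam"
  obtain h where h: "h \<in> group_algebra ?n" "f = gprod ?n h (young_symmetrizer lam)"
    using f by (auto simp: specht_module_def)
  have "left_mult x f = gprod ?n (left_mult x h) (young_symmetrizer lam)"
  proof
    fix s
    have "gprod ?n (left_mult x h) (young_symmetrizer lam) s =
      (\<Sum>p\<in>sym_group ?n. h (inv x \<circ> (x \<circ> p)) * young_symmetrizer lam (inv (x \<circ> p) \<circ> s))"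
      unfolding gprod_def left_mult_def by (rule sum_sym_group_left[OF x, symmetric])
    also have "\<dots> = left_mult x f s"
      unfolding h gprod_def left_mult_def
      using sym_group_bij[OF x]
      by (intro sum.cong refl) (simp add: bij_inv_comp_assoc o_inv_distrib sym_group_bij comp_assoc)
    finally show "left_mult x f s = gprod ?n (left_mult x h) (young_symmetrizer lam) s" ..
  qed
  moreover have "left_mult x h \<in> group_algebra ?n"
  proof -
    have "p \<in> sym_group ?n" if "inv x \<circ> p \<in> sym_group ?n" for p
      using sym_group_comp[OF x that] sym_group_bij[OF x] by (simp add: bij_inv_comp_assoc)
    then show ?thesis using h(1) by (auto simp: group_algebra_def left_mult_def)
  qed
  ultimately show ?thesis by (auto simp: specht_module_def)
qed

text \<open>The trace of the class sum on the Specht module is computed twice. Conjugation does not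
  change the trace, which gives the group order times the trace of \<open>\<sigma>\<close>; and the
  class sum is a scalar, which gives that scalar times the dimension. The dimension is the trace of
  \<open>id\<close>.\<close>

lemma norm_character_eq:
  assumes \<sigma>: "\<sigma> \<in> sym_group (\<Sum>\<^sub># lam)"
  shows "norm_character lam \<sigma> = of_real (class_scalar lam \<sigma> / fact (\<Sum>\<^sub># lam))"
proof -
  let ?n = "\<Sum>\<^sub># lam" let ?V = "specht_module lam" let ?c = "young_symmetrizer lam"
  \<comment> \<open>The choice depends on the module alone, so one basis serves for the traces of
    all permutations.\<close>
  define B where "B = (SOME B. cfun.independent B \<and> B \<subseteq> ?V \<and> ?V \<subseteq> cfun.span B)"
  let ?r = "cfun.representation B"
  define tr where "tr \<tau> = (\<Sum>b\<in>B. ?r (left_mult \<tau> b) b)" for \<tau>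
  have irr: "irr_character lam \<tau> = tr \<tau>" for \<tau>
    by (simp add: irr_character_def trace_on_def tr_def B_def Let_def)
  have "\<exists>B. cfun.independent B \<and> B \<subseteq> ?V \<and> ?V \<subseteq> cfun.span B"
    using cfun.maximal_independent_subset[of ?V] by metis
  then have B: "cfun.independent B" "B \<subseteq> ?V" "?V \<subseteq> cfun.span B"
    unfolding B_def by (metis (mono_tags, lifting) someI_ex)+
  have "?V \<subseteq> group_algebra ?n"
  proof
    fix f assume "f \<in> ?V"
    then obtain h where h: "f = gprod ?n h ?c" by (auto simp: specht_module_def)
    have cc: "?c s = 0" if "s \<notin> sym_group ?n" for s
    proof -
      have "inv p \<circ> s \<notin> column_group lam" if p: "p \<in> sym_group ?n" for p
      proof
        assume "inv p \<circ> s \<in> column_group lam"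
        from sym_group_comp[OF p column_group_sym_group[OF this]] show False
          using \<open>s \<notin> sym_group ?n\<close> p by (simp add: bij_inv_comp_assoc sym_group_bij)
      qed
      then show ?thesis by (simp add: young_symmetrizer_def gprod_def column_antisymmetrizer_def)
    qed
    have "inv p \<circ> s \<notin> sym_group ?n" if "p \<in> sym_group ?n" "s \<notin> sym_group ?n" for p s
    proof
      assume "inv p \<circ> s \<in> sym_group ?n"
      from sym_group_comp[OF that(1) this] show False
        using that by (simp add: bij_inv_comp_assoc sym_group_bij)
    qed
    then show "f \<in> group_algebra ?n" unfolding h by (simp add: group_algebra_def gprod_def cc)
  qed
  then have "B \<subseteq> cfun.span ((\<lambda>p q. if q = p then 1 else 0) ` sym_group ?n)"
    using B(2) group_algebra_span[of ?n] by blast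
  then have fin: "finite B"
    using cfun.independent_span_bound[OF _ B(1)] finite_sym_group by blast
  have stable: "left_mult x b \<in> cfun.span B" if "x \<in> sym_group ?n" "b \<in> B" for x b
    using left_mult_specht[OF that(1)] that(2) B by blast
  have conj: "tr (conj_by g \<sigma>) = tr \<sigma>" if g: "g \<in> sym_group ?n" for g
  proof -
    have b: "bij g" "bij \<sigma>" using g \<sigma> by (auto intro: sym_group_bij)
    have s: "\<sigma> \<circ> inv g \<in> sym_group ?n" using g \<sigma> by (simp add: sym_group_comp sym_group_inv)
    have "tr (conj_by g \<sigma>) = (\<Sum>x\<in>B. ?r (left_mult g (left_mult (\<sigma> \<circ> inv g) x)) x)"
      unfolding tr_def conj_by_def using b by (simp add: left_mult_comp[symmetric] bij_comp bij_imp_bij_inv comp_assoc)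
    also have "\<dots> = (\<Sum>x\<in>B. ?r (left_mult (\<sigma> \<circ> inv g) (left_mult g x)) x)"
      by (rule representation_left_mult_commute[OF B(1) fin]) (use stable g s in auto)
    also have "\<dots> = tr \<sigma>"
      unfolding tr_def using b by (simp add: left_mult_comp[symmetric] bij_comp bij_imp_bij_inv comp_assoc bij_inv_comp)
    finally show ?thesis .
  qed
  have rB: "?r b b = 1" if "b \<in> B" for b
    by (simp add: cfun.representation_basis[OF B(1) that])
  have "fact ?n * tr \<sigma> = (\<Sum>g\<in>sym_group ?n. tr (conj_by g \<sigma>))"
    by (simp add: conj card_sym_group)
  also have "\<dots> = (\<Sum>b\<in>B. \<Sum>g\<in>sym_group ?n. ?r (left_mult (conj_by g \<sigma>) b) b)"
    unfolding tr_def by (rule sum.swap)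
  also have "\<dots> = (\<Sum>b\<in>B. ?r (\<Sum>g\<in>sym_group ?n. left_mult (conj_by g \<sigma>) b) b)"
    by (intro sum.cong refl, subst cfun.representation_sum[OF B(1)]) (auto intro: stable sym_group_conj \<sigma>)
  also have "\<dots> = (\<Sum>b\<in>B. ?r (cscale (of_real (class_scalar lam \<sigma>)) b) b)"
  proof (intro sum.cong refl)
    fix b assume "b \<in> B"
    then have "(\<Sum>g\<in>sym_group ?n. left_mult (conj_by g \<sigma>) b) = cscale (of_real (class_scalar lam \<sigma>)) b"
      using sum_conj_specht[OF \<sigma>, of b] B(2) by (auto simp: fun_eq_iff sum_fun_apply cscale_def)
    then show "?r (\<Sum>g\<in>sym_group ?n. left_mult (conj_by g \<sigma>) b) b = ?r (cscale (of_real (class_scalar lam \<sigma>)) b) b"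
      by simp
  qed
  also have "\<dots> = (\<Sum>b\<in>B. of_real (class_scalar lam \<sigma>))"
    by (intro sum.cong refl) (simp add: cfun.representation_scale[OF B(1) cfun.span_base] rB)
  finally have main: "fact ?n * tr \<sigma> = of_real (class_scalar lam \<sigma>) * of_nat (card B)"
    by (simp add: mult.commute)
  have "tr id = (\<Sum>b\<in>B. ?r b b)" by (simp add: tr_def left_mult_def)
  also have "\<dots> = of_nat (card B)" by (simp add: rB)
  finally have tr_id: "tr id = of_nat (card B)" .
  \<comment> \<open>A nonzero element of the module, so that the dimension can be divided
    by.\<close>
  have "?c \<in> ?V"
  proof -
    let ?e = "\<lambda>p. if p = id then 1 else (0::complex)"
    have "?e \<in> group_algebra ?n" using sym_group_id by (auto simp: group_algebra_def)
    moreover have "gprod ?n ?e ?c = ?c"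
    proof
      fix s
      have "gprod ?n ?e ?c s = (\<Sum>p\<in>sym_group ?n. if p = id then ?c s else 0)"
        unfolding gprod_def by (intro sum.cong) auto
      then show "gprod ?n ?e ?c s = ?c s" by (simp add: finite_sym_group sym_group_id)
    qed
    ultimately show ?thesis unfolding specht_module_def by (metis image_eqI)
  qed
  then have "?c \<in> cfun.span B" using B by blast
  moreover have "?c \<noteq> 0" 
  proof
    assume "?c = 0"
    then have "?c id = 0" by simp
    then show False by (simp add: young_symmetrizer_id)
  qed
  ultimately have "B \<noteq> {}" by auto
  then have "of_nat (card B) \<noteq> (0::complex)" using fin by simp
  then show ?thesis
    using main by (simp add: norm_character_def irr tr_id field_simps)
qed

section \<open>Normalized characters as real numbers and their functional equation\<close>

definition char_value :: "nat multiset \<Rightarrow> (nat \<Rightarrow> nat) \<Rightarrow> real" where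
  "char_value lam \<sigma> = Re (norm_character lam \<sigma>)"

lemma norm_character_char_value:
  "\<sigma> \<in> sym_group (\<Sum>\<^sub># lam) \<Longrightarrow> norm_character lam \<sigma> = of_real (char_value lam \<sigma>)"
  unfolding char_value_def norm_character_eq by (simp only: Re_complex_of_real)

lemma char_value_id: "char_value lam id = 1"
proof -
  have "left_mult id (column_antisymmetrizer lam) = column_antisymmetrizer lam"
    by (simp add: left_mult_def)
  then have "young_symmetrizer lam id = of_real (kappa lam id) * young_symmetrizer lam id"
    using kappa[OF sym_group_id, of lam id] by (simp only: young_symmetrizer_def)
  then have k: "kappa lam id = 1" by (simp only: young_symmetrizer_id) simp
  have "class_scalar lam id = (\<Sum>g\<in>sym_group (\<Sum>\<^sub># lam). kappa lam id)"
    unfolding class_scalar_def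
    by (intro sum.cong refl) (simp add: conj_by_def bij_inv_comp sym_group_bij)
  then have "class_scalar lam id = fact (\<Sum>\<^sub># lam)" by (simp add: k card_sym_group)
  then show ?thesis by (simp add: char_value_def norm_character_eq sym_group_id)
qed

text \<open>\<open>class_scalar_mult\<close> divided by the square of the group order; it turns
  products of characters into averages of single ones.\<close>

lemma char_value_mult:
  assumes "\<sigma> \<in> sym_group (\<Sum>\<^sub># lam)" "\<tau> \<in> sym_group (\<Sum>\<^sub># lam)"
  shows "char_value lam \<sigma> * char_value lam \<tau> =
    (\<Sum>g\<in>sym_group (\<Sum>\<^sub># lam). char_value lam (\<sigma> \<circ> conj_by g \<tau>)) / fact (\<Sum>\<^sub># lam)"
proof -
  have cv: "char_value lam x = class_scalar lam x / fact (\<Sum>\<^sub># lam)" if "x \<in> sym_group (\<Sum>\<^sub># lam)" for x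
    unfolding char_value_def norm_character_eq[OF that] by (rule Re_complex_of_real)
  have "(\<Sum>g\<in>sym_group (\<Sum>\<^sub># lam). char_value lam (\<sigma> \<circ> conj_by g \<tau>)) =
    (\<Sum>g\<in>sym_group (\<Sum>\<^sub># lam). class_scalar lam (\<sigma> \<circ> conj_by g \<tau>)) / fact (\<Sum>\<^sub># lam)"
    unfolding sum_divide_distrib by (intro sum.cong refl cv sym_group_comp sym_group_conj assms)
  then show ?thesis using assms by (simp add: cv class_scalar_mult[symmetric])
qed


section \<open>Cycle types of products\<close>

definition perm_supp :: "('a \<Rightarrow> 'a) \<Rightarrow> 'a set" where
  "perm_supp \<sigma> = {x. \<sigma> x \<noteq> x}"

lemma perm_supp_iff: "x \<in> perm_supp \<sigma> \<longleftrightarrow> \<sigma> x \<noteq> x"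
  by (simp add: perm_supp_def)

lemma finite_perm_supp: "permutation \<sigma> \<Longrightarrow> finite (perm_supp \<sigma>)"
  by (simp add: permutation perm_supp_def)

lemma perm_supp_image: "permutation \<sigma> \<Longrightarrow> \<sigma> x \<in> perm_supp \<sigma> \<longleftrightarrow> x \<in> perm_supp \<sigma>"
  by (auto simp: permutation perm_supp_iff bij_def inj_eq)

lemma orbit_perm_supp:
  assumes "permutation \<sigma>" "x \<in> perm_supp \<sigma>" shows "orbit \<sigma> x \<subseteq> perm_supp \<sigma>"
proof
  fix y assume "y \<in> orbit \<sigma> x"
  then show "y \<in> perm_supp \<sigma>"
    by induction (use assms in \<open>auto simp: perm_supp_image\<close>)
qed

lemma orbit_eq_of_mem: "permutation \<sigma> \<Longrightarrow> y \<in> orbit \<sigma> x \<Longrightarrow> orbit \<sigma> y = orbit \<sigma> x"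
  using orbit_cyclic_eq3[OF cyclic_on_orbit'] by metis

lemma finite_orbit_permutation: "permutation \<sigma> \<Longrightarrow> finite (orbit \<sigma> x)"
  by (rule finite_orbit) (rule permutation_self_in_orbit)

lemma nontrivial_cycle_type_alt:
  "nontrivial_cycle_type \<sigma> = image_mset card (mset_set (orbit \<sigma> ` perm_supp \<sigma>))"
  by (simp add: nontrivial_cycle_type_def perm_supp_def)

lemma nontrivial_cycle_type_ge_2:
  assumes "permutation \<sigma>" "k \<in># nontrivial_cycle_type \<sigma>" shows "k \<ge> 2"
proof -
  have "finite (orbit \<sigma> ` perm_supp \<sigma>)" using finite_perm_supp[OF assms(1)] by simp
  then obtain x where x: "x \<in> perm_supp \<sigma>" "k = card (orbit \<sigma> x)"
    using assms(2) by (auto simp: nontrivial_cycle_type_alt)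
  have "{x, \<sigma> x} \<subseteq> orbit \<sigma> x" using permutation_self_in_orbit[OF assms(1)] by (auto intro: orbit.base)
  then have "card {x, \<sigma> x} \<le> k" unfolding x by (rule card_mono[OF finite_orbit_permutation[OF assms(1)]])
  then show ?thesis using x by (auto simp: perm_supp_iff)
qed

text \<open>A cycle of length \<open>a\<close> consists of \<open>a\<close> points. Sums over points
  are what the incidences of supports produce, and this conversion yields the weights
  \<open>a\<close> and \<open>b\<close> of the covariance.\<close>

lemma sum_perm_supp:
  assumes \<sigma>: "permutation \<sigma>"
  shows "(\<Sum>x\<in>perm_supp \<sigma>. F (card (orbit \<sigma> x))) = (\<Sum>a\<in>#nontrivial_cycle_type \<sigma>. real a * F a)"
proof -
  have fin: "finite (perm_supp \<sigma>)" by (rule finite_perm_supp[OF \<sigma>])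
  have "(\<Sum>x\<in>perm_supp \<sigma>. F (card (orbit \<sigma> x))) =
    (\<Sum>Q\<in>orbit \<sigma> ` perm_supp \<sigma>. \<Sum>x\<in>{x\<in>perm_supp \<sigma>. orbit \<sigma> x = Q}. F (card (orbit \<sigma> x)))"
    by (rule sum.image_gen[OF fin])
  also have "\<dots> = (\<Sum>Q\<in>orbit \<sigma> ` perm_supp \<sigma>. real (card Q) * F (card Q))"
  proof (intro sum.cong refl)
    fix Q' assume "Q' \<in> orbit \<sigma> ` perm_supp \<sigma>"
    then obtain y where y: "y \<in> perm_supp \<sigma>" "Q' = orbit \<sigma> y" by blast
    have "{x\<in>perm_supp \<sigma>. orbit \<sigma> x = Q'} = Q'"
      using y orbit_perm_supp[OF \<sigma> y(1)] orbit_eq_of_mem[OF \<sigma>] permutation_self_in_orbit[OF \<sigma>] by blast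
    moreover have "(\<Sum>x\<in>{x\<in>perm_supp \<sigma>. orbit \<sigma> x = Q'}. F (card (orbit \<sigma> x))) = (\<Sum>x\<in>{x\<in>perm_supp \<sigma>. orbit \<sigma> x = Q'}. F (card Q'))"
      by (intro sum.cong) auto
    ultimately show "(\<Sum>x\<in>{x\<in>perm_supp \<sigma>. orbit \<sigma> x = Q'}. F (card (orbit \<sigma> x))) = real (card Q') * F (card Q')"
      by simp
  qed
  also have "\<dots> = (\<Sum>a\<in>#nontrivial_cycle_type \<sigma>. real a * F a)"
    by (simp add: nontrivial_cycle_type_alt sum_unfold_sum_mset image_mset.compositionality comp_def)
  finally show ?thesis .
qed

lemma perm_supp_conj_by: "bij g \<Longrightarrow> perm_supp (conj_by g \<sigma>) = g ` perm_supp \<sigma>"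
  unfolding perm_supp_def conj_by_def
  by (auto simp: image_iff bij_is_inj bij_is_surj surj_f_inv_f inv_f_f) (metis bij_inv_eq_iff)+

lemma orbit_conj_by:
  assumes "permutation \<sigma>" "bij g" shows "orbit (conj_by g \<sigma>) (g x) = g ` orbit \<sigma> x"
  by (rule orbit_inverse[symmetric])
     (use assms in \<open>auto simp: conj_by_def bij_is_inj intro: permutation_self_in_orbit\<close>)

lemma permutation_conj_by:
  assumes "permutation \<sigma>" "bij g" shows "permutation (conj_by g \<sigma>)"
  using finite_perm_supp[OF assms(1)] perm_supp_conj_by[OF assms(2), of \<sigma>] assms
  by (simp add: permutation bij_conj_by perm_supp_def[symmetric])

lemma nontrivial_cycle_type_conj_by:
  assumes "permutation \<sigma>" "bij g"
  shows "nontrivial_cycle_type (conj_by g \<sigma>) = nontrivial_cycle_type \<sigma>"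
proof -
  have "orbit (conj_by g \<sigma>) ` perm_supp (conj_by g \<sigma>) = (\<lambda>A. g ` A) ` (orbit \<sigma> ` perm_supp \<sigma>)"
    using assms by (simp add: perm_supp_conj_by image_image orbit_conj_by)
  moreover have inj: "inj_on (\<lambda>A. g ` A) X" for X
    using assms(2) by (auto simp: inj_on_def bij_def inj_image_eq_iff)
  ultimately have "nontrivial_cycle_type (conj_by g \<sigma>) =
      image_mset card (image_mset (\<lambda>A. g ` A) (mset_set (orbit \<sigma> ` perm_supp \<sigma>)))"
    by (simp add: nontrivial_cycle_type_alt image_mset_mset_set)
  moreover have "card (g ` A) = card A" for A
    using assms(2) by (intro card_image inj_on_subset[OF bij_is_inj]) auto
  ultimately show ?thesis by (simp add: nontrivial_cycle_type_alt image_mset.compositionality comp_def)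
qed

section \<open>Products of permutations whose supports are disjoint or share one point\<close>

lemma disjoint_supp_commute:
  assumes "permutation \<sigma>" "permutation \<tau>" "perm_supp \<sigma> \<inter> perm_supp \<tau> = {}"
  shows "\<sigma> \<circ> \<tau> = \<tau> \<circ> \<sigma>"
proof
  fix x
  have "\<tau> x \<in> perm_supp \<tau> \<longleftrightarrow> x \<in> perm_supp \<tau>" "\<sigma> x \<in> perm_supp \<sigma> \<longleftrightarrow> x \<in> perm_supp \<sigma>"
    using assms by (simp_all add: perm_supp_image)
  then show "(\<sigma> \<circ> \<tau>) x = (\<tau> \<circ> \<sigma>) x" using assms(3) by (auto simp: perm_supp_iff disjoint_iff)
qed

lemma perm_supp_comp: "perm_supp (\<sigma> \<circ> \<tau>) \<subseteq> perm_supp \<sigma> \<union> perm_supp \<tau>"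
  by (auto simp: perm_supp_iff)

lemma orbit_comp_left:
  assumes "permutation \<sigma>" "orbit \<sigma> x \<inter> perm_supp \<tau> = {}"
  shows "orbit (\<sigma> \<circ> \<tau>) x = orbit \<sigma> x"
  by (rule orbit_cong[OF permutation_self_in_orbit[OF assms(1)]])
     (use assms(2) in \<open>auto simp: perm_supp_iff disjoint_iff\<close>)

lemma orbit_comp_right:
  assumes "permutation \<tau>" "orbit \<tau> x \<inter> perm_supp \<sigma> = {}"
  shows "orbit (\<sigma> \<circ> \<tau>) x = orbit \<tau> x"
proof (rule orbit_cong[OF permutation_self_in_orbit[OF assms(1)]])
  fix y assume "y \<in> orbit \<tau> x"
  then have "\<tau> y \<in> orbit \<tau> x" by (rule orbit.step)
  then show "(\<sigma> \<circ> \<tau>) y = \<tau> y" using assms(2) by (auto simp: perm_supp_iff disjoint_iff)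
qed

text \<open>Each factor is the identity on the nontrivial cycles of the other, so the product has
  the cycles of both.\<close>

lemma nontrivial_cycle_type_disjoint:
  assumes "permutation \<sigma>" "permutation \<tau>" "perm_supp \<sigma> \<inter> perm_supp \<tau> = {}"
  shows "nontrivial_cycle_type (\<sigma> \<circ> \<tau>) = nontrivial_cycle_type \<sigma> + nontrivial_cycle_type \<tau>"
proof -
  have S: "perm_supp (\<sigma> \<circ> \<tau>) = perm_supp \<sigma> \<union> perm_supp \<tau>"
  proof (intro equalityI perm_supp_comp subsetI)
    fix x assume "x \<in> perm_supp \<sigma> \<union> perm_supp \<tau>"
    then show "x \<in> perm_supp (\<sigma> \<circ> \<tau>)"
      using assms(3) perm_supp_image[OF assms(2), of x] by (auto simp: perm_supp_iff disjoint_iff) 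
  qed
  have l: "orbit (\<sigma> \<circ> \<tau>) x = orbit \<sigma> x" if "x \<in> perm_supp \<sigma>" for x
    by (rule orbit_comp_left[OF assms(1)]) (use orbit_perm_supp[OF assms(1) that] assms(3) in blast)
  have r: "orbit (\<sigma> \<circ> \<tau>) x = orbit \<tau> x" if "x \<in> perm_supp \<tau>" for x
    by (rule orbit_comp_right[OF assms(2)]) (use orbit_perm_supp[OF assms(2) that] assms(3) in blast)
  have "orbit (\<sigma> \<circ> \<tau>) ` perm_supp (\<sigma> \<circ> \<tau>) = orbit \<sigma> ` perm_supp \<sigma> \<union> orbit \<tau> ` perm_supp \<tau>"
    unfolding S image_Un using l r by simp
  moreover have "orbit \<sigma> ` perm_supp \<sigma> \<inter> orbit \<tau> ` perm_supp \<tau> = {}"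
  proof -
    have "orbit \<sigma> x \<noteq> orbit \<tau> y" if "x \<in> perm_supp \<sigma>" "y \<in> perm_supp \<tau>" for x y
      using orbit_perm_supp[OF assms(1) that(1)] orbit_perm_supp[OF assms(2) that(2)] assms(3)
        permutation_self_in_orbit[OF assms(1), of x] by blast
    then show ?thesis by blast
  qed
  ultimately show ?thesis
    using finite_perm_supp[OF assms(1)] finite_perm_supp[OF assms(2)]
    by (simp add: nontrivial_cycle_type_alt mset_set_Union)
qed

text \<open>Started at \<open>s\<close>, the product runs through the cycle of
  \<open>\<tau>\<close>; where that would return to \<open>s\<close>, it goes to
  \<open>\<sigma> s\<close> instead and runs through the cycle of \<open>\<sigma>\<close> back to
  \<open>s\<close>.\<close>

lemma orbit_comp_merge:
  assumes \<sigma>: "permutation \<sigma>" and \<tau>: "permutation \<tau>" and s: "perm_supp \<sigma> \<inter> perm_supp \<tau> = {s}"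
  shows "orbit (\<sigma> \<circ> \<tau>) s = orbit \<sigma> s \<union> orbit \<tau> s"
proof -
  let ?f = "\<sigma> \<circ> \<tau>"
  have f: "permutation ?f" using \<sigma> \<tau> by (rule permutation_compose)
  have ss: "s \<in> perm_supp \<sigma>" "s \<in> perm_supp \<tau>" using s by auto
  have os: "orbit \<sigma> s \<subseteq> perm_supp \<sigma>" and ot: "orbit \<tau> s \<subseteq> perm_supp \<tau>"
    using ss \<sigma> \<tau> by (auto dest: orbit_perm_supp)
  have only: "y = s" if "y \<in> perm_supp \<sigma>" "y \<in> perm_supp \<tau>" for y using s that by blast
  have f\<tau>: "?f y = \<tau> y" if "y \<in> perm_supp \<tau>" "\<tau> y \<noteq> s" for y
    using only[of "\<tau> y"] perm_supp_image[OF \<tau>, of y] that by (auto simp: perm_supp_iff)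
  have f\<sigma>: "?f y = \<sigma> y" if "y \<in> perm_supp \<sigma>" "y \<noteq> s" for y
  proof -
    have "\<tau> y = y" using only[of y] that by (auto simp: perm_supp_iff)
    then show ?thesis by simp
  qed
  have fin: "y \<in> orbit \<sigma> s \<union> orbit \<tau> s \<Longrightarrow> ?f y \<in> orbit \<sigma> s \<union> orbit \<tau> s" for y
  proof (cases "y \<in> orbit \<tau> s")
    case True
    then show ?thesis
    proof (cases "\<tau> y = s")
      case True
      then show ?thesis by (simp add: orbit.base)
    next
      case False
      have "y \<in> perm_supp \<tau>" using \<open>y \<in> orbit \<tau> s\<close> ot by blast
      then have "?f y = \<tau> y" using f\<tau> False by blast
      then show ?thesis using orbit.step[OF \<open>y \<in> orbit \<tau> s\<close>] by simp
    qed
  next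
    case False
    moreover assume "y \<in> orbit \<sigma> s \<union> orbit \<tau> s"
    ultimately have y: "y \<in> orbit \<sigma> s" by simp
    moreover have "y \<noteq> s" using False permutation_self_in_orbit[OF \<tau>] by auto
    ultimately have "?f y = \<sigma> y" using f\<sigma> os by blast
    then show ?thesis using orbit.step[OF y] by simp
  qed
  have self: "s \<in> orbit ?f s" by (rule permutation_self_in_orbit[OF f])
  have sub1: "orbit ?f s \<subseteq> orbit \<sigma> s \<union> orbit \<tau> s"
  proof
    fix y assume "y \<in> orbit ?f s"
    then show "y \<in> orbit \<sigma> s \<union> orbit \<tau> s"
      by induction (use fin permutation_self_in_orbit[OF \<sigma>] in blast)+
  qed
  have step\<tau>: "\<tau> y \<in> orbit ?f s" if "y \<in> orbit ?f s" "y \<in> perm_supp \<tau>" for y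
  proof (cases "\<tau> y = s")
    case False
    then show ?thesis using orbit.step[OF that(1)] f\<tau>[OF that(2)] by simp
  qed (simp add: self)
  have sub2: "orbit \<tau> s \<subseteq> orbit ?f s"
  proof
    fix y assume "y \<in> orbit \<tau> s"
    then show "y \<in> orbit ?f s"
    proof induction
      case base
      show ?case by (rule step\<tau>[OF self ss(2)])
    next
      case (step y)
      then show ?case using step\<tau> ot by blast
    qed
  qed
  \<comment> \<open>The predecessor of \<open>s\<close> on its \<open>\<tau>\<close>-cycle: from
    there the product crosses over to the cycle of \<open>\<sigma>\<close>.\<close>
  obtain z where z: "z \<in> orbit \<tau> s" "\<tau> z = s"
    using permutation_self_in_orbit[OF \<tau>, of s] ss by cases (auto simp: perm_supp_iff)
  have \<sigma>s: "\<sigma> s \<in> orbit ?f s"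
    using orbit.step[of z ?f s] z sub2 by auto
  have "orbit \<sigma> s \<subseteq> orbit ?f s"
  proof
    fix y assume "y \<in> orbit \<sigma> s"
    then show "y \<in> orbit ?f s"
    proof induction
      case base
      show ?case by (rule \<sigma>s)
    next
      case (step y)
      show ?case
      proof (cases "y = s")
        case True
        show ?thesis unfolding True by (rule \<sigma>s)
      next
        case False
        then have "?f y = \<sigma> y" using f\<sigma> step.hyps os by blast
        then show ?thesis using orbit.step[OF step.IH] by simp
      qed
    qed
  qed
  then show ?thesis using sub1 sub2 by blast
qed

text \<open>Every cycle that avoids \<open>s\<close> is untouched by the other factor; the two
  cycles through \<open>s\<close> join by \<open>orbit_comp_merge\<close>.\<close>

lemma nontrivial_cycle_type_merge:
  assumes \<sigma>: "permutation \<sigma>" and \<tau>: "permutation \<tau>" and s: "perm_supp \<sigma> \<inter> perm_supp \<tau> = {s}"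
  shows "nontrivial_cycle_type (\<sigma> \<circ> \<tau>) =
    (nontrivial_cycle_type \<sigma> - {#card (orbit \<sigma> s)#}) + (nontrivial_cycle_type \<tau> - {#card (orbit \<tau> s)#}) +
    {#card (orbit \<sigma> s) + card (orbit \<tau> s) - 1#}"
proof -
  let ?f = "\<sigma> \<circ> \<tau>" let ?A = "orbit \<sigma> ` perm_supp \<sigma>" let ?B = "orbit \<tau> ` perm_supp \<tau>"
  let ?O = "orbit \<sigma> s \<union> orbit \<tau> s"
  have ss: "s \<in> perm_supp \<sigma>" "s \<in> perm_supp \<tau>" using s by auto
  have only: "y = s" if "y \<in> perm_supp \<sigma>" "y \<in> perm_supp \<tau>" for y using s that by blast
  note self\<sigma> = permutation_self_in_orbit[OF \<sigma>] and self\<tau> = permutation_self_in_orbit[OF \<tau>]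
  note sub\<sigma> = orbit_perm_supp[OF \<sigma>] and sub\<tau> = orbit_perm_supp[OF \<tau>]
  have f: "permutation ?f" using \<sigma> \<tau> by (rule permutation_compose)
  have O: "orbit ?f s = ?O" by (rule orbit_comp_merge[OF assms])
  have l: "orbit ?f x = orbit \<sigma> x" if "x \<in> perm_supp \<sigma>" "orbit \<sigma> x \<noteq> orbit \<sigma> s" for x
  proof (rule orbit_comp_left[OF \<sigma>])
    have "s \<notin> orbit \<sigma> x" using that(2) orbit_eq_of_mem[OF \<sigma>] by blast
    then show "orbit \<sigma> x \<inter> perm_supp \<tau> = {}" using only sub\<sigma>[OF that(1)] by blast
  qed
  have r: "orbit ?f x = orbit \<tau> x" if "x \<in> perm_supp \<tau>" "orbit \<tau> x \<noteq> orbit \<tau> s" for x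
  proof (rule orbit_comp_right[OF \<tau>])
    have "s \<notin> orbit \<tau> x" using that(2) orbit_eq_of_mem[OF \<tau>] by blast
    then show "orbit \<tau> x \<inter> perm_supp \<sigma> = {}" using only sub\<tau>[OF that(1)] by blast
  qed
  have lo: "orbit ?f x = ?O" if "orbit \<sigma> x = orbit \<sigma> s \<or> orbit \<tau> x = orbit \<tau> s" for x
  proof -
    have "x \<in> ?O" using that self\<sigma>[of x] self\<tau>[of x] by blast
    then show ?thesis using orbit_eq_of_mem[OF f, of x s] O by simp
  qed
  have S: "perm_supp ?f = perm_supp \<sigma> \<union> perm_supp \<tau>"
  proof (intro equalityI perm_supp_comp subsetI)
    fix x assume x: "x \<in> perm_supp \<sigma> \<union> perm_supp \<tau>"
    \<comment> \<open>No point of either support becomes fixed: off the two cycles through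
      \<open>s\<close> nothing changes, and the merged cycle has more than one point.\<close>
    have "orbit ?f x \<noteq> {x}"
    proof
      assume e: "orbit ?f x = {x}"
      have n\<sigma>: "orbit \<sigma> x \<noteq> {x}" if "x \<in> perm_supp \<sigma>" using that by (simp add: orbit_eq_singleton_iff perm_supp_iff)
      have n\<tau>: "orbit \<tau> x \<noteq> {x}" if "x \<in> perm_supp \<tau>" using that by (simp add: orbit_eq_singleton_iff perm_supp_iff)
      have "\<sigma> s \<in> ?O" "s \<in> ?O" "\<sigma> s \<noteq> s" using self\<sigma> ss by (auto intro: orbit.base simp: perm_supp_iff)
      then have "?O \<noteq> {x}" by (metis singletonD)
      then have "orbit \<sigma> x \<noteq> orbit \<sigma> s" "orbit \<tau> x \<noteq> orbit \<tau> s" using lo[of x] e by auto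
      moreover from x have "x \<in> perm_supp \<sigma> \<or> x \<in> perm_supp \<tau>" by simp
      ultimately show False using e l[of x] r[of x] n\<sigma> n\<tau> by metis
    qed
    then show "x \<in> perm_supp ?f" by (simp only: orbit_eq_singleton_iff perm_supp_iff) simp
  qed
  have img: "orbit ?f ` perm_supp ?f = insert ?O ((?A - {orbit \<sigma> s}) \<union> (?B - {orbit \<tau> s}))" (is "?L = ?R")
  proof
    show "?L \<subseteq> ?R"
    proof
      fix X assume "X \<in> ?L"
      then obtain x where x: "x \<in> perm_supp \<sigma> \<union> perm_supp \<tau>" "X = orbit ?f x" unfolding S by blast
      then show "X \<in> ?R" using l[of x] r[of x] lo[of x] by blast
    qed
    have "?O \<in> ?L" using O S ss by blast
    moreover have "?A - {orbit \<sigma> s} \<subseteq> ?L"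
    proof
      fix X assume "X \<in> ?A - {orbit \<sigma> s}"
      then obtain x where "x \<in> perm_supp \<sigma>" "X = orbit \<sigma> x" "orbit \<sigma> x \<noteq> orbit \<sigma> s" by blast
      then show "X \<in> ?L" using l[of x] S by (intro image_eqI[of _ _ x]) auto
    qed
    moreover have "?B - {orbit \<tau> s} \<subseteq> ?L"
    proof
      fix X assume "X \<in> ?B - {orbit \<tau> s}"
      then obtain x where "x \<in> perm_supp \<tau>" "X = orbit \<tau> x" "orbit \<tau> x \<noteq> orbit \<tau> s" by blast
      then show "X \<in> ?L" using r[of x] S by (intro image_eqI[of _ _ x]) auto
    qed
    ultimately show "?R \<subseteq> ?L" by simp
  qed
  have nA: "s \<notin> X" if "X \<in> ?A - {orbit \<sigma> s}" for X
    using that orbit_eq_of_mem[OF \<sigma>] by blast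
  have nB: "s \<notin> X" if "X \<in> ?B - {orbit \<tau> s}" for X
    using that orbit_eq_of_mem[OF \<tau>] by blast
  have disj: "(?A - {orbit \<sigma> s}) \<inter> (?B - {orbit \<tau> s}) = {}"
  proof (rule ccontr)
    assume "(?A - {orbit \<sigma> s}) \<inter> (?B - {orbit \<tau> s}) \<noteq> {}"
    then obtain X where X: "X \<in> ?A - {orbit \<sigma> s}" "X \<in> ?B - {orbit \<tau> s}" by blast
    then obtain x y where xy: "x \<in> perm_supp \<sigma>" "X = orbit \<sigma> x" "y \<in> perm_supp \<tau>" "X = orbit \<tau> y" by blast
    have "x \<in> X" using xy self\<sigma> by blast
    moreover have "X \<subseteq> perm_supp \<sigma>" "X \<subseteq> perm_supp \<tau>" using xy sub\<sigma> sub\<tau> by blast+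
    ultimately have "x = s" using only by blast
    then show False using nA[OF X(1)] \<open>x \<in> X\<close> by blast
  qed
  have nO: "?O \<notin> (?A - {orbit \<sigma> s}) \<union> (?B - {orbit \<tau> s})"
  proof -
    have "s \<in> ?O" using self\<sigma> by blast
    then show ?thesis using nA[of ?O] nB[of ?O] by blast
  qed
  \<comment> \<open>The two cycles share \<open>s\<close> only, hence the 1 that is
    subtracted.\<close>
  have cO: "card ?O = card (orbit \<sigma> s) + card (orbit \<tau> s) - 1"
  proof -
    have "orbit \<sigma> s \<inter> orbit \<tau> s = {s}"
      using sub\<sigma>[OF ss(1)] sub\<tau>[OF ss(2)] only self\<sigma> self\<tau> by blast
    then show ?thesis
      using card_Un_Int[OF finite_orbit_permutation[OF \<sigma>] finite_orbit_permutation[OF \<tau>], of s s] by simp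
  qed
  have finA: "finite ?A" "finite ?B" using finite_perm_supp \<sigma> \<tau> by auto
  have del: "image_mset card (mset_set (X - {Y})) = image_mset card (mset_set X) - {#card Y#}"
    if "finite X" "Y \<in> X" for X and Y :: "nat set"
    using that by (simp add: mset_set_Diff image_mset_Diff)
  have "nontrivial_cycle_type ?f = {#card ?O#} +
     (image_mset card (mset_set (?A - {orbit \<sigma> s})) + image_mset card (mset_set (?B - {orbit \<tau> s})))"
    unfolding nontrivial_cycle_type_alt img using nO finA by (simp add: mset_set_Union[OF _ _ disj])
  also have "\<dots> = {#card ?O#} + ((nontrivial_cycle_type \<sigma> - {#card (orbit \<sigma> s)#}) + (nontrivial_cycle_type \<tau> - {#card (orbit \<tau> s)#}))"
    using del[OF finA(1), of "orbit \<sigma> s"] del[OF finA(2), of "orbit \<tau> s"] ss by (simp add: nontrivial_cycle_type_alt)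
  finally show ?thesis unfolding cO by (simp add: ac_simps)
qed


section \<open>The extremal characters\<close>

lemma thoma_character_conj_by:
  "permutation \<sigma> \<Longrightarrow> bij g \<Longrightarrow> thoma_character \<omega> (conj_by g \<sigma>) = thoma_character \<omega> \<sigma>"
  by (simp add: thoma_character_def nontrivial_cycle_type_conj_by)

lemma thoma_character_disjoint:
  "permutation \<sigma> \<Longrightarrow> permutation \<tau> \<Longrightarrow> perm_supp \<sigma> \<inter> perm_supp \<tau> = {} \<Longrightarrow>
    thoma_character \<omega> (\<sigma> \<circ> \<tau>) = thoma_character \<omega> \<sigma> * thoma_character \<omega> \<tau>"
  by (simp add: thoma_character_def nontrivial_cycle_type_disjoint thoma_p_part_def)

lemma thoma_character_id: "thoma_character \<omega> id = 1"
  by (simp add: thoma_character_def nontrivial_cycle_type_def thoma_p_part_def)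

text \<open>Every coordinate lies in the unit interval, so its powers do not exceed it; the two
  power sums are bounded by the sums of \<alpha> and \<beta>, which together are at most 1.\<close>

lemma abs_thoma_p_le_1:
  assumes \<omega>: "\<omega> \<in> thoma_simplex" and k: "k \<ge> 1" shows "\<bar>thoma_p \<omega> k\<bar> \<le> 1"
proof (cases "k = 1")
  case False
  obtain \<alpha> \<beta> where ab: "\<omega> = (\<alpha>, \<beta>)" "\<And>i. \<alpha> i \<ge> 0" "\<And>i. \<beta> i \<ge> 0" "summable \<alpha>" "summable \<beta>" "suminf \<alpha> + suminf \<beta> \<le> 1"
    using \<omega> by (auto simp: thoma_simplex_def)
  have pow: "0 \<le> (\<Sum>i. x i ^ k) \<and> (\<Sum>i. x i ^ k) \<le> suminf x"
    if x: "\<And>i. x i \<ge> 0" "summable x" "suminf x \<le> 1" for x :: "nat \<Rightarrow> real"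
  proof -
    have x1: "x i \<le> 1" for i
      using sum_le_suminf[OF x(2), of "{i}"] x by simp
    have le: "x i ^ k \<le> x i" for i
      using power_decreasing[of 1 k "x i"] k x(1) x1 by simp
    have s: "summable (\<lambda>i. x i ^ k)"
      by (rule summable_comparison_test'[OF x(2), of 0]) (use le x(1) in simp)
    show ?thesis using suminf_nonneg[OF s] suminf_le[OF le s x(2)] x(1) by simp
  qed
  have nn: "suminf \<alpha> \<ge> 0" "suminf \<beta> \<ge> 0" using ab suminf_nonneg by blast+
  have "0 \<le> (\<Sum>i. \<alpha> i ^ k)" "(\<Sum>i. \<alpha> i ^ k) \<le> suminf \<alpha>" "0 \<le> (\<Sum>i. \<beta> i ^ k)" "(\<Sum>i. \<beta> i ^ k) \<le> suminf \<beta>"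
    using pow[of \<alpha>] pow[of \<beta>] ab nn by auto
  then have "\<bar>\<Sum>i. \<alpha> i ^ k\<bar> + \<bar>(- 1) ^ (k - 1) * (\<Sum>i. \<beta> i ^ k)\<bar> \<le> 1"
    using ab(6) by (simp add: abs_mult power_abs)
  then show ?thesis using False by (simp add: thoma_p_def ab(1))
qed (simp add: thoma_p_def)

lemma abs_thoma_p_part_le_1:
  assumes "\<omega> \<in> thoma_simplex" "0 \<notin># \<mu>" shows "\<bar>thoma_p_part \<omega> \<mu>\<bar> \<le> 1"
  using assms(2)
proof (induction \<mu>)
  case (add k \<mu>)
  then have "\<bar>thoma_p \<omega> k\<bar> \<le> 1" by (intro abs_thoma_p_le_1[OF assms(1)]) auto
  moreover have "\<bar>thoma_p_part \<omega> \<mu>\<bar> \<le> 1" using add by simp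
  ultimately have "\<bar>thoma_p \<omega> k\<bar> * \<bar>thoma_p_part \<omega> \<mu>\<bar> \<le> 1 * 1" by (intro mult_mono) auto
  then show ?case by (simp add: thoma_p_part_def abs_mult)
qed (simp add: thoma_p_part_def)

lemma abs_thoma_character_le_1:
  "\<omega> \<in> thoma_simplex \<Longrightarrow> permutation \<sigma> \<Longrightarrow> \<bar>thoma_character \<omega> \<sigma>\<bar> \<le> 1"
  unfolding thoma_character_def
  by (rule abs_thoma_p_part_le_1) (use nontrivial_cycle_type_ge_2[of \<sigma> 0] in auto)

section \<open>The limit covariance as a function of two cycle types\<close>

definition thoma_covariance :: "(nat \<Rightarrow> real) \<times> (nat \<Rightarrow> real) \<Rightarrow> nat multiset \<Rightarrow> nat multiset \<Rightarrow> real" where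
  "thoma_covariance \<omega> \<mu> \<nu> = (\<Sum>a\<in>#\<mu>. \<Sum>b\<in>#\<nu>. real a * real b * thoma_p_part \<omega> (\<mu> + \<nu> - {#a, b#}) *
     (thoma_p \<omega> (a + b - 1) - thoma_p \<omega> a * thoma_p \<omega> b))"

lemma thoma_p_1: "thoma_p \<omega> (Suc 0) = 1"
  by (simp add: thoma_p_def)

lemma thoma_p_part_filter: "thoma_p_part \<omega> (filter_mset (\<lambda>k. k \<noteq> 1) \<mu>) = thoma_p_part \<omega> \<mu>"
  by (induction \<mu>) (auto simp: thoma_p_part_def thoma_p_def)

lemma sum_mset_filter_1:
  "(\<And>a. a \<in># \<mu> \<Longrightarrow> a = 1 \<Longrightarrow> f a = (0::real)) \<Longrightarrow> (\<Sum>a\<in>#filter_mset (\<lambda>k. k \<noteq> (1::nat)) \<mu>. f a) = (\<Sum>a\<in>#\<mu>. f a)"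
  by (induction \<mu>) auto

text \<open>A part 1 among the remaining parts contributes the factor
  \<open>thoma_p \<omega> 1 = 1\<close>. As \<open>a\<close> or \<open>b\<close> it makes the
  bracket vanish, since \<open>a + b - 1\<close> is then the other part.\<close>

lemma thoma_covariance_filter:
  "thoma_covariance \<omega> (filter_mset (\<lambda>k. k \<noteq> 1) \<mu>) (filter_mset (\<lambda>k. k \<noteq> 1) \<nu>) = thoma_covariance \<omega> \<mu> \<nu>"
proof -
  let ?F = "filter_mset (\<lambda>k. k \<noteq> (1::nat))"
  have e: "thoma_p_part \<omega> (?F \<mu> + ?F \<nu> - {#a, b#}) = thoma_p_part \<omega> (\<mu> + \<nu> - {#a, b#})"
    if "a \<in># ?F \<mu>" "b \<in># ?F \<nu>" for a b
  proof -
    have "?F \<mu> + ?F \<nu> - {#a, b#} = ?F (\<mu> + \<nu> - {#a, b#})" using that by (simp add: filter_diff_mset)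
    then show ?thesis by (simp only: thoma_p_part_filter)
  qed
  have "thoma_covariance \<omega> (?F \<mu>) (?F \<nu>) = (\<Sum>a\<in>#?F \<mu>. \<Sum>b\<in>#?F \<nu>. real a * real b * thoma_p_part \<omega> (\<mu> + \<nu> - {#a, b#}) *
     (thoma_p \<omega> (a + b - 1) - thoma_p \<omega> a * thoma_p \<omega> b))"
    unfolding thoma_covariance_def
    by (intro arg_cong[where f = sum_mset] image_mset_cong arg_cong2[where f = "(*)"] refl e) auto
  also have "\<dots> = thoma_covariance \<omega> \<mu> \<nu>"
    unfolding thoma_covariance_def
    by (subst (1 2) sum_mset_filter_1) (auto simp: thoma_p_1 intro!: sum_mset.neutral)
  finally show ?thesis .
qed

lemma thoma_covariance_single:
  "thoma_covariance \<omega> {#l#} {#m#} = real l * real m * (thoma_p \<omega> (l + m - 1) - thoma_p \<omega> l * thoma_p \<omega> m)"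
  by (simp add: thoma_covariance_def thoma_p_part_def)

lemma thoma_covariance_commute: "thoma_covariance \<omega> \<mu> \<nu> = thoma_covariance \<omega> \<nu> \<mu>"
proof -
  have "thoma_covariance \<omega> \<mu> \<nu> = (\<Sum>b\<in>#\<nu>. \<Sum>a\<in>#\<mu>. real a * real b * thoma_p_part \<omega> (\<mu> + \<nu> - {#a, b#}) *
     (thoma_p \<omega> (a + b - 1) - thoma_p \<omega> a * thoma_p \<omega> b))"
    unfolding thoma_covariance_def by (rule sum_mset.swap)
  also have "\<dots> = thoma_covariance \<omega> \<nu> \<mu>"
    unfolding thoma_covariance_def by (simp add: add_mset_commute ac_simps)
  finally show ?thesis .
qed

text \<open>The character of the product and the product of the characters share all factors except
  those of the cycles through \<open>s\<close>: \<open>thoma_p\<close> at \<open>a + b - 1\<close>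
  for the former, at \<open>a\<close> and at \<open>b\<close> for the latter.\<close>

lemma thoma_character_merge:
  assumes \<sigma>: "permutation \<sigma>" and \<tau>: "permutation \<tau>" and s: "perm_supp \<sigma> \<inter> perm_supp \<tau> = {s}"
  defines "a \<equiv> card (orbit \<sigma> s)" and "b \<equiv> card (orbit \<tau> s)"
  shows "thoma_character \<omega> (\<sigma> \<circ> \<tau>) - thoma_character \<omega> \<sigma> * thoma_character \<omega> \<tau> =
    thoma_p_part \<omega> (nontrivial_cycle_type \<sigma> + nontrivial_cycle_type \<tau> - {#a, b#}) *
     (thoma_p \<omega> (a + b - 1) - thoma_p \<omega> a * thoma_p \<omega> b)"
proof -
  let ?\<mu> = "nontrivial_cycle_type \<sigma>" let ?\<nu> = "nontrivial_cycle_type \<tau>"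
  have ss: "s \<in> perm_supp \<sigma>" "s \<in> perm_supp \<tau>" using s by auto
  have "a \<in># ?\<mu>" "b \<in># ?\<nu>"
    using ss finite_perm_supp[OF \<sigma>] finite_perm_supp[OF \<tau>]
    by (auto simp: nontrivial_cycle_type_alt a_def b_def)
  then obtain \<mu>' \<nu>' where "?\<mu> = add_mset a \<mu>'" "?\<nu> = add_mset b \<nu>'" by (metis mset_add)
  then show ?thesis
    unfolding thoma_character_def nontrivial_cycle_type_merge[OF \<sigma> \<tau> s] a_def[symmetric] b_def[symmetric]
    by (simp add: thoma_p_part_def algebra_simps)
qed


section \<open>Weighted sums over families of vertices\<close>

text \<open>If \<open>wt\<close> is a probability distribution, this is the conditional expectation of \<open>F\<close> at independent
  vertices, given those outside \<open>V\<close>.\<close>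

definition wsum :: "'w set \<Rightarrow> ('w \<Rightarrow> real) \<Rightarrow> 'i set \<Rightarrow> (('i \<Rightarrow> 'w) \<Rightarrow> real) \<Rightarrow> ('i \<Rightarrow> 'w) \<Rightarrow> real" where
  "wsum W wt V F w = (\<Sum>f\<in>PiE V (\<lambda>_. W). (\<Prod>i\<in>V. wt (f i)) * F (\<lambda>i. if i \<in> V then f i else w i))"

lemma wsum_empty: "wsum W wt {} F w = F w"
  by (simp add: wsum_def)

text \<open>Summing over one more vertex amounts to fixing its value in the outer configuration
  \<open>w\<close>; this is the form of Fubini that the inductions below use.\<close>

lemma wsum_insert:
  assumes "finite V" "i \<notin> V"
  shows "wsum W wt (insert i V) F w = (\<Sum>a\<in>W. wt a * wsum W wt V F (w(i := a)))"
proof -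
  have inj: "inj_on (\<lambda>(y, g). g(i := y)) (W \<times> PiE V (\<lambda>_. W))"
    using inj_combinator[of i V "\<lambda>_. W"] assms(2) by simp
  have e: "(\<lambda>j. if j \<in> insert i V then (g(i := a)) j else w j) = (\<lambda>j. if j \<in> V then g j else (w(i := a)) j)" for g a
    using assms(2) by auto
  have p: "(\<Prod>j\<in>insert i V. wt ((g(i := a)) j)) = wt a * (\<Prod>j\<in>V. wt (g j))" for g a
    using assms by (simp add: prod.insert) (intro disjI2 prod.cong, auto)
  have "wsum W wt (insert i V) F w = (\<Sum>(a, g)\<in>W \<times> PiE V (\<lambda>_. W).
      (\<Prod>j\<in>insert i V. wt ((g(i := a)) j)) * F (\<lambda>j. if j \<in> insert i V then (g(i := a)) j else w j))"
    unfolding wsum_def PiE_insert_eq by (subst sum.reindex[OF inj]) (simp add: case_prod_unfold)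
  also have "\<dots> = (\<Sum>(a, g)\<in>W \<times> PiE V (\<lambda>_. W). wt a * ((\<Prod>j\<in>V. wt (g j)) * F (\<lambda>j. if j \<in> V then g j else (w(i := a)) j)))"
    unfolding e p by (simp add: mult.assoc)
  finally show ?thesis by (simp add: wsum_def sum_distrib_left sum.cartesian_product)
qed

lemma wsum_cong:
  assumes "\<And>w'. (\<And>i. i \<in> V \<Longrightarrow> w' i \<in> W) \<Longrightarrow> (\<And>i. i \<notin> V \<Longrightarrow> w' i = w i) \<Longrightarrow> F w' = G w'"
  shows "wsum W wt V F w = wsum W wt V G w"
  unfolding wsum_def by (intro sum.cong refl arg_cong2[where f = "(*)"] assms) auto

lemma wsum_base:
  assumes "\<And>w' w''. (\<And>i. i \<in> V \<Longrightarrow> w' i = w'' i) \<Longrightarrow> F w' = F w''"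
  shows "wsum W wt V F w = wsum W wt V F v"
  unfolding wsum_def by (intro sum.cong refl arg_cong2[where f = "(*)"] assms) auto

lemma wsum_mono:
  assumes "\<And>a. a \<in> W \<Longrightarrow> wt a \<ge> 0"
    and "\<And>w'. (\<And>i. i \<in> V \<Longrightarrow> w' i \<in> W) \<Longrightarrow> (\<And>i. i \<notin> V \<Longrightarrow> w' i = w i) \<Longrightarrow> F w' \<le> G w'"
  shows "wsum W wt V F w \<le> wsum W wt V G w"
  unfolding wsum_def
proof (intro sum_mono mult_left_mono)
  fix f assume f: "f \<in> V \<rightarrow>\<^sub>E W"
  show "F (\<lambda>i. if i \<in> V then f i else w i) \<le> G (\<lambda>i. if i \<in> V then f i else w i)"
    by (rule assms(2)) (use f in auto)
  show "0 \<le> (\<Prod>i\<in>V. wt (f i))" using f by (intro prod_nonneg) (auto intro: assms(1))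
qed

lemma abs_wsum_le: "\<bar>wsum W wt V F w\<bar> \<le> wsum W (\<lambda>a. \<bar>wt a\<bar>) V (\<lambda>w. \<bar>F w\<bar>) w"
  unfolding wsum_def by (rule order_trans[OF sum_abs]) (simp add: abs_mult abs_prod)

lemma wsum_add: "wsum W wt V (\<lambda>w. F w + G w) w = wsum W wt V F w + wsum W wt V G w"
  by (simp add: wsum_def sum.distrib algebra_simps)

lemma wsum_diff: "wsum W wt V (\<lambda>w. F w - G w) w = wsum W wt V F w - wsum W wt V G w"
  by (simp add: wsum_def sum_subtractf algebra_simps)

lemma wsum_mult_const: "wsum W wt V (\<lambda>w. c * F w) w = c * wsum W wt V F w"
  by (simp add: wsum_def sum_distrib_left mult_ac)

lemma wsum_sum: "wsum W wt V (\<lambda>w. \<Sum>j\<in>J. F j w) w = (\<Sum>j\<in>J. wsum W wt V (F j) w)"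
  unfolding wsum_def by (subst sum.swap) (simp add: sum_distrib_left)

lemma wsum_pull:
  assumes "\<And>w'. (\<And>i. i \<notin> V \<Longrightarrow> w' i = w i) \<Longrightarrow> P w' = P w"
  shows "wsum W wt V (\<lambda>w'. P w' * F w') w = P w * wsum W wt V F w"
proof -
  have "wsum W wt V (\<lambda>w'. P w' * F w') w = wsum W wt V (\<lambda>w'. P w * F w') w"
  proof (rule wsum_cong)
    fix w' assume "\<And>i. i \<notin> V \<Longrightarrow> w' i = w i"
    then have "P w' = P w" by (rule assms)
    then show "P w' * F w' = P w * F w'" by simp
  qed
  then show ?thesis by (simp add: wsum_mult_const)
qed

text \<open>Independence of functions that depend on disjoint sets of vertices.\<close>

lemma wsum_mult:
  fixes F G :: "('i \<Rightarrow> 'w) \<Rightarrow> real"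
  assumes "finite V1" "finite V2" "V1 \<inter> V2 = {}"
    and F: "\<And>w' w''. (\<And>i. i \<in> V1 \<Longrightarrow> w' i = w'' i) \<Longrightarrow> F w' = F w''"
    and G: "\<And>w' w''. (\<And>i. i \<in> V2 \<Longrightarrow> w' i = w'' i) \<Longrightarrow> G w' = G w''"
  shows "wsum W wt (V1 \<union> V2) (\<lambda>w. F w * G w) w = wsum W wt V1 F w * wsum W wt V2 G w"
proof -
  have F': "F w' = F w''" if "\<And>i. i \<notin> V2 \<Longrightarrow> w' i = w'' i" for w' w''
  proof (rule F)
    fix i assume "i \<in> V1"
    then have "i \<notin> V2" using assms(3) by blast
    then show "w' i = w'' i" by (rule that)
  qed
  have "wsum W wt (S \<union> V2) (\<lambda>w. F w * G w) w = wsum W wt S F w * wsum W wt V2 G w"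
    if "finite S" "S \<inter> V2 = {}" for S w
    using that
  proof (induction S arbitrary: w rule: finite_induct)
    case empty
    have "wsum W wt V2 (\<lambda>w. F w * G w) w = F w * wsum W wt V2 G w"
    proof (rule wsum_pull)
      fix w' assume "\<And>i. i \<notin> V2 \<Longrightarrow> w' i = w i"
      then show "F w' = F w" by (rule F')
    qed
    then show ?case by (simp only: wsum_empty Un_empty_left)
  next
    case (insert i S)
    have "wsum W wt (insert i S \<union> V2) (\<lambda>w. F w * G w) w =
      (\<Sum>a\<in>W. wt a * wsum W wt (S \<union> V2) (\<lambda>w. F w * G w) (w(i := a)))"
      unfolding Un_insert_left by (rule wsum_insert) (use insert.hyps(1,2) insert.prems assms(2) in auto)
    also have "\<dots> = (\<Sum>a\<in>W. wt a * wsum W wt S F (w(i := a)) * wsum W wt V2 G w)"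
    proof (intro sum.cong refl)
      fix a
      have "wsum W wt V2 G (w(i := a)) = wsum W wt V2 G w" 
      proof (rule wsum_base)
        fix w' w'' :: "'i \<Rightarrow> 'w" assume "\<And>i. i \<in> V2 \<Longrightarrow> w' i = w'' i"
        then show "G w' = G w''" by (rule G)
      qed
      moreover have "wsum W wt (S \<union> V2) (\<lambda>w. F w * G w) (w(i := a)) = wsum W wt S F (w(i := a)) * wsum W wt V2 G (w(i := a))"
        by (rule insert.IH) (use insert.prems in blast)
      ultimately show "wt a * wsum W wt (S \<union> V2) (\<lambda>w. F w * G w) (w(i := a)) =
        wt a * wsum W wt S F (w(i := a)) * wsum W wt V2 G w"
        by (simp only: mult.assoc)
    qed
    also have "\<dots> = wsum W wt (insert i S) F w * wsum W wt V2 G w"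
      unfolding wsum_insert[OF insert.hyps(1,2)] by (simp only: sum_distrib_right)
    finally show ?case .
  qed
  from this[OF assms(1,3)] show ?thesis .
qed


section \<open>Random intersection graphs without isolated vertices\<close>

text \<open>\<open>U\<close> holds the vertices already explored: they may serve as neighbours, but
  are not asked to have one.\<close>

definition covered :: "('w \<Rightarrow> 'w \<Rightarrow> bool) \<Rightarrow> nat set \<Rightarrow> nat set \<Rightarrow> (nat \<Rightarrow> 'w) \<Rightarrow> bool" where
  "covered R V U w \<longleftrightarrow> (\<forall>i\<in>V. \<exists>j\<in>V \<union> U. j \<noteq> i \<and> R (w i) (w j))"

text \<open>The two summands are the two cases in \<open>asum_covered_le\<close>: the chosen vertex
  finds its neighbour among the \<open>m\<close> explored ones, or among the \<open>k\<close>
  others, in which case two vertices are used up. At \<open>k = 0\<close> the truncated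
  \<open>k - 1\<close> is multiplied by 0.\<close>

fun cov_const :: "real \<Rightarrow> real \<Rightarrow> nat \<Rightarrow> nat \<Rightarrow> real" where
  "cov_const T K 0 m = 1"
| "cov_const T K (Suc k) m = real m * K * cov_const T K k (m + 1) + real k * T * K * cov_const T K (k - 1) (m + 2)"

lemma cov_const_nonneg: "T \<ge> 0 \<Longrightarrow> K \<ge> 0 \<Longrightarrow> cov_const T K k m \<ge> 0"
  by (induction T K k m rule: cov_const.induct) auto

text \<open>The weights may have either sign, so total mass and meeting probability are measured by
  absolute values. The scale \<open>e\<close> stands for \<open>1 / sqrt n\<close>: a random vertex
  meets a given one with weight of order \<open>e\<^sup>2\<close>.\<close>

locale weighted_graph =
  fixes W :: "'w set" and wt :: "'w \<Rightarrow> real" and R :: "'w \<Rightarrow> 'w \<Rightarrow> bool" and T K e :: real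
  assumes finW: "finite W"
    and R_sym: "\<And>a b. R a b = R b a"
    and T: "(\<Sum>a\<in>W. \<bar>wt a\<bar>) \<le> T"
    and K0: "K \<ge> 0"
    and K: "\<And>b. b \<in> W \<Longrightarrow> (\<Sum>a\<in>W. \<bar>wt a\<bar> * of_bool (R a b)) \<le> K * e\<^sup>2"
    and e: "0 \<le> e" "e \<le> 1"
begin

abbreviation asum :: "nat set \<Rightarrow> ((nat \<Rightarrow> 'w) \<Rightarrow> real) \<Rightarrow> (nat \<Rightarrow> 'w) \<Rightarrow> real" where
  "asum \<equiv> wsum W (\<lambda>a. \<bar>wt a\<bar>)"

lemma T0: "T \<ge> 0"
  by (rule order_trans[OF _ T]) (simp add: sum_nonneg)

lemma sum_edge: "(\<Sum>a\<in>W. \<Sum>b\<in>W. \<bar>wt a\<bar> * \<bar>wt b\<bar> * of_bool (R a b)) \<le> T * K * e\<^sup>2"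
proof -
  have "(\<Sum>a\<in>W. \<Sum>b\<in>W. \<bar>wt a\<bar> * \<bar>wt b\<bar> * of_bool (R a b)) = (\<Sum>b\<in>W. \<bar>wt b\<bar> * (\<Sum>a\<in>W. \<bar>wt a\<bar> * of_bool (R a b)))"
    by (subst sum.swap) (simp add: sum_distrib_left mult_ac)
  also have "\<dots> \<le> (\<Sum>b\<in>W. \<bar>wt b\<bar> * (K * e\<^sup>2))" by (intro sum_mono mult_left_mono K) auto
  also have "\<dots> = (\<Sum>b\<in>W. \<bar>wt b\<bar>) * (K * e\<^sup>2)" by (simp add: sum_distrib_right)
  also have "\<dots> \<le> T * (K * e\<^sup>2)" using T K0 by (intro mult_right_mono) auto
  finally show ?thesis by (simp add: mult.assoc)
qed

lemma asum_mono:
  "(\<And>w'. (\<And>i. i \<in> V \<Longrightarrow> w' i \<in> W) \<Longrightarrow> (\<And>i. i \<notin> V \<Longrightarrow> w' i = w i) \<Longrightarrow> F w' \<le> G w') \<Longrightarrow> asum V F w \<le> asum V G w"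
  by (rule wsum_mono) auto

text \<open>Exploring the graph from a vertex: each new edge costs a factor \<open>e\<^sup>2\<close> and brings in at most two vertices.\<close>

lemma asum_covered_le:
  assumes "finite V" "finite U" "V \<inter> U = {}" "card V = k" "card U = m" "\<And>j. j \<in> U \<Longrightarrow> w j \<in> W"
  shows "asum V (\<lambda>w. of_bool (covered R V U w)) w \<le> cov_const T K k m * e ^ k"
  using assms
proof (induction k arbitrary: V U m w rule: less_induct)
  case (less k)
  show ?case
  proof (cases k)
    case 0
    then have "V = {}" using less.prems by simp
    then show ?thesis using 0 by (simp add: wsum_empty)
  next
    case (Suc k')
    then obtain i V' where V: "V = insert i V'" "i \<notin> V'" "card V' = k'"
      using less.prems(4) by (metis card_Suc_eq)
    have finV': "finite V'" using V less.prems by simp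
    have iU: "i \<notin> U" and V'U: "V' \<inter> U = {}" using V less.prems by auto
    \<comment> \<open>The neighbour of \<open>i\<close> is a vertex of \<open>U\<close> in
      \<open>?G\<close> and an unexplored one in \<open>?H\<close>; the latter leaves
      \<open>V\<close> together with \<open>i\<close>.\<close>
    let ?G = "\<lambda>j w. of_bool (R (w i) (w j)) * of_bool (covered R V' (insert i U) w) :: real"
    let ?H = "\<lambda>j w. of_bool (R (w i) (w j)) * of_bool (covered R (V' - {j}) (insert j (insert i U)) w) :: real"
    have point: "of_bool (covered R V U w) \<le> (\<Sum>j\<in>U. ?G j w) + (\<Sum>j\<in>V'. ?H j w)" for w
    proof (cases "covered R V U w")
      case True
      then obtain j where j: "j \<in> V \<union> U" "j \<noteq> i" "R (w i) (w j)" using V by (auto simp: covered_def)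
      have nn: "(\<Sum>j\<in>U. ?G j w) \<ge> 0" "(\<Sum>j\<in>V'. ?H j w) \<ge> 0" by (intro sum_nonneg; simp)+
      from j V consider "j \<in> U" | "j \<in> V'" by auto
      then show ?thesis
      proof cases
        case 1
        have "covered R V' (insert i U) w" using True V by (auto simp: covered_def)
        then have "1 \<le> (\<Sum>j\<in>U. ?G j w)"
          using member_le_sum[of j U "\<lambda>j. ?G j w"] 1 j less.prems(2) by simp
        then show ?thesis using nn True by simp
      next
        case 2
        have "covered R (V' - {j}) (insert j (insert i U)) w" using True V by (auto simp: covered_def)
        then have "1 \<le> (\<Sum>j\<in>V'. ?H j w)"
          using member_le_sum[of j V' "\<lambda>j. ?H j w"] 2 j finV' by simp
        then show ?thesis using nn True by simp
      qed
    qed (simp add: sum_nonneg)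
    have c0: "cov_const T K a b \<ge> 0" for a b by (rule cov_const_nonneg[OF T0 K0])
    have G: "asum V (?G j) w \<le> K * cov_const T K k' (m + 1) * e ^ k" if j: "j \<in> U" for j
    proof -
      have ij: "j \<noteq> i" using j iU by blast
      have "asum V (?G j) w = (\<Sum>a\<in>W. \<bar>wt a\<bar> * asum V' (?G j) (w(i := a)))"
        unfolding V(1) by (rule wsum_insert[OF finV' V(2)])
      also have "\<dots> = (\<Sum>a\<in>W. \<bar>wt a\<bar> * (of_bool (R a (w j)) * asum V' (\<lambda>w. of_bool (covered R V' (insert i U) w)) (w(i := a))))"
      proof (intro sum.cong refl arg_cong2[where f = "(*)"])
        fix a
        have "asum V' (?G j) (w(i := a)) = of_bool (R ((w(i := a)) i) ((w(i := a)) j)) *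
          asum V' (\<lambda>w. of_bool (covered R V' (insert i U) w)) (w(i := a))"
        proof (rule wsum_pull)
          fix w' assume h: "\<And>x. x \<notin> V' \<Longrightarrow> w' x = (w(i := a)) x"
          have "j \<notin> V'" using j V'U by blast
          then show "of_bool (R (w' i) (w' j)) = of_bool (R ((w(i := a)) i) ((w(i := a)) j))"
            using h[OF V(2)] h[of j] by simp
        qed
        then show "asum V' (?G j) (w(i := a)) = of_bool (R a (w j)) *
          asum V' (\<lambda>w. of_bool (covered R V' (insert i U) w)) (w(i := a))"
          using ij by simp
      qed
      also have "\<dots> \<le> (\<Sum>a\<in>W. \<bar>wt a\<bar> * (of_bool (R a (w j)) * (cov_const T K k' (m + 1) * e ^ k')))"
      proof (intro sum_mono mult_left_mono)
        fix a assume a: "a \<in> W"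
        show "asum V' (\<lambda>w. of_bool (covered R V' (insert i U) w)) (w(i := a)) \<le> cov_const T K k' (m + 1) * e ^ k'"
        proof (rule less.IH)
          show "k' < k" "finite V'" "finite (insert i U)" "V' \<inter> insert i U = {}" "card V' = k'" "card (insert i U) = m + 1"
            using Suc finV' less.prems(2,5) V V'U iU by simp_all
          show "(w(i := a)) j \<in> W" if "j \<in> insert i U" for j
            using that a less.prems(6)[of j] by (cases "j = i") simp_all
        qed
      qed auto
      also have "\<dots> = (\<Sum>a\<in>W. \<bar>wt a\<bar> * of_bool (R a (w j))) * (cov_const T K k' (m + 1) * e ^ k')"
        by (simp add: sum_distrib_right mult.assoc)
      also have "\<dots> \<le> K * e\<^sup>2 * (cov_const T K k' (m + 1) * e ^ k')"
        using less.prems(6) j c0 e by (intro mult_right_mono K) auto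
      \<comment> \<open>One vertex accounts for a factor \<open>e\<^sup>2\<close> here, where
        \<open>e\<close> suffices; the surplus \<open>e\<close> is bounded by 1.\<close>
      also have "\<dots> = K * cov_const T K k' (m + 1) * (e ^ k * e)"
        by (simp add: Suc power2_eq_square)
      also have "\<dots> \<le> K * cov_const T K k' (m + 1) * (e ^ k * 1)"
        using K0 c0 e by (intro mult_left_mono) auto
      finally show ?thesis by simp
    qed
    have H: "asum V (?H j) w \<le> T * K * cov_const T K (k' - 1) (m + 2) * e ^ k" if j: "j \<in> V'" for j
    proof -
      have ji: "j \<noteq> i" using j V by auto
      have k': "k' = Suc (k' - 1)" using j V finV' by (metis Suc_pred' card_gt_0_iff empty_iff)
      have cj: "card (V' - {j}) = k' - 1" using j V finV' by simp
      let ?A = "\<lambda>a b. asum (V' - {j}) (\<lambda>w. of_bool (covered R (V' - {j}) (insert j (insert i U)) w)) (w(i := a, j := b))"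
      have "asum V (?H j) w = (\<Sum>a\<in>W. \<bar>wt a\<bar> * asum V' (?H j) (w(i := a)))"
        unfolding V(1) by (rule wsum_insert[OF finV' V(2)])
      also have "\<dots> = (\<Sum>a\<in>W. \<bar>wt a\<bar> * (\<Sum>b\<in>W. \<bar>wt b\<bar> * asum (V' - {j}) (?H j) (w(i := a, j := b))))"
        using wsum_insert[of "V' - {j}" j W "\<lambda>a. \<bar>wt a\<bar>" "?H j"] finV' j by (simp add: insert_absorb)
      also have "\<dots> = (\<Sum>a\<in>W. \<bar>wt a\<bar> * (\<Sum>b\<in>W. \<bar>wt b\<bar> * (of_bool (R a b) * ?A a b)))"
      proof (intro sum.cong refl arg_cong2[where f = "(*)"])
        fix a b
        have "asum (V' - {j}) (?H j) (w(i := a, j := b)) = of_bool (R ((w(i := a, j := b)) i) ((w(i := a, j := b)) j)) * ?A a b"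
        proof (rule wsum_pull)
          fix w' assume h: "\<And>x. x \<notin> V' - {j} \<Longrightarrow> w' x = (w(i := a, j := b)) x"
          have "w' i = (w(i := a, j := b)) i" "w' j = (w(i := a, j := b)) j" using V(2) by (intro h; blast)+
          then show "of_bool (R (w' i) (w' j)) = of_bool (R ((w(i := a, j := b)) i) ((w(i := a, j := b)) j))"
            by (simp only:)
        qed
        then show "asum (V' - {j}) (?H j) (w(i := a, j := b)) = of_bool (R a b) * ?A a b"
          using ji by simp
      qed
      also have "\<dots> \<le> (\<Sum>a\<in>W. \<bar>wt a\<bar> * (\<Sum>b\<in>W. \<bar>wt b\<bar> * (of_bool (R a b) * (cov_const T K (k' - 1) (m + 2) * e ^ (k' - 1)))))"
      proof (intro sum_mono mult_left_mono)
        fix a b assume ab: "a \<in> W" "b \<in> W"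
        have jU: "j \<notin> U" using j V'U by blast
        then show "?A a b \<le> cov_const T K (k' - 1) (m + 2) * e ^ (k' - 1)"
        proof (intro less.IH)
          show "k' - 1 < k" "finite (V' - {j})" "finite (insert j (insert i U))" "card (V' - {j}) = k' - 1"
            "card (insert j (insert i U)) = m + 2"
            using Suc finV' less.prems(2,5) cj jU iU ji by simp_all
          show "(V' - {j}) \<inter> insert j (insert i U) = {}" using V(2) V'U by blast
          show "(w(i := a, j := b)) x \<in> W" if "x \<in> insert j (insert i U)" for x
            using that ab less.prems(6)[of x] by (cases "x = j"; cases "x = i") simp_all
        qed
      qed auto
      also have "\<dots> = (\<Sum>a\<in>W. \<Sum>b\<in>W. \<bar>wt a\<bar> * \<bar>wt b\<bar> * of_bool (R a b)) * (cov_const T K (k' - 1) (m + 2) * e ^ (k' - 1))"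
        by (simp add: sum_distrib_right sum_distrib_left mult.assoc)
      also have "\<dots> \<le> T * K * e\<^sup>2 * (cov_const T K (k' - 1) (m + 2) * e ^ (k' - 1))"
        using c0 e by (intro mult_right_mono sum_edge) auto
      \<comment> \<open>Two vertices share the factor \<open>e\<^sup>2\<close>: this case decides
        the exponent, one factor \<open>e\<close> per vertex.\<close>
      also have "\<dots> = T * K * cov_const T K (k' - 1) (m + 2) * (e * e ^ Suc (k' - 1))"
        by (simp add: power2_eq_square)
      finally show ?thesis using k' Suc by simp
    qed
    have "asum V (\<lambda>w. of_bool (covered R V U w)) w \<le> asum V (\<lambda>w. (\<Sum>j\<in>U. ?G j w) + (\<Sum>j\<in>V'. ?H j w)) w"
      by (rule asum_mono) (rule point)
    also have "\<dots> = (\<Sum>j\<in>U. asum V (?G j) w) + (\<Sum>j\<in>V'. asum V (?H j) w)"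
      by (simp only: wsum_add wsum_sum)
    also have "\<dots> \<le> (\<Sum>j\<in>U. K * cov_const T K k' (m + 1) * e ^ k) + (\<Sum>j\<in>V'. T * K * cov_const T K (k' - 1) (m + 2) * e ^ k)"
      by (intro add_mono sum_mono G H)
    also have "\<dots> = cov_const T K k m * e ^ k"
      using less.prems V by (simp add: Suc algebra_simps)
    finally show ?thesis .
  qed
qed

text \<open>The configurations in which \<open>i\<close> and its neighbour \<open>j\<close> are not
  a component by themselves: \<open>l\<close> is attached to the pair, and every other vertex still
  has a neighbour.\<close>

definition clustered :: "nat set \<Rightarrow> nat \<Rightarrow> nat \<Rightarrow> nat \<Rightarrow> (nat \<Rightarrow> 'w) \<Rightarrow> bool" where
  "clustered V i j l w \<longleftrightarrow> R (w i) (w j) \<and> (R (w l) (w i) \<or> R (w l) (w j)) \<and>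
     covered R (V - {i, j, l}) {i, j, l} w"

text \<open>Three vertices joined by two edges give \<open>e ^ 4\<close> instead of one factor
  \<open>e\<close> per vertex; the other vertices contribute \<open>e\<close> each. The extra factor
  \<open>e\<close> is the gain that makes the moment recursion asymptotically exact.\<close>

lemma asum_clustered_le:
  assumes V: "finite V" "i \<in> V" "j \<in> V" "l \<in> V" and d: "i \<noteq> j" "i \<noteq> l" "j \<noteq> l"
  shows "asum V (\<lambda>w. of_bool (clustered V i j l w)) w \<le>
    2 * T * K\<^sup>2 * cov_const T K (card V - 3) 3 * e ^ (card V + 1)"
proof -
  let ?S = "V - {i, j, l}"
  let ?F = "\<lambda>w. of_bool (clustered V i j l w) :: real"
  let ?C = "\<lambda>w. of_bool (covered R ?S {i, j, l} w) :: real"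
  let ?c = "cov_const T K (card V - 3) 3 * e ^ (card V - 3)"
  have c3: "card {i, j, l} = 3" using d by simp
  have cS: "card ?S = card V - 3" using V c3 by (subst card_Diff_subset) auto
  have "card {i, j, l} \<le> card V" by (rule card_mono) (use V in auto)
  then have k3: "card V \<ge> 3" using c3 by simp
  have c0: "?c \<ge> 0" using cov_const_nonneg[OF T0 K0] e by simp
  have Vi: "V = insert i (insert j (insert l ?S))" using V by auto
  have "asum V ?F w = (\<Sum>a\<in>W. \<bar>wt a\<bar> * (\<Sum>b\<in>W. \<bar>wt b\<bar> * (\<Sum>c\<in>W. \<bar>wt c\<bar> * asum ?S ?F (w(i := a, j := b, l := c)))))"
  proof -
    have "asum (insert i (insert j (insert l ?S))) F w =
      (\<Sum>a\<in>W. \<bar>wt a\<bar> * (\<Sum>b\<in>W. \<bar>wt b\<bar> * (\<Sum>c\<in>W. \<bar>wt c\<bar> * asum ?S F (w(i := a, j := b, l := c)))))" for F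
      using V d by (simp add: wsum_insert)
    from this[of ?F] show ?thesis unfolding Vi[symmetric] .
  qed
  also have "\<dots> \<le> (\<Sum>a\<in>W. \<bar>wt a\<bar> * (\<Sum>b\<in>W. \<bar>wt b\<bar> * (\<Sum>c\<in>W. \<bar>wt c\<bar> *
      (of_bool (R a b) * (of_bool (R c a) + of_bool (R c b)) * ?c))))"
  proof (intro sum_mono mult_left_mono)
    fix a b c assume abc: "a \<in> W" "b \<in> W" "c \<in> W"
    let ?w = "w(i := a, j := b, l := c)"
    let ?P = "\<lambda>w. of_bool (R (w i) (w j)) * (of_bool (R (w l) (w i)) + of_bool (R (w l) (w j))) :: real"
    have "asum ?S ?F ?w \<le> asum ?S (\<lambda>w. ?P w * ?C w) ?w"
      by (rule asum_mono) (auto simp: clustered_def)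
    also have "\<dots> = ?P ?w * asum ?S ?C ?w" by (rule wsum_pull) auto
    also have "\<dots> \<le> ?P ?w * ?c"
    proof (rule mult_left_mono)
      show "asum ?S ?C ?w \<le> ?c"
        by (rule asum_covered_le) (use V abc c3 cS in auto)
    qed simp
    also have "?P ?w = of_bool (R a b) * (of_bool (R c a) + of_bool (R c b))" using d by simp
    finally show "asum ?S ?F ?w \<le> of_bool (R a b) * (of_bool (R c a) + of_bool (R c b)) * ?c" .
  qed auto
  also have "\<dots> = (\<Sum>a\<in>W. \<Sum>b\<in>W. \<bar>wt a\<bar> * \<bar>wt b\<bar> * of_bool (R a b) *
      ((\<Sum>c\<in>W. \<bar>wt c\<bar> * of_bool (R c a)) + (\<Sum>c\<in>W. \<bar>wt c\<bar> * of_bool (R c b)))) * ?c"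
    by (simp add: sum_distrib_right sum_distrib_left sum.distrib algebra_simps del: sum_of_bool_mult_eq sum_mult_of_bool_eq)
  also have "\<dots> \<le> (\<Sum>a\<in>W. \<Sum>b\<in>W. \<bar>wt a\<bar> * \<bar>wt b\<bar> * of_bool (R a b) * (2 * (K * e\<^sup>2))) * ?c"
    unfolding mult_2[of "K * e\<^sup>2"] using c0 by (intro mult_right_mono sum_mono mult_left_mono add_mono K) auto
  also have "\<dots> = (\<Sum>a\<in>W. \<Sum>b\<in>W. \<bar>wt a\<bar> * \<bar>wt b\<bar> * of_bool (R a b)) * (2 * K * e\<^sup>2 * ?c)"
    by (simp only: sum_distrib_right mult.assoc mult_2[symmetric])
  also have "\<dots> \<le> T * K * e\<^sup>2 * (2 * K * e\<^sup>2 * ?c)"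
    using c0 K0 by (intro mult_right_mono sum_edge) auto
  also have "\<dots> = 2 * T * K\<^sup>2 * cov_const T K (card V - 3) 3 * e ^ (card V + 1)"
  proof -
    have "card V + 1 = 2 + 2 + (card V - 3)" using k3 by simp
    then have "e ^ (card V + 1) = e\<^sup>2 * e\<^sup>2 * e ^ (card V - 3)" by (simp only: power_add)
    then show ?thesis by (simp only: power2_eq_square ac_simps)
  qed
  finally show ?thesis .
qed

end


section \<open>Centered products\<close>

text \<open>Permutations do not commute, so the order of the indices fixes the order of composition.
  A new largest index is composed on the right, which matches the right multiplication by a
  conjugate in \<open>char_value_mult_avg\<close>.\<close>

definition ordered_prod :: "(nat \<Rightarrow> 'a \<Rightarrow> 'a) \<Rightarrow> nat set \<Rightarrow> 'a \<Rightarrow> 'a" where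
  "ordered_prod p A = fold (\<lambda>i f. f \<circ> p i) (sorted_list_of_set A) id"

lemma ordered_prod_empty: "ordered_prod p {} = id"
  by (simp add: ordered_prod_def)

lemma ordered_prod_insert:
  assumes "finite A" "\<And>a. a \<in> A \<Longrightarrow> a < m"
  shows "ordered_prod p (insert m A) = ordered_prod p A \<circ> p m"
proof -
  have "m \<notin> A" using assms(2) by blast
  then have "sorted_list_of_set (insert m A) = insort m (sorted_list_of_set A)"
    using assms(1) by simp
  also have "\<dots> = sorted_list_of_set A @ [m]"
    by (rule sorted_insort_is_snoc) (use assms in \<open>auto intro: less_imp_le\<close>)
  finally show ?thesis by (simp add: ordered_prod_def)
qed

lemma ordered_prod_cong:
  assumes "finite A" "\<And>i. i \<in> A \<Longrightarrow> p i = q i"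
  shows "ordered_prod p A = ordered_prod q A"
  unfolding ordered_prod_def by (rule fold_cong) (use assms in auto)

lemma ordered_prod_mem:
  assumes "finite A" "id \<in> S" "\<And>f i. f \<in> S \<Longrightarrow> i \<in> A \<Longrightarrow> f \<circ> p i \<in> S"
  shows "ordered_prod p A \<in> S"
proof -
  have "ordered_prod p B \<in> S" if "finite B" "B \<subseteq> A" for B
    using that
  proof (induction B rule: finite_linorder_max_induct)
    case (insert m B)
    then have "ordered_prod p (insert m B) = ordered_prod p B \<circ> p m"
      by (intro ordered_prod_insert) auto
    moreover have "ordered_prod p B \<circ> p m \<in> S"
      using insert.IH insert.prems by (intro assms(3)) auto
    ultimately show ?case by (simp only:)
  qed (simp add: ordered_prod_empty assms(2))
  then show ?thesis using assms(1) by blast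
qed

lemma permutation_ordered_prod:
  "finite A \<Longrightarrow> (\<And>i. i \<in> A \<Longrightarrow> permutation (p i)) \<Longrightarrow> permutation (ordered_prod p A)"
  using ordered_prod_mem[of A "Collect permutation" p] by (auto intro: permutation_compose)

lemma perm_supp_ordered_prod:
  assumes "finite A" shows "perm_supp (ordered_prod p A) \<subseteq> (\<Union>i\<in>A. perm_supp (p i))"
  using assms
proof (induction A rule: finite_linorder_max_induct)
  case empty
  then show ?case by (simp add: ordered_prod_empty perm_supp_def)
next
  case (insert m A)
  have "ordered_prod p (insert m A) = ordered_prod p A \<circ> p m"
    by (rule ordered_prod_insert) (use insert in auto)
  then have "perm_supp (ordered_prod p (insert m A)) \<subseteq> perm_supp (ordered_prod p A) \<union> perm_supp (p m)"
    using perm_supp_comp[of "ordered_prod p A" "p m"] by (simp only:)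
  then show ?case using insert.IH by blast
qed

text \<open>If the largest index lies in \<open>A2\<close>, its factor already stands at the end; if
  it lies in \<open>A1\<close>, the factor is moved across the product over \<open>A2\<close>, with
  which it commutes.\<close>

lemma ordered_prod_Un:
  assumes "finite A" "A = A1 \<union> A2" "A1 \<inter> A2 = {}" "\<And>i. i \<in> A \<Longrightarrow> permutation (p i)"
    and "\<And>i j. i \<in> A1 \<Longrightarrow> j \<in> A2 \<Longrightarrow> perm_supp (p i) \<inter> perm_supp (p j) = {}"
  shows "ordered_prod p A = ordered_prod p A1 \<circ> ordered_prod p A2"
  using assms
proof (induction A arbitrary: A1 A2 rule: finite_linorder_max_induct)
  case empty
  then show ?case by (simp add: ordered_prod_empty)
next
  case (insert m A)
  have m: "m \<notin> A" using insert.hyps by blast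
  have "finite (A1 \<union> A2)" unfolding insert.prems(1)[symmetric] using insert.hyps(1) by simp
  then have fin: "finite A1" "finite A2" by simp_all
  have lt: "a < m" if "a \<in> A" for a using insert.hyps that by blast
  have A: "ordered_prod p (insert m A) = ordered_prod p A \<circ> p m"
    by (rule ordered_prod_insert[OF insert.hyps(1) lt])
  show ?case
  proof (cases "m \<in> A1")
    case True
    have "m \<notin> A2" using insert.prems(2) True by blast
    have "A = insert m A - {m}" using m by simp
    also have "\<dots> = (A1 - {m}) \<union> A2" unfolding insert.prems(1) using \<open>m \<notin> A2\<close> by blast
    finally have sub: "A = (A1 - {m}) \<union> A2" .
    have IH: "ordered_prod p A = ordered_prod p (A1 - {m}) \<circ> ordered_prod p A2"
      by (rule insert.IH[OF sub]) (use insert.prems in auto)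
    have "insert m (A1 - {m}) = A1" using True by blast
    then have A1: "ordered_prod p A1 = ordered_prod p (A1 - {m}) \<circ> p m"
      using ordered_prod_insert[of "A1 - {m}" m p] fin lt sub by auto
    have "perm_supp (ordered_prod p A2) \<inter> perm_supp (p m) = {}"
      using perm_supp_ordered_prod[OF fin(2), of p] insert.prems(4)[OF True] by blast
    then have "ordered_prod p A2 \<circ> p m = p m \<circ> ordered_prod p A2"
      using insert.prems(1,3) fin by (intro disjoint_supp_commute permutation_ordered_prod) auto
    then show ?thesis unfolding A IH A1 by (simp only: comp_assoc)
  next
    case False
    then have True: "m \<in> A2" using insert.prems(1) by blast
    have "A = insert m A - {m}" using m by simp
    also have "\<dots> = A1 \<union> (A2 - {m})" unfolding insert.prems(1) using False by blast
    finally have sub: "A = A1 \<union> (A2 - {m})" .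
    have IH: "ordered_prod p A = ordered_prod p A1 \<circ> ordered_prod p (A2 - {m})"
      by (rule insert.IH[OF sub]) (use insert.prems in auto)
    have "insert m (A2 - {m}) = A2" using True by blast
    then have A2: "ordered_prod p A2 = ordered_prod p (A2 - {m}) \<circ> p m"
      using ordered_prod_insert[of "A2 - {m}" m p] fin lt sub by auto
    show ?thesis unfolding A IH A2 by (simp only: comp_assoc)
  qed
qed

text \<open>The value of the linear extension of \<open>\<psi>\<close> at the product over \<open>V\<close> of the \<open>p i - x i\<close>.\<close>

definition centered_prod :: "(('a \<Rightarrow> 'a) \<Rightarrow> real) \<Rightarrow> (nat \<Rightarrow> real) \<Rightarrow> (nat \<Rightarrow> 'a \<Rightarrow> 'a) \<Rightarrow> nat set \<Rightarrow> real" where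
  "centered_prod \<psi> x p V = (\<Sum>A\<in>Pow V. (\<Prod>i\<in>V - A. - x i) * \<psi> (ordered_prod p A))"

lemma centered_prod_empty: "centered_prod \<psi> x p {} = \<psi> id"
  by (simp add: centered_prod_def ordered_prod_empty)

text \<open>Subsets with and without \<open>m\<close> are matched, which exposes the last factor
  \<open>p m - x m\<close>.\<close>

lemma centered_prod_insert:
  assumes V: "finite V" "\<And>a. a \<in> V \<Longrightarrow> a < m"
  shows "centered_prod \<psi> x p (insert m V) =
    (\<Sum>A\<in>Pow V. (\<Prod>i\<in>V - A. - x i) * (\<psi> (ordered_prod p A \<circ> p m) - x m * \<psi> (ordered_prod p A)))"
proof -
  let ?t = "\<lambda>A. (\<Prod>i\<in>insert m V - A. - x i) * \<psi> (ordered_prod p A)"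
  have m: "m \<notin> V" using V(2) by blast
  have alg: "- y * P * b + P * c = P * (c - y * b)" for y P b c :: real by (simp add: algebra_simps)
  have inj: "inj_on (insert m) (Pow V)" using m by (auto simp: inj_on_def)
  have "centered_prod \<psi> x p (insert m V) = (\<Sum>A\<in>Pow V. ?t A) + (\<Sum>A\<in>insert m ` Pow V. ?t A)"
    unfolding centered_prod_def Pow_insert using V m by (intro sum.union_disjoint) auto
  also have "(\<Sum>A\<in>insert m ` Pow V. ?t A) = (\<Sum>A\<in>Pow V. ?t (insert m A))"
    by (simp add: sum.reindex[OF inj])
  also have "\<dots> = (\<Sum>A\<in>Pow V. (\<Prod>i\<in>V - A. - x i) * \<psi> (ordered_prod p A \<circ> p m))"
  proof (intro sum.cong refl)
    fix A assume A: "A \<in> Pow V"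
    then have "ordered_prod p (insert m A) = ordered_prod p A \<circ> p m"
      using V finite_subset by (intro ordered_prod_insert) auto
    moreover have "insert m V - insert m A = V - A" using m by auto
    ultimately show "?t (insert m A) = (\<Prod>i\<in>V - A. - x i) * \<psi> (ordered_prod p A \<circ> p m)" by simp
  qed
  also have "(\<Sum>A\<in>Pow V. ?t A) = (\<Sum>A\<in>Pow V. - x m * (\<Prod>i\<in>V - A. - x i) * \<psi> (ordered_prod p A))"
  proof (intro sum.cong refl)
    fix A assume A: "A \<in> Pow V"
    then have "insert m V - A = insert m (V - A)" using m by auto
    then show "?t A = - x m * (\<Prod>i\<in>V - A. - x i) * \<psi> (ordered_prod p A)" using V m by simp
  qed
  also have "(\<Sum>A\<in>Pow V. - x m * (\<Prod>i\<in>V - A. - x i) * \<psi> (ordered_prod p A)) +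
      (\<Sum>A\<in>Pow V. (\<Prod>i\<in>V - A. - x i) * \<psi> (ordered_prod p A \<circ> p m)) =
    (\<Sum>A\<in>Pow V. (\<Prod>i\<in>V - A. - x i) * (\<psi> (ordered_prod p A \<circ> p m) - x m * \<psi> (ordered_prod p A)))"
    unfolding sum.distrib[symmetric]
    by (rule sum.cong[OF refl]) (rule alg)
  finally show ?thesis .
qed

lemma centered_prod_cong:
  assumes "finite V" "\<And>i. i \<in> V \<Longrightarrow> x i = y i" "\<And>i. i \<in> V \<Longrightarrow> p i = q i"
  shows "centered_prod \<psi> x p V = centered_prod \<psi> y q V"
  unfolding centered_prod_def
proof (rule sum.cong[OF refl])
  fix A assume A: "A \<in> Pow V"
  have "ordered_prod p A = ordered_prod q A"
    by (rule ordered_prod_cong) (use A assms finite_subset in auto)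
  moreover have "(\<Prod>i\<in>V - A. - x i) = (\<Prod>i\<in>V - A. - y i)" by (rule prod.cong) (use assms in auto)
  ultimately show "(\<Prod>i\<in>V - A. - x i) * \<psi> (ordered_prod p A) = (\<Prod>i\<in>V - A. - y i) * \<psi> (ordered_prod q A)"
    by simp
qed

text \<open>Hypothesis \<open>Z\<close> says that the weighted sum of the
  \<open>\<pi> a - x a\<close>, multiplied from the right, acts on \<open>\<psi>\<close> as the
  scalar \<open>Z\<close>. Summing over the vertex of largest index therefore extracts one factor
  \<open>Z\<close>, and induction gives the power. The set \<open>S\<close> contains all partial
  products that occur.\<close>

lemma wsum_centered_prod:
  assumes V: "finite V" and W: "finite W"
    and S: "id \<in> S" "\<And>\<rho> a. \<rho> \<in> S \<Longrightarrow> a \<in> W \<Longrightarrow> \<rho> \<circ> \<pi> a \<in> S"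
    and Z: "\<And>\<rho>. \<rho> \<in> S \<Longrightarrow> (\<Sum>a\<in>W. wt a * (\<psi> (\<rho> \<circ> \<pi> a) - x a * \<psi> \<rho>)) = Z * \<psi> \<rho>"
  shows "wsum W wt V (\<lambda>w. centered_prod \<psi> (\<lambda>i. x (w i)) (\<lambda>i. \<pi> (w i)) V) w0 = Z ^ card V * \<psi> id"
  using V
proof (induction V rule: finite_linorder_max_induct)
  case empty
  show ?case by (simp only: wsum_empty centered_prod_empty card.empty power_0 mult_1_left)
next
  case (insert m V)
  have m: "m \<notin> V" using insert.hyps by blast
  have lt: "a < m" if "a \<in> V" for a using insert.hyps that by blast
  let ?c = "\<lambda>w A. \<Prod>i\<in>V - A. - x (w i)"
  let ?o = "\<lambda>w A. ordered_prod (\<lambda>i. \<pi> (w i)) A"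
  let ?H = "\<lambda>a w. \<Sum>A\<in>Pow V. ?c w A * (\<psi> (?o w A \<circ> \<pi> a) - x a * \<psi> (?o w A))"
  let ?M = "\<lambda>w. centered_prod \<psi> (\<lambda>i. x (w i)) (\<lambda>i. \<pi> (w i))"
  have H: "wsum W wt V (\<lambda>w. ?M w (insert m V)) (w0(m := a)) = wsum W wt V (?H a) w0" for a
  proof -
    have "wsum W wt V (\<lambda>w. ?M w (insert m V)) (w0(m := a)) = wsum W wt V (?H a) (w0(m := a))"
    proof (rule wsum_cong)
      fix w' assume "\<And>i. i \<notin> V \<Longrightarrow> w' i = (w0(m := a)) i"
      from this[OF m] have "w' m = a" by simp
      then show "?M w' (insert m V) = ?H a w'" by (simp add: centered_prod_insert[OF insert.hyps(1) lt])
    qed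
    also have "\<dots> = wsum W wt V (?H a) w0"
    proof (rule wsum_base)
      fix w' w'' :: "nat \<Rightarrow> 'a" assume e: "\<And>i. i \<in> V \<Longrightarrow> w' i = w'' i"
      show "?H a w' = ?H a w''"
      proof (rule sum.cong[OF refl])
        fix A assume A: "A \<in> Pow V"
        have "?o w' A = ?o w'' A"
          by (rule ordered_prod_cong) (use A insert.hyps(1) finite_subset e in auto)
        moreover have "?c w' A = ?c w'' A" by (rule prod.cong) (use e in auto)
        ultimately show "?c w' A * (\<psi> (?o w' A \<circ> \<pi> a) - x a * \<psi> (?o w' A)) =
          ?c w'' A * (\<psi> (?o w'' A \<circ> \<pi> a) - x a * \<psi> (?o w'' A))" by simp
      qed
    qed
    finally show ?thesis .
  qed
  have "wsum W wt (insert m V) (\<lambda>w. ?M w (insert m V)) w0 = (\<Sum>a\<in>W. wt a * wsum W wt V (?H a) w0)"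
    unfolding wsum_insert[OF insert.hyps(1) m] H ..
  also have "\<dots> = wsum W wt V (\<lambda>w. \<Sum>a\<in>W. wt a * ?H a w) w0"
    by (simp only: wsum_sum wsum_mult_const)
  also have "\<dots> = wsum W wt V (\<lambda>w. Z * ?M w V) w0"
  proof (rule wsum_cong)
    fix w' assume w': "\<And>i. i \<in> V \<Longrightarrow> w' i \<in> W"
    have "(\<Sum>a\<in>W. wt a * ?H a w') = (\<Sum>a\<in>W. \<Sum>A\<in>Pow V. ?c w' A * (wt a * (\<psi> (?o w' A \<circ> \<pi> a) - x a * \<psi> (?o w' A))))"
      unfolding sum_distrib_left by (intro sum.cong refl) (simp only: mult.left_commute)
    also have "\<dots> = (\<Sum>A\<in>Pow V. ?c w' A * (\<Sum>a\<in>W. wt a * (\<psi> (?o w' A \<circ> \<pi> a) - x a * \<psi> (?o w' A))))"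
      by (subst sum.swap) (simp only: sum_distrib_left)
    also have "\<dots> = (\<Sum>A\<in>Pow V. ?c w' A * (Z * \<psi> (?o w' A)))"
    proof (rule sum.cong[OF refl])
      fix A assume A: "A \<in> Pow V"
      have "?o w' A \<in> S"
      proof (rule ordered_prod_mem)
        show "finite A" using A insert.hyps(1) finite_subset by auto
        show "f \<circ> \<pi> (w' i) \<in> S" if "f \<in> S" "i \<in> A" for f i using that S(2) w' A by blast
      qed (rule S(1))
      then show "?c w' A * (\<Sum>a\<in>W. wt a * (\<psi> (?o w' A \<circ> \<pi> a) - x a * \<psi> (?o w' A))) = ?c w' A * (Z * \<psi> (?o w' A))"
        by (simp only: Z)
    qed
    also have "\<dots> = Z * ?M w' V" by (simp add: centered_prod_def sum_distrib_left mult_ac)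
    finally show "(\<Sum>a\<in>W. wt a * ?H a w') = Z * ?M w' V" .
  qed
  also have "\<dots> = Z ^ card (insert m V) * \<psi> id"
    unfolding wsum_mult_const insert.IH using m insert.hyps(1) by simp
  finally show ?case .
qed

lemma centered_prod_sum:
  assumes "\<And>A. A \<subseteq> V \<Longrightarrow> \<psi> (ordered_prod p A) = (\<Sum>l\<in>L. c l * \<phi> l (ordered_prod p A))"
  shows "centered_prod \<psi> x p V = (\<Sum>l\<in>L. c l * centered_prod (\<phi> l) x p V)"
proof -
  have "centered_prod \<psi> x p V = (\<Sum>A\<in>Pow V. \<Sum>l\<in>L. c l * ((\<Prod>i\<in>V - A. - x i) * \<phi> l (ordered_prod p A)))"
    unfolding centered_prod_def using assms by (intro sum.cong refl) (simp add: sum_distrib_left mult_ac)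
  then show ?thesis
    unfolding centered_prod_def by (subst (asm) sum.swap) (simp add: sum_distrib_left)
qed

text \<open>A subset of \<open>V1 \<union> V2\<close> is a pair of subsets, and the products over
  the two have disjoint supports; hence each term of the expansion factors.\<close>

lemma centered_prod_Un:
  assumes V: "finite V1" "finite V2" "V1 \<inter> V2 = {}"
    and p: "\<And>i. i \<in> V1 \<union> V2 \<Longrightarrow> permutation (p i)"
    and d: "\<And>i j. i \<in> V1 \<Longrightarrow> j \<in> V2 \<Longrightarrow> perm_supp (p i) \<inter> perm_supp (p j) = {}"
  shows "centered_prod (thoma_character \<omega>) x p (V1 \<union> V2) =
    centered_prod (thoma_character \<omega>) x p V1 * centered_prod (thoma_character \<omega>) x p V2"
proof -
  let ?\<chi> = "thoma_character \<omega>"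
  let ?t = "\<lambda>V A. (\<Prod>i\<in>V - A. - x i) * ?\<chi> (ordered_prod p A)"
  have e: "?t (V1 \<union> V2) (A1 \<union> A2) = ?t V1 A1 * ?t V2 A2" if A: "A1 \<subseteq> V1" "A2 \<subseteq> V2" for A1 A2
  proof -
    have fin: "finite A1" "finite A2" using A V finite_subset by blast+
    have "ordered_prod p (A1 \<union> A2) = ordered_prod p A1 \<circ> ordered_prod p A2"
      by (rule ordered_prod_Un) (use fin A V p d in \<open>blast intro: finite_UnI\<close>)+
    moreover have "perm_supp (ordered_prod p A1) \<inter> perm_supp (ordered_prod p A2) = {}"
    proof -
      have "(\<Union>i\<in>A1. perm_supp (p i)) \<inter> (\<Union>i\<in>A2. perm_supp (p i)) = {}" using A d by blast
      then show ?thesis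
        using perm_supp_ordered_prod[OF fin(1), of p] perm_supp_ordered_prod[OF fin(2), of p] by blast
    qed
    moreover have "permutation (ordered_prod p A1)" "permutation (ordered_prod p A2)"
      using fin A p by (intro permutation_ordered_prod; blast)+
    ultimately have "?\<chi> (ordered_prod p (A1 \<union> A2)) = ?\<chi> (ordered_prod p A1) * ?\<chi> (ordered_prod p A2)"
      by (simp add: thoma_character_disjoint)
    moreover have "V1 \<union> V2 - (A1 \<union> A2) = (V1 - A1) \<union> (V2 - A2)" using A V by blast
    moreover have "(\<Prod>i\<in>(V1 - A1) \<union> (V2 - A2). - x i) = (\<Prod>i\<in>V1 - A1. - x i) * (\<Prod>i\<in>V2 - A2. - x i)"
      using V by (intro prod.union_disjoint) auto
    ultimately show ?thesis by simp
  qed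
  have "centered_prod ?\<chi> x p (V1 \<union> V2) = (\<Sum>(A1, A2)\<in>Pow V1 \<times> Pow V2. ?t (V1 \<union> V2) (A1 \<union> A2))"
    unfolding centered_prod_def
    by (rule sum.reindex_bij_witness[of _ "\<lambda>(A1, A2). A1 \<union> A2" "\<lambda>A. (A \<inter> V1, A \<inter> V2)"])
       (use V in \<open>auto simp: Int_Un_distrib[symmetric] Int_absorb2\<close>)
  also have "\<dots> = (\<Sum>(A1, A2)\<in>Pow V1 \<times> Pow V2. ?t V1 A1 * ?t V2 A2)"
    by (rule sum.cong[OF refl]) (clarsimp simp only: mem_Sigma_iff Pow_iff e split: prod.splits)
  also have "\<dots> = centered_prod ?\<chi> x p V1 * centered_prod ?\<chi> x p V2"
    unfolding centered_prod_def sum_product sum.cartesian_product ..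
  finally show ?thesis .
qed

lemma centered_prod_single:
  "centered_prod (thoma_character \<omega>) (\<lambda>i. thoma_character \<omega> (p i)) p {i} = 0"
  using centered_prod_insert[of "{}" i "thoma_character \<omega>" "\<lambda>i. thoma_character \<omega> (p i)" p]
  by (simp add: ordered_prod_empty thoma_character_id)

text \<open>One term of absolute value at most 1 for every subset of \<open>V\<close>.\<close>

lemma abs_centered_prod_le:
  assumes "\<omega> \<in> thoma_simplex" "finite V" "\<And>i. i \<in> V \<Longrightarrow> permutation (p i)"
  shows "\<bar>centered_prod (thoma_character \<omega>) (\<lambda>i. thoma_character \<omega> (p i)) p V\<bar> \<le> 2 ^ card V"
proof -
  let ?\<chi> = "thoma_character \<omega>"
  have "\<bar>centered_prod ?\<chi> (\<lambda>i. ?\<chi> (p i)) p V\<bar> \<le> (\<Sum>A\<in>Pow V. \<bar>(\<Prod>i\<in>V - A. - ?\<chi> (p i)) * ?\<chi> (ordered_prod p A)\<bar>)"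
    unfolding centered_prod_def by (rule sum_abs)
  also have "\<dots> \<le> (\<Sum>A\<in>Pow V. 1)"
  proof (rule sum_mono)
    fix A assume A: "A \<in> Pow V"
    have "\<bar>\<Prod>i\<in>V - A. - ?\<chi> (p i)\<bar> \<le> 1"
      unfolding abs_prod by (rule prod_le_1) (auto intro!: abs_thoma_character_le_1 assms)
    moreover have "\<bar>?\<chi> (ordered_prod p A)\<bar> \<le> 1"
      by (intro abs_thoma_character_le_1 permutation_ordered_prod assms) (use A assms finite_subset in auto)
    ultimately show "\<bar>(\<Prod>i\<in>V - A. - ?\<chi> (p i)) * ?\<chi> (ordered_prod p A)\<bar> \<le> 1"
      unfolding abs_mult using mult_mono[of _ 1 _ 1] by fastforce
  qed
  also have "\<dots> = 2 ^ card V" using assms(2) by (simp add: card_Pow)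
  finally show ?thesis .
qed


section \<open>The asymptotic Wick recursion\<close>

locale permutation_model =
  weighted_graph W wt "\<lambda>a b. perm_supp (\<pi> a) \<inter> perm_supp (\<pi> b) \<noteq> {}" T K e
  for W :: "'w set" and wt :: "'w \<Rightarrow> real" and \<pi> :: "'w \<Rightarrow> nat \<Rightarrow> nat" and T K e :: real +
  fixes \<omega> :: "(nat \<Rightarrow> real) \<times> (nat \<Rightarrow> real)"
  assumes \<omega>: "\<omega> \<in> thoma_simplex" and perm: "\<And>a. a \<in> W \<Longrightarrow> permutation (\<pi> a)"
begin

definition M :: "nat set \<Rightarrow> (nat \<Rightarrow> 'w) \<Rightarrow> real" where
  "M V w = centered_prod (thoma_character \<omega>) (\<lambda>i. thoma_character \<omega> (\<pi> (w i))) (\<lambda>i. \<pi> (w i)) V"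

abbreviation adj :: "'w \<Rightarrow> 'w \<Rightarrow> bool" where
  "adj \<equiv> \<lambda>a b. perm_supp (\<pi> a) \<inter> perm_supp (\<pi> b) \<noteq> {}"

lemma M_Un:
  assumes "finite V1" "finite V2" "V1 \<inter> V2 = {}" "\<And>i. i \<in> V1 \<union> V2 \<Longrightarrow> w i \<in> W"
    and "\<And>i j. i \<in> V1 \<Longrightarrow> j \<in> V2 \<Longrightarrow> \<not> adj (w i) (w j)"
  shows "M (V1 \<union> V2) w = M V1 w * M V2 w"
  unfolding M_def by (rule centered_prod_Un) (use assms perm in auto)

text \<open>The isolated vertex splits off by \<open>M_Un\<close> as a centered product over a
  single vertex, which is zero.\<close>

lemma M_isolated:
  assumes "finite V" "i \<in> V" "\<And>j. j \<in> V \<Longrightarrow> w j \<in> W" "\<And>j. j \<in> V \<Longrightarrow> j \<noteq> i \<Longrightarrow> \<not> adj (w i) (w j)"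
  shows "M V w = 0"
proof -
  have "M ({i} \<union> (V - {i})) w = M {i} w * M (V - {i}) w"
    by (rule M_Un) (use assms in auto)
  moreover have "{i} \<union> (V - {i}) = V" using assms(2) by blast
  moreover have "M {i} w = 0" unfolding M_def by (rule centered_prod_single)
  ultimately show ?thesis by simp
qed

lemma abs_M_le:
  assumes "finite V" "\<And>j. j \<in> V \<Longrightarrow> w j \<in> W" shows "\<bar>M V w\<bar> \<le> 2 ^ card V"
  unfolding M_def by (rule abs_centered_prod_le[OF \<omega>]) (use assms perm in auto)

lemma M_cong: "finite V \<Longrightarrow> (\<And>i. i \<in> V \<Longrightarrow> w i = w' i) \<Longrightarrow> M V w = M V w'"
  unfolding M_def by (rule centered_prod_cong) auto

text \<open>Both sides vanish if the intersection graph has an isolated vertex, and they agree if the component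
  of \<open>i\<close> has two elements.\<close>

lemma M_pairing:
  assumes V: "finite V" "i \<in> V" and w: "\<And>j. j \<in> V \<Longrightarrow> w j \<in> W"
  shows "\<bar>M V w - (\<Sum>j\<in>V - {i}. M {i, j} w * M (V - {i, j}) w)\<bar> \<le>
    (2 ^ card V + real (card V) * (4 * 2 ^ card V)) *
      (\<Sum>j\<in>V - {i}. \<Sum>l\<in>V - {i, j}. of_bool (clustered V i j l w))" (is "\<bar>?L\<bar> \<le> ?C * ?R")
proof -
  have not_isolated: "\<not> (\<exists>m\<in>V. \<forall>j\<in>V. j \<noteq> m \<longrightarrow> \<not> A m j) \<Longrightarrow> m \<in> V \<Longrightarrow> \<exists>j\<in>V. j \<noteq> m \<and> A m j"
    for A m by blast
  have not_bexD: "\<not> (\<exists>l\<in>S. A l) \<Longrightarrow> l \<in> S \<Longrightarrow> \<not> A l" for A l and S :: "nat set" by blast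
  have R0: "?R \<ge> 0" by (intro sum_nonneg) simp
  have C0: "?C \<ge> 0" by simp
  show ?thesis
  proof (cases "\<exists>m\<in>V. \<forall>j\<in>V. j \<noteq> m \<longrightarrow> \<not> adj (w m) (w j)")
    case True
    then obtain m where m: "m \<in> V" "\<And>j. j \<in> V \<Longrightarrow> j \<noteq> m \<Longrightarrow> \<not> adj (w m) (w j)" by blast
    have "M V w = 0" by (rule M_isolated[OF V(1) m(1)]) (use w m(2) in blast)+
    \<comment> \<open>\<open>m\<close> stays isolated in whichever of the two sets contains
      it.\<close>
    moreover have "M {i, j} w * M (V - {i, j}) w = 0" if j: "j \<in> V - {i}" for j
    proof (cases "m \<in> {i, j}")
      case True
      have "M {i, j} w = 0"
        by (rule M_isolated[of _ m]) (use True V w j m in auto)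
      then show ?thesis by simp
    next
      case False
      have "M (V - {i, j}) w = 0"
        by (rule M_isolated[of _ m]) (use False V w j m in auto)
      then show ?thesis by simp
    qed
    then have "(\<Sum>j\<in>V - {i}. M {i, j} w * M (V - {i, j}) w) = 0" by (rule sum.neutral[OF ballI])
    ultimately have "?L = 0" by simp
    then show ?thesis using R0 C0 by simp
  next
    case False
    note neighbour = not_isolated[OF False]
    from neighbour[OF V(2)] obtain j where j: "j \<in> V" "j \<noteq> i" "adj (w i) (w j)" by (elim bexE conjE)
    have ij: "j \<in> V - {i}" using j by blast
    show ?thesis
    proof (cases "\<exists>l\<in>V - {i, j}. adj (w l) (w i) \<or> adj (w l) (w j)")
      case True
      \<comment> \<open>Here no cancellation is used: the indicator sum is at least 1, and the left
        side is bounded crudely by \<open>?C\<close>.\<close>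
      then obtain l where l: "l \<in> V - {i, j}" "adj (w l) (w i) \<or> adj (w l) (w j)" by (rule bexE)
      have "covered adj (V - {i, j, l}) {i, j, l} w"
        unfolding covered_def
      proof
        fix m assume m: "m \<in> V - {i, j, l}"
        then have "m \<in> V" by simp
        from neighbour[OF this] obtain k where k: "k \<in> V" "k \<noteq> m" "adj (w m) (w k)" by (elim bexE conjE)
        then have "k \<in> V - {i, j, l} \<union> {i, j, l}" by blast
        then show "\<exists>k\<in>V - {i, j, l} \<union> {i, j, l}. k \<noteq> m \<and> adj (w m) (w k)" using k by (intro bexI[of _ k] conjI)
      qed
      then have cl: "clustered V i j l w" using j l by (simp add: clustered_def)
      have "1 \<le> (\<Sum>l\<in>V - {i, j}. of_bool (clustered V i j l w) :: real)"
        using member_le_sum[of l "V - {i, j}" "\<lambda>l. of_bool (clustered V i j l w) :: real"] l V cl by simp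
      also have "\<dots> \<le> ?R"
        using member_le_sum[of j "V - {i}" "\<lambda>j. \<Sum>l\<in>V - {i, j}. of_bool (clustered V i j l w) :: real"] ij V
        by (simp add: sum_nonneg)
      finally have R1: "1 \<le> ?R" .
      have b: "\<bar>M {i, k} w * M (V - {i, k}) w\<bar> \<le> 4 * 2 ^ card V" if k: "k \<in> V - {i}" for k
      proof -
        have "card {i, k} = 2" using k by auto
        moreover have "\<bar>M {i, k} w\<bar> \<le> 2 ^ card {i, k}" by (rule abs_M_le) (use k V w in auto)
        ultimately have 1: "\<bar>M {i, k} w\<bar> \<le> 4" by simp
        have "\<bar>M (V - {i, k}) w\<bar> \<le> 2 ^ card (V - {i, k})" by (rule abs_M_le) (use V w in auto)
        also have "(2::real) ^ card (V - {i, k}) \<le> 2 ^ card V"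
          by (rule power_increasing) (use V in \<open>auto intro: card_mono\<close>)
        finally show ?thesis unfolding abs_mult by (intro mult_mono 1) auto
      qed
      have "\<bar>?L\<bar> \<le> \<bar>M V w\<bar> + \<bar>\<Sum>j\<in>V - {i}. M {i, j} w * M (V - {i, j}) w\<bar>" by (rule abs_triangle_ineq4)
      also have "\<dots> \<le> 2 ^ card V + (\<Sum>j\<in>V - {i}. 4 * 2 ^ card V)"
        by (intro add_mono abs_M_le V w order_trans[OF sum_abs] sum_mono b)
      also have "\<dots> \<le> 2 ^ card V + real (card V) * (4 * 2 ^ card V)"
        using card_mono[OF V(1), of "V - {i}"] by (auto intro!: mult_right_mono)
      also have "\<dots> = ?C * 1" by simp
      also have "\<dots> \<le> ?C * ?R" by (rule mult_left_mono[OF R1 C0])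
      finally show ?thesis .
    next
      case False
      then have iso: "\<not> adj (w i) (w l)" "\<not> adj (w j) (w l)" if "l \<in> V - {i, j}" for l
      proof -
        have "\<not> (adj (w l) (w i) \<or> adj (w l) (w j))" using False that by (rule not_bexD)
        then show "\<not> adj (w i) (w l)" "\<not> adj (w j) (w l)" by (simp_all add: Int_commute)
      qed
      \<comment> \<open>\<open>{i, j}\<close> is a component, so the product for \<open>j\<close>
        equals \<open>M V w\<close>; for any other \<open>k\<close> the factor
        \<open>M {i, k} w\<close> vanishes, since \<open>i\<close> meets only
        \<open>j\<close>.\<close>
      have "M ({i, j} \<union> (V - {i, j})) w = M {i, j} w * M (V - {i, j}) w"
        by (rule M_Un) (use V j w iso in auto)
      moreover have "{i, j} \<union> (V - {i, j}) = V" using V j by blast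
      moreover have "M {i, k} w * M (V - {i, k}) w = 0" if k: "k \<in> V - {i} - {j}" for k
      proof -
        have "M {i, k} w = 0"
          by (rule M_isolated[of _ i]) (use V w k iso(1)[of k] in auto)
        then show ?thesis by simp
      qed
      then have "(\<Sum>k\<in>V - {i} - {j}. M {i, k} w * M (V - {i, k}) w) = 0" by (rule sum.neutral[OF ballI])
      then have "(\<Sum>k\<in>V - {i}. M {i, k} w * M (V - {i, k}) w) = M {i, j} w * M (V - {i, j}) w"
        using sum.remove[of "V - {i}" j "\<lambda>k. M {i, k} w * M (V - {i, k}) w"] V ij by simp
      ultimately have "?L = 0" by simp
      then show ?thesis using R0 C0 by simp
    qed
  qed
qed

text \<open>The pointwise constant of \<open>M_pairing\<close>, times the bound \<open>k * k\<close>
  for the number of pairs \<open>(j, l)\<close>, times the constant of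
  \<open>asum_clustered_le\<close>.\<close>

definition rec_const :: "nat \<Rightarrow> real" where
  "rec_const k = (2 ^ k + real k * (4 * 2 ^ k)) * (real k * (real k * (2 * T * K\<^sup>2 * cov_const T K (k - 3) 3)))"

text \<open>Vertex 0 may be matched with any of the \<open>k + 1\<close> others, and by independence
  each matching contributes \<open>m 2 * m k\<close>. What remains is dominated by clustered
  configurations, which explains the exponent \<open>card V + 1 = k + 3\<close>.\<close>

lemma moment_recursion:
  assumes m: "\<And>V. finite V \<Longrightarrow> wsum W wt V (M V) w0 = m (card V)"
  shows "\<bar>m (k + 2) - real (k + 1) * m 2 * m k\<bar> \<le> rec_const (k + 2) * e ^ (k + 3)"
proof -
  define V where "V = {..<k + 2}"
  have V: "finite V" "0 \<in> V" "card V = k + 2" by (simp_all add: V_def)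
  let ?D = "\<lambda>w. M V w - (\<Sum>j\<in>V - {0}. M {0, j} w * M (V - {0, j}) w)"
  let ?C = "2 ^ card V + real (card V) * (4 * 2 ^ card V) :: real"
  let ?B = "2 * T * K\<^sup>2 * cov_const T K (card V - 3) 3 * e ^ (card V + 1)"
  have B0: "?B \<ge> 0" using T0 cov_const_nonneg[OF T0 K0] e by simp
  have const: "(\<Sum>x\<in>S. c) \<le> real (card V) * c" if "S \<subseteq> V" "c \<ge> 0" for S and c :: real
    using that V(1) by (simp add: card_mono mult_right_mono)
  have pair: "wsum W wt V (\<lambda>w. M {0, j} w * M (V - {0, j}) w) w0 = m 2 * m k" if j: "j \<in> V - {0}" for j
  proof -
    have "wsum W wt ({0, j} \<union> (V - {0, j})) (\<lambda>w. M {0, j} w * M (V - {0, j}) w) w0 =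
      wsum W wt {0, j} (M {0, j}) w0 * wsum W wt (V - {0, j}) (M (V - {0, j})) w0"
    proof (rule wsum_mult)
      show "M {0, j} w' = M {0, j} w''" if "\<And>i. i \<in> {0, j} \<Longrightarrow> w' i = w'' i" for w' w''
        by (rule M_cong) (use that in auto)
      show "M (V - {0, j}) w' = M (V - {0, j}) w''" if "\<And>i. i \<in> V - {0, j} \<Longrightarrow> w' i = w'' i" for w' w''
        by (rule M_cong) (use that V in auto)
    qed (use V in auto)
    moreover have "{0, j} \<union> (V - {0, j}) = V" using V j by blast
    moreover have "card {0, j} = 2" using j by auto
    moreover have "card (V - {0, j}) = k" using j V by (subst card_Diff_subset) auto
    ultimately show ?thesis using m[of "{0, j}"] m[of "V - {0, j}"] V by simp
  qed
  have "wsum W wt V ?D w0 = m (k + 2) - (\<Sum>j\<in>V - {0}. m 2 * m k)"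
    unfolding wsum_diff wsum_sum using m[OF V(1)] V(3) by (simp only: sum.cong[OF refl pair])
  also have "(\<Sum>j\<in>V - {0}. m 2 * m k) = real (k + 1) * m 2 * m k"
    using V by simp
  finally have "\<bar>m (k + 2) - real (k + 1) * m 2 * m k\<bar> = \<bar>wsum W wt V ?D w0\<bar>" by simp
  also have "\<dots> \<le> asum V (\<lambda>w. \<bar>?D w\<bar>) w0" by (rule abs_wsum_le)
  also have "\<dots> \<le> asum V (\<lambda>w. ?C * (\<Sum>j\<in>V - {0}. \<Sum>l\<in>V - {0, j}. of_bool (clustered V 0 j l w))) w0"
    by (rule asum_mono) (rule M_pairing[OF V(1,2)])
  also have "\<dots> = ?C * (\<Sum>j\<in>V - {0}. \<Sum>l\<in>V - {0, j}. asum V (\<lambda>w. of_bool (clustered V 0 j l w)) w0)"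
    by (simp only: wsum_mult_const wsum_sum)
  also have "\<dots> \<le> ?C * (\<Sum>j\<in>V - {0}. \<Sum>l\<in>V - {0, j}. ?B)"
    by (intro mult_left_mono sum_mono asum_clustered_le V) auto
  also have "\<dots> \<le> ?C * (\<Sum>j\<in>V - {0}. real (card V) * ?B)"
    by (intro mult_left_mono sum_mono const B0) auto
  also have "\<dots> \<le> ?C * (real (card V) * (real (card V) * ?B))"
    by (intro mult_left_mono const mult_nonneg_nonneg[OF _ B0]) auto
  also have "\<dots> = rec_const (k + 2) * e ^ (k + 3)"
    by (simp add: rec_const_def V(3) mult.assoc numeral_eq_Suc)
  finally show ?thesis .
qed

end


section \<open>Gaussian vectors\<close>

lemma char_scaled_std_normal:
  "char (distr std_normal_distribution borel (\<lambda>z. s * z)) t = complex_of_real (exp (- (s * t)\<^sup>2 / 2))"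
proof -
  have "char (distr std_normal_distribution borel (\<lambda>z. s * z)) t = (CLINT z|std_normal_distribution. iexp (t * (s * z)))"
    unfolding char_def by (subst integral_distr) auto
  also have "\<dots> = char std_normal_distribution (s * t)"
    unfolding char_def by (simp add: ac_simps)
  finally show ?thesis by (simp add: char_std_normal_distribution)
qed

lemma real_distribution_scaled_std_normal:
  "real_distribution (distr std_normal_distribution borel (\<lambda>z. s * z))"
proof -
  interpret real_distribution std_normal_distribution by (rule real_dist_normal_dist)
  show ?thesis by (rule real_distribution_distr) simp
qed

lemma centered_gaussian_scaled_std_normal:
  assumes "s \<ge> 0"
  shows "centered_gaussian (distr std_normal_distribution borel (\<lambda>z. s * z))"
proof (cases "s = 0")
  case True
  interpret real_distribution std_normal_distribution by (rule real_dist_normal_dist)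
  have "distr std_normal_distribution borel (\<lambda>z. s * z) = return borel 0"
    using True by (simp add: distr_const)
  then show ?thesis by (simp add: centered_gaussian_def)
next
  case False
  then have s: "s > 0" using assms by simp
  interpret real_distribution std_normal_distribution by (rule real_dist_normal_dist)
  have "distributed std_normal_distribution lborel (\<lambda>x. x) (normal_density 0 1)"
    by (auto simp: distributed_def distr_id2)
  from normal_density_affine[OF this, of s 0]
  have "distributed std_normal_distribution lborel (\<lambda>x. s * x) (normal_density 0 s)"
    using s by simp
  then have "distr std_normal_distribution lborel (\<lambda>x. s * x) = density lborel (normal_density 0 s)"
    by (simp add: distributed_def)
  moreover have "distr std_normal_distribution lborel (\<lambda>x. s * x) = distr std_normal_distribution borel (\<lambda>x. s * x)"
    by (rule distr_cong) auto
  ultimately show ?thesis using s by (auto simp: centered_gaussian_def)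
qed

text \<open>The law of the sum of the vectors in \<open>as\<close>, multiplied by independent
  standard normal variables; each list element adds one factor to a product measure.\<close>

lemma ex_gaussian_vector_sum_squares:
  fixes as :: "'a::euclidean_space list"
  shows "\<exists>N. prob_space N \<and> sets N = sets borel \<and>
    (\<forall>u. (CLINT x|N. iexp (u \<bullet> x)) = complex_of_real (exp (- (\<Sum>a\<leftarrow>as. (a \<bullet> u)\<^sup>2) / 2)))"
proof (induction as)
  case Nil
  have "(CLINT x|return borel (0::'a). iexp (u \<bullet> x)) = 1" for u :: 'a
    by (subst integral_return) auto
  then show ?case by (intro exI[of _ "return borel 0"]) (auto intro: prob_space_return)
next
  case (Cons a as)
  then obtain N where N: "prob_space N" and sN[measurable_cong]: "sets N = sets borel"
    and char_N: "\<And>u. (CLINT x|N. iexp (u \<bullet> x)) = complex_of_real (exp (- (\<Sum>a\<leftarrow>as. (a \<bullet> u)\<^sup>2) / 2))"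
    by blast
  let ?S = std_normal_distribution
  interpret S: real_distribution ?S by (rule real_dist_normal_dist)
  interpret N: prob_space N by fact
  interpret pair_prob_space N ?S ..
  define N' where "N' = distr (N \<Otimes>\<^sub>M ?S) borel (\<lambda>p. fst p + snd p *\<^sub>R a)"
  have m[measurable]: "(\<lambda>p. fst p + snd p *\<^sub>R a) \<in> borel_measurable (N \<Otimes>\<^sub>M ?S)" by measurable
  have "prob_space N'" unfolding N'_def by (rule P.prob_space_distr) (rule m)
  moreover have "(CLINT x|N'. iexp (u \<bullet> x)) = complex_of_real (exp (- (\<Sum>a\<leftarrow>a # as. (a \<bullet> u)\<^sup>2) / 2))" for u
  proof -
    have "(CLINT x|N'. iexp (u \<bullet> x)) = (CLINT p|N \<Otimes>\<^sub>M ?S. iexp (u \<bullet> (fst p + snd p *\<^sub>R a)))"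
      unfolding N'_def by (subst integral_distr) auto
    also have "\<dots> = (CLINT x|N. (CLINT z|?S. iexp (u \<bullet> (x + z *\<^sub>R a))))"
      by (subst integral_fst'[symmetric]) (auto intro!: P.integrable_const_bound[of _ 1])
    also have "\<dots> = (CLINT x|N. iexp (u \<bullet> x) * char ?S (u \<bullet> a))"
    proof (intro Bochner_Integration.integral_cong refl)
      fix x
      have "(CLINT z|?S. iexp (u \<bullet> (x + z *\<^sub>R a))) = (CLINT z|?S. iexp (u \<bullet> x) * iexp ((u \<bullet> a) * z))"
        by (intro Bochner_Integration.integral_cong refl) (simp add: inner_right_distrib exp_add ring_distribs mult_ac)
      then show "(CLINT z|?S. iexp (u \<bullet> (x + z *\<^sub>R a))) = iexp (u \<bullet> x) * char ?S (u \<bullet> a)"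
        unfolding char_def by simp
    qed
    also have "\<dots> = (CLINT x|N. iexp (u \<bullet> x)) * char ?S (u \<bullet> a)"
      by (rule integral_mult_left_zero)
    also have "\<dots> = complex_of_real (exp (- (\<Sum>a\<leftarrow>as. (a \<bullet> u)\<^sup>2) / 2) * exp (- (u \<bullet> a)\<^sup>2 / 2))"
      by (simp only: char_N char_std_normal_distribution of_real_mult)
    also have "exp (- (\<Sum>a\<leftarrow>as. (a \<bullet> u)\<^sup>2) / 2) * exp (- (u \<bullet> a)\<^sup>2 / 2) = exp (- (\<Sum>a\<leftarrow>a # as. (a \<bullet> u)\<^sup>2) / 2)"
      by (simp add: exp_add[symmetric] inner_commute field_simps)
    finally show ?thesis .
  qed
  moreover have "sets N' = sets borel" by (simp add: N'_def)
  ultimately show ?case by blast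
qed

text \<open>Otherwise the form is a nonconstant affine function of \<open>t\<close> along
  \<open>u - t *\<^sub>R b\<close> and takes negative values.\<close>

lemma psd_zero_diag:
  fixes B :: "'a::real_vector \<Rightarrow> 'a \<Rightarrow> real"
  assumes B: "bilinear B" "\<And>u w. B u w = B w u" "\<And>u. B u u \<ge> 0" and b: "B b b = 0"
  shows "B u b = 0"
proof (rule ccontr)
  assume n: "B u b \<noteq> 0"
  \<comment> \<open>Chosen so that the form takes the value -1.\<close>
  define t where "t = (B u u + 1) / (2 * B u b)"
  have "B (u - t *\<^sub>R b) (u - t *\<^sub>R b) = B u u - 2 * t * B u b + t * t * B b b"
    using B(2)[of b u] by (simp add: bilinear_lsub[OF B(1)] bilinear_rsub[OF B(1)] bilinear_lmul[OF B(1)]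
      bilinear_rmul[OF B(1)] algebra_simps)
  also have "\<dots> = -1" using n b by (simp add: t_def field_simps)
  finally show False using B(3)[of "u - t *\<^sub>R b"] by simp
qed

text \<open>Schur complements: subtract a square to kill one diagonal entry at a time.\<close>

lemma psd_sum_squares:
  fixes B :: "'a::euclidean_space \<Rightarrow> 'a \<Rightarrow> real"
  assumes "S \<subseteq> Basis" "bilinear B" "\<And>u w. B u w = B w u" "\<And>u. B u u \<ge> 0" "\<And>b. b \<in> Basis - S \<Longrightarrow> B b b = 0"
  shows "\<exists>as::'a list. \<forall>u. B u u = (\<Sum>a\<leftarrow>as. (a \<bullet> u)\<^sup>2)"
proof -
  have "finite S" using assms(1) finite_Basis finite_subset by blast
  then show ?thesis using assms
  proof (induction S arbitrary: B rule: finite_induct)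
    case empty
    have "B u u = 0" for u
    proof -
      have z: "B u b = 0" if "b \<in> Basis" for b
        by (rule psd_zero_diag) (use empty that in auto)
      have "B u u = B u (\<Sum>b\<in>Basis. (u \<bullet> b) *\<^sub>R b)" by (simp add: euclidean_representation)
      also have "\<dots> = (\<Sum>b\<in>Basis. (u \<bullet> b) * B u b)"
        using empty(2) by (simp add: bilinear_def linear_sum linear_scale)
      finally show ?thesis using z by simp
    qed
    then show ?case by (intro exI[of _ "[]"]) simp
  next
    case (insert b S)
    note B = insert.prems(2-4)
    show ?case
    proof (cases "B b b = 0")
      case True
      have "B c c = 0" if "c \<in> Basis - S" for c
        using that insert.prems(5)[of c] True by blast
      then show ?thesis using insert.IH[of B] insert.prems(1) B by blast
    next
      case False
      then have pos: "B b b > 0" using B(3)[of b] by simp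
      \<comment> \<open>Subtracting the square of the functional \<open>B u b / sqrt (B b b)\<close>
        makes the diagonal entry at \<open>b\<close> vanish.\<close>
      define B' where "B' u w = B u w - B u b * B w b / B b b" for u w
      have bil: "bilinear B'"
      proof -
        have l1: "linear (\<lambda>x. B x y)" and l2: "linear (B x)" for x y using B(1) by (auto simp: bilinear_def)
        have "linear (B' x)" for x
          unfolding B'_def
          by (rule linearI) (simp_all add: linear_add[OF l1] linear_scale[OF l1] linear_add[OF l2] linear_scale[OF l2]
            algebra_simps add_divide_distrib diff_divide_distrib)
        moreover have "linear (\<lambda>x. B' x y)" for y
          unfolding B'_def
          by (rule linearI) (simp_all add: linear_add[OF l1] linear_scale[OF l1] linear_add[OF l2] linear_scale[OF l2]
            algebra_simps add_divide_distrib diff_divide_distrib)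
        ultimately show ?thesis by (simp add: bilinear_def)
      qed
      have sym: "B' u w = B' w u" for u w using B(2)[of u w] by (simp add: B'_def mult.commute)
      have psd: "B' u u \<ge> 0" for u
      proof -
        \<comment> \<open>The minimizer of the form on the line through \<open>u\<close> in
          direction \<open>b\<close>; the minimum is \<open>B' u u\<close>.\<close>
        define t where "t = B u b / B b b"
        have "B (u - t *\<^sub>R b) (u - t *\<^sub>R b) = B u u - 2 * t * B u b + t * t * B b b"
          using B(2)[of b u] by (simp add: bilinear_lsub[OF B(1)] bilinear_rsub[OF B(1)] bilinear_lmul[OF B(1)]
            bilinear_rmul[OF B(1)] algebra_simps)
        also have "\<dots> = B' u u" using pos by (simp add: t_def B'_def field_simps)
        finally show ?thesis using B(3)[of "u - t *\<^sub>R b"] by simp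
      qed
      have diag: "B' c c = 0" if "c \<in> Basis - S" for c
      proof (cases "c = b")
        case True
        then show ?thesis using pos by (simp add: B'_def)
      next
        case False
        then have "B c c = 0" using insert.prems(5) that by auto
        \<comment> \<open>A square is subtracted from 0, and \<open>psd\<close> gives the other
          inequality; so the zeros reached before persist.\<close>
        then have "B' c c \<le> 0" using pos by (simp add: B'_def)
        then show ?thesis using psd[of c] by simp
      qed
      obtain as where as: "\<And>u. B' u u = (\<Sum>a\<leftarrow>as. (a \<bullet> u)\<^sup>2)"
        using insert.IH[of B'] bil sym psd diag insert.prems(1) by blast
      \<comment> \<open>The vector that represents this functional, so that the subtracted square is
        \<open>(a \<bullet> u)\<^sup>2\<close>.\<close>
      define a where "a = (\<Sum>e\<in>Basis. (B e b / sqrt (B b b)) *\<^sub>R e)"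
      have "(a \<bullet> u)\<^sup>2 = B u b * B u b / B b b" for u
      proof -
        have "B u b = B (\<Sum>e\<in>Basis. (u \<bullet> e) *\<^sub>R e) b" by (simp add: euclidean_representation)
        also have "\<dots> = (\<Sum>e\<in>Basis. B ((u \<bullet> e) *\<^sub>R e) b)"
          by (rule linear_sum) (use B(1) in \<open>simp add: bilinear_def\<close>)
        also have "\<dots> = (\<Sum>e\<in>Basis. (u \<bullet> e) * B e b)"
          by (simp add: bilinear_lmul[OF B(1)])
        finally have "a \<bullet> u = B u b / sqrt (B b b)"
          by (simp add: a_def inner_sum_left inner_sum_right inner_commute[of _ u] sum_divide_distrib mult_ac)
        then show ?thesis using pos by (simp add: power2_eq_square)
      qed
      then have "B u u = (\<Sum>a\<leftarrow>a # as. (a \<bullet> u)\<^sup>2)" for u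
        using as[of u] by (simp add: B'_def)
      then show ?thesis by blast
    qed
  qed
qed

text \<open>The vectors from \<open>psd_sum_squares\<close> determine the characteristic function,
  and Levy uniqueness identifies each projection to the line.\<close>

lemma ex_gaussian_vector:
  fixes B :: "'a::euclidean_space \<Rightarrow> 'a \<Rightarrow> real"
  assumes "bilinear B" "\<And>u w. B u w = B w u" "\<And>u. B u u \<ge> 0"
  shows "\<exists>N. prob_space N \<and> sets N = sets borel \<and>
    (\<forall>u. distr N borel (\<lambda>x. u \<bullet> x) = distr std_normal_distribution borel (\<lambda>z. sqrt (B u u) * z))"
proof -
  obtain as :: "'a list" where as: "\<And>u. B u u = (\<Sum>a\<leftarrow>as. (a \<bullet> u)\<^sup>2)"
    using psd_sum_squares[of Basis B] assms by auto
  obtain N where N: "prob_space N" and sN[measurable_cong]: "sets N = sets (borel :: 'a measure)"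
    and char_N: "\<And>u. (CLINT x|N. iexp (u \<bullet> x)) = complex_of_real (exp (- (\<Sum>a\<leftarrow>as. (a \<bullet> u)\<^sup>2) / 2))"
    using ex_gaussian_vector_sum_squares[of as] by blast
  interpret prob_space N by fact
  have "distr N borel (\<lambda>x. u \<bullet> x) = distr std_normal_distribution borel (\<lambda>z. sqrt (B u u) * z)" for u
  proof (rule Levy_uniqueness)
    show "real_distribution (distr N borel (\<lambda>x. u \<bullet> x))" by (rule real_distribution_distr) simp
    show "char (distr N borel (\<lambda>x. u \<bullet> x)) = char (distr std_normal_distribution borel (\<lambda>z. sqrt (B u u) * z))"
    proof
      fix t
      have "char (distr N borel (\<lambda>x. u \<bullet> x)) t = (CLINT x|N. iexp ((t *\<^sub>R u) \<bullet> x))"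
        unfolding char_def by (subst integral_distr) auto
      also have "\<dots> = complex_of_real (exp (- B (t *\<^sub>R u) (t *\<^sub>R u) / 2))"
        unfolding char_N as ..
      also have "B (t *\<^sub>R u) (t *\<^sub>R u) = (sqrt (B u u) * t)\<^sup>2"
        by (simp add: bilinear_lmul[OF assms(1)] bilinear_rmul[OF assms(1)] power_mult_distrib assms(3) power2_eq_square)
      finally show "char (distr N borel (\<lambda>x. u \<bullet> x)) t = char (distr std_normal_distribution borel (\<lambda>z. sqrt (B u u) * z)) t"
        by (simp only: char_scaled_std_normal)
    qed
  qed (rule real_distribution_scaled_std_normal)
  then show ?thesis using N sN by blast
qed


section \<open>Convergence in law\<close>

text \<open>The functions whose integrals converge as soon as the characteristic functions do. They
  are closed under products, hence contain the polynomials in sines that approximate continuous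
  functions.\<close>

inductive trig_poly :: "('a::real_inner \<Rightarrow> complex) \<Rightarrow> bool" where
  base: "trig_poly (\<lambda>x. c * iexp (u \<bullet> x))"
| add: "trig_poly f \<Longrightarrow> trig_poly g \<Longrightarrow> trig_poly (\<lambda>x. f x + g x)"

lemma trig_poly_const: "trig_poly (\<lambda>x. c)"
  using trig_poly.base[of c 0] by simp

lemma trig_poly_mult:
  assumes "trig_poly f" "trig_poly g" shows "trig_poly (\<lambda>x. f x * g x)"
  using assms
proof (induction f arbitrary: g rule: trig_poly.induct)
  case (base c u)
  from this show ?case
  proof (induction g rule: trig_poly.induct)
    case (base d w)
    have "(\<lambda>x. c * iexp (u \<bullet> x) * (d * iexp (w \<bullet> x))) = (\<lambda>x. (c * d) * iexp ((u + w) \<bullet> x))"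
      by (auto simp: inner_left_distrib exp_add ring_distribs)
    then show ?case by (simp only: trig_poly.base)
  qed (simp add: ring_distribs trig_poly.add)
qed (simp add: ring_distribs trig_poly.add)

lemma trig_poly_sum: "(\<And>i. i \<in> I \<Longrightarrow> trig_poly (f i)) \<Longrightarrow> trig_poly (\<lambda>x. \<Sum>i\<in>I. f i x)"
  by (induction I rule: infinite_finite_induct) (auto intro: trig_poly_const trig_poly.add)

lemma trig_poly_sin: "trig_poly (\<lambda>x. of_real (sin (u \<bullet> x)))"
proof -
  have "trig_poly (\<lambda>x. 1 / (2 * \<i>) * iexp (u \<bullet> x) + (- 1 / (2 * \<i>)) * iexp ((- u) \<bullet> x))"
    by (intro trig_poly.intros)
  also have "(\<lambda>x. 1 / (2 * \<i>) * iexp (u \<bullet> x) + (- 1 / (2 * \<i>)) * iexp ((- u) \<bullet> x)) = (\<lambda>x. of_real (sin (u \<bullet> x)))"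
    by (simp add: sin_of_real[symmetric] sin_exp_eq fun_eq_iff field_simps)
  finally show ?thesis .
qed

lemma trig_poly_real_polynomial_function:
  fixes p :: "real ^ 'r \<Rightarrow> real"
  assumes "real_polynomial_function p"
  shows "trig_poly (\<lambda>x :: real ^ 'r. of_real (p (\<chi> i. sin (x $ i / R))))"
  using assms
proof (induction p rule: real_polynomial_function.induct)
  case (linear f)
  then interpret bounded_linear f .
  have f: "f y = (\<Sum>i\<in>UNIV. y $ i * f (axis i 1))" for y :: "real ^ 'r"
  proof -
    have "f y = f (\<Sum>i\<in>UNIV. y $ i *\<^sub>R axis i 1)"
      by (simp add: basis_expansion[of y, unfolded scalar_mult_eq_scaleR])
    then show ?thesis by (simp add: sum scaleR)
  qed
  have "trig_poly (\<lambda>x :: real ^ 'r. \<Sum>i\<in>UNIV. of_real (sin (axis i (1 / R) \<bullet> x)) * of_real (f (axis i 1)))"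
    by (intro trig_poly_sum trig_poly_mult trig_poly_sin trig_poly_const)
  then show ?case by (subst f) (simp add: inner_axis')
qed (simp_all add: trig_poly_const trig_poly.add trig_poly_mult)

lemma trig_poly_bounded_measurable:
  fixes f :: "'a::euclidean_space \<Rightarrow> complex"
  assumes "trig_poly f" shows "f \<in> borel_measurable borel \<and> (\<exists>B. \<forall>x. cmod (f x) \<le> B)"
  using assms
proof (induction f rule: trig_poly.induct)
  case (base c u)
  have "\<forall>x. cmod (c * iexp (u \<bullet> x)) \<le> cmod c" by (simp add: norm_mult)
  then show ?case by auto
next
  case (add f g)
  then obtain B C where "\<And>x. cmod (f x) \<le> B" "\<And>x. cmod (g x) \<le> C" by blast
  then have "\<forall>x. cmod (f x + g x) \<le> B + C" by (meson norm_triangle_mono)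
  then show ?case using add by auto
qed

lemma trig_poly_integrable:
  fixes f :: "'a::euclidean_space \<Rightarrow> complex"
  assumes "trig_poly f" "prob_space M" and s[measurable_cong]: "sets M = sets borel"
  shows "integrable M f"
proof -
  interpret prob_space M by fact
  obtain B where B: "\<And>x. cmod (f x) \<le> B" and [measurable]: "f \<in> borel_measurable borel"
    using trig_poly_bounded_measurable[OF assms(1)] by blast
  show ?thesis by (rule integrable_const_bound[of _ B]) (use B in auto)
qed

lemma trig_poly_tendsto:
  fixes f :: "'a::euclidean_space \<Rightarrow> complex"
  assumes "trig_poly f"
    and M: "\<And>n. prob_space (M n)" "\<And>n. sets (M n) = sets borel" and N: "prob_space N" "sets N = sets borel"
    and char: "\<And>u. (\<lambda>n. CLINT x|M n. iexp (u \<bullet> x)) \<longlonglongrightarrow> (CLINT x|N. iexp (u \<bullet> x))"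
  shows "(\<lambda>n. CLINT x|M n. f x) \<longlonglongrightarrow> (CLINT x|N. f x)"
  using assms(1)
proof (induction f rule: trig_poly.induct)
  case (base c u)
  show ?case by (simp add: tendsto_mult_left char)
next
  case (add f g)
  then show ?case
    using trig_poly_integrable[OF add(1) M] trig_poly_integrable[OF add(2) M]
      trig_poly_integrable[OF add(1) N] trig_poly_integrable[OF add(2) N]
    by (simp add: tendsto_add)
qed

text \<open>A bounded continuous function agrees on a large ball, up to a small error, with a polynomial in the
  \<open>sin (x $ i / R)\<close>; unlike a polynomial in the coordinates, this one is bounded everywhere.\<close>

lemma trig_approximation:
  fixes f :: "real ^ 'r \<Rightarrow> real"
  assumes f: "continuous_on UNIV f" and B: "\<And>x. \<bar>f x\<bar> \<le> B" and R: "R > 0" and e: "e > 0"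
  shows "\<exists>h. trig_poly (\<lambda>x. of_real (h x)) \<and> (\<forall>x. \<bar>f x - h x\<bar> \<le> e + (2 * B + e) * (norm x)\<^sup>2 / R\<^sup>2)"
proof -
  define S where "S = cbox (\<chi> i. -1) (\<chi> i. 1 :: real ^ 'r)"
  \<comment> \<open>\<open>f\<close> in the coordinates \<open>sin (x $ i / R)\<close>, a continuous
    function on the cube \<open>S\<close>, to which Stone-Weierstrass applies.\<close>
  define F where "F y = f (\<chi> i. R * arcsin (y $ i))" for y
  have S: "y \<in> S \<longleftrightarrow> (\<forall>i. -1 \<le> y $ i \<and> y $ i \<le> 1)" for y by (simp add: S_def mem_box_cart)
  have "continuous_on S (\<lambda>y. \<chi> i. R * arcsin (y $ i) :: real ^ 'r)"
    by (intro continuous_on_vec_lambda continuous_intros) (auto simp: S)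
  then have cF: "continuous_on S F"
    unfolding F_def by (rule continuous_on_compose2[OF f]) auto
  obtain p where p: "real_polynomial_function p" "\<And>y. y \<in> S \<Longrightarrow> \<bar>F y - p y\<bar> < e"
    using Stone_Weierstrass_real_polynomial_function[OF _ cF e] by (metis S_def compact_cbox)
  define h where "h x = p (\<chi> i. sin (x $ i / R))" for x :: "real ^ 'r"
  have "\<bar>f x - h x\<bar> \<le> e + (2 * B + e) * (norm x)\<^sup>2 / R\<^sup>2" for x
  proof -
    let ?y = "\<chi> i. sin (x $ i / R)"
    have y: "\<bar>F ?y - h x\<bar> < e" unfolding h_def by (rule p(2)) (simp add: S)
    have B0: "B \<ge> 0" using B[of 0] by simp
    show ?thesis
    proof (cases "norm x \<le> R")
      case True
      have "R * arcsin (sin (x $ i / R)) = x $ i" for i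
      proof -
        have "\<bar>x $ i\<bar> \<le> R" using component_le_norm_cart[of x i] True by simp
        \<comment> \<open>Inside the ball the arguments stay within the range where
          \<open>arcsin\<close> inverts the sine.\<close>
        then have "\<bar>x $ i / R\<bar> \<le> 1" using R by (simp add: field_simps)
        also have "1 \<le> pi / 2" using pi_ge_two by simp
        finally have "arcsin (sin (x $ i / R)) = x $ i / R"
          by (intro arcsin_sin) (unfold abs_le_iff, linarith+)
        then show ?thesis using R by simp
      qed
      then have "F ?y = f x" by (simp add: F_def)
      moreover have "(2 * B + e) * (norm x)\<^sup>2 / R\<^sup>2 \<ge> 0" using B0 e by simp
      ultimately show ?thesis using y by linarith
    next
      case False
      \<comment> \<open>Outside the ball both \<open>f\<close> and \<open>F\<close> are bounded by
        \<open>B\<close>; the quotient \<open>(norm x)\<^sup>2 / R\<^sup>2\<close> is at least 1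
        there and covers the error.\<close>
      have "\<bar>f x - h x\<bar> \<le> 2 * B + e" using B[of x] B[of "\<chi> i. R * arcsin (?y $ i)"] y by (auto simp: F_def)
      also have "\<dots> * 1 \<le> (2 * B + e) * ((norm x)\<^sup>2 / R\<^sup>2)"
        using False R B0 e by (intro mult_left_mono) (auto simp: power_mono)
      finally show ?thesis using e by simp
    qed
  qed
  moreover have "trig_poly (\<lambda>x. of_real (h x))"
    unfolding h_def by (rule trig_poly_real_polynomial_function[OF p(1)])
  ultimately show ?thesis by blast
qed

text \<open>The characteristic functions settle all trigonometric polynomials; the common second
  moment bound \<open>K\<close> controls what \<open>trig_approximation\<close> loses far from the
  origin, for all large \<open>n\<close> at once.\<close>

lemma converges_in_law_charI:
  fixes M :: "nat \<Rightarrow> (real ^ 'r) measure"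
  assumes M: "\<And>n. prob_space (M n)" "\<And>n. sets (M n) = sets borel" and N: "prob_space N" "sets N = sets borel"
    and char: "\<And>u. (\<lambda>n. CLINT x|M n. iexp (u \<bullet> x)) \<longlonglongrightarrow> (CLINT x|N. iexp (u \<bullet> x))"
    and M2: "\<And>n. integrable (M n) (\<lambda>x. (norm x)\<^sup>2)" "\<forall>\<^sub>F n in sequentially. (LINT x|M n. (norm x)\<^sup>2) \<le> K"
    and N2: "integrable N (\<lambda>x. (norm x)\<^sup>2)" "(LINT x|N. (norm x)\<^sup>2) \<le> K"
  shows "converges_in_law M N"
  unfolding converges_in_law_def
proof (intro allI impI, elim conjE)
  fix f :: "real ^ 'r \<Rightarrow> real"
  assume f: "continuous_on UNIV f" and "bounded (range f)"
  then obtain B where B: "\<And>x. \<bar>f x\<bar> \<le> B" by (auto simp: bounded_iff)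
  have B0: "B \<ge> 0" using B[of 0] by simp
  have "0 \<le> (LINT x|N. (norm x)\<^sup>2)" by (rule Bochner_Integration.integral_nonneg) simp
  then have K: "K \<ge> 0" using N2(2) by (rule order_trans)
  have fm[measurable]: "f \<in> borel_measurable borel" using f by (rule borel_measurable_continuous_onI)
  show "(\<lambda>n. LINT x|M n. f x) \<longlonglongrightarrow> (LINT x|N. f x)"
  proof (rule tendstoI)
    fix \<epsilon> :: real assume \<epsilon>: "\<epsilon> > 0"
    \<comment> \<open>\<open>e\<close> and \<open>R\<close> make the two error terms at most
      \<open>\<epsilon> / 6\<close> each. The approximation under \<open>M n\<close>, that under
      \<open>N\<close> and the convergence for \<open>h\<close> then cost
      \<open>\<epsilon> / 3\<close> each.\<close>
    define e where "e = min 1 (\<epsilon> / 6)"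
    define R where "R = sqrt ((2 * B + 1) * (K + 1) * 6 / \<epsilon>)"
    have e: "e > 0" "e \<le> 1" "e \<le> \<epsilon> / 6" using \<epsilon> by (auto simp: e_def)
    have R: "R > 0" using \<epsilon> B0 K by (simp add: R_def)
    have R2: "R\<^sup>2 = (2 * B + 1) * (K + 1) * 6 / \<epsilon>" using \<epsilon> B0 K by (simp add: R_def)
    obtain h where h: "trig_poly (\<lambda>x. of_real (h x))" "\<And>x. \<bar>f x - h x\<bar> \<le> e + (2 * B + e) * (norm x)\<^sup>2 / R\<^sup>2"
      using trig_approximation[OF f B R e(1)] by blast
    have close: "\<bar>(LINT x|L. f x) - (LINT x|L. h x)\<bar> \<le> \<epsilon> / 3" and hint: "(CLINT x|L. of_real (h x)) = of_real (LINT x|L. h x)"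
      if L: "prob_space L" "sets L = sets borel" "integrable L (\<lambda>x. (norm x)\<^sup>2)" "(LINT x|L. (norm x)\<^sup>2) \<le> K" for L
    proof -
      interpret prob_space L by fact
      note [measurable_cong] = L(2)
      have ih: "integrable L h" using integrable_Re[OF trig_poly_integrable[OF h(1) L(1,2)]] by simp
      then show "(CLINT x|L. of_real (h x)) = of_real (LINT x|L. h x)" by simp
      have if': "integrable L f" by (rule integrable_const_bound[of _ B]) (use B in auto)
      have "\<bar>(LINT x|L. f x) - (LINT x|L. h x)\<bar> = \<bar>LINT x|L. f x - h x\<bar>" using ih if' by simp
      also have "\<dots> \<le> (LINT x|L. \<bar>f x - h x\<bar>)" by (rule integral_abs_bound)
      also have "\<dots> \<le> (LINT x|L. e + (2 * B + e) * (norm x)\<^sup>2 / R\<^sup>2)"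
        by (intro integral_mono) (use h(2) ih if' L(3) in auto)
      also have "\<dots> = e + (2 * B + e) * (LINT x|L. (norm x)\<^sup>2) / R\<^sup>2"
        using L(3) by (simp add: prob_space)
      also have "(2 * B + e) * (LINT x|L. (norm x)\<^sup>2) / R\<^sup>2 \<le> (2 * B + 1) * (K + 1) / R\<^sup>2"
        using L(4) e B0 K by (intro divide_right_mono mult_mono) auto
      also have "\<dots> = \<epsilon> / 6"
      proof -
        have "D / (D * 6 / \<epsilon>) = \<epsilon> / 6" if "D > 0" for D :: real using that \<epsilon> by simp
        moreover have "(2 * B + 1) * (K + 1) > 0" using B0 K by simp
        ultimately show ?thesis unfolding R2 by blast
      qed
      finally show "\<bar>(LINT x|L. f x) - (LINT x|L. h x)\<bar> \<le> \<epsilon> / 3" using e by simp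
    qed
    have "(\<lambda>n. CLINT x|M n. of_real (h x)) \<longlonglongrightarrow> (CLINT x|N. of_real (h x))"
      by (rule trig_poly_tendsto[OF h(1) M N char])
    then have "\<forall>\<^sub>F n in sequentially. dist (CLINT x|M n. of_real (h x)) (CLINT x|N. of_real (h x)) < \<epsilon> / 3"
      using \<epsilon> by (intro tendstoD) auto
    then show "\<forall>\<^sub>F n in sequentially. dist (LINT x|M n. f x) (LINT x|N. f x) < \<epsilon>"
      using M2(2)
    proof eventually_elim
      case (elim n)
      have "\<bar>(LINT x|M n. h x) - (LINT x|N. h x)\<bar> < \<epsilon> / 3"
        using elim(1) unfolding hint[OF M M2(1) elim(2)] hint[OF N N2]
        by (simp only: dist_norm of_real_diff[symmetric] norm_of_real)
      then show ?case
        using close[OF M M2(1) elim(2)] close[OF N N2] unfolding dist_real_def by linarith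
    qed
  qed
qed


section \<open>The method of moments\<close>

text \<open>For \<open>k = 2 * j\<close> this is \<open>v ^ j\<close> times the number of perfect
  matchings of \<open>2 * j\<close> points. Since \<open>0 ^ 0 = 1\<close>, the case
  \<open>v = 0\<close> gives the moments of the point mass at 0.\<close>

definition gaussian_moment :: "real \<Rightarrow> nat \<Rightarrow> real" where
  "gaussian_moment v k = (if even k then v ^ (k div 2) * fact k / (2 ^ (k div 2) * fact (k div 2)) else 0)"

text \<open>Odd terms vanish and in the even ones \<open>fact k\<close> cancels: the Taylor
  polynomial of the Gaussian characteristic function at 1 is a partial sum of an exponential
  series.\<close>

lemma sum_gaussian_moment:
  "(\<Sum>k\<le>2 * j. \<i> ^ k / fact k * complex_of_real (gaussian_moment v k)) = (\<Sum>l\<le>j. of_real ((- v / 2) ^ l / fact l))"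
proof (induction j)
  case 0
  show ?case by (simp add: gaussian_moment_def)
next
  case (Suc j)
  have e: "\<i> ^ (2 * Suc j) / fact (2 * Suc j) * complex_of_real (gaussian_moment v (2 * Suc j)) =
    of_real ((- v / 2) ^ Suc j / fact (Suc j))"
  proof -
    have "\<i> ^ (2 * Suc j) = (-1) ^ Suc j" by (subst power_mult) (simp only: power2_i)
    moreover have "complex_of_real (gaussian_moment v (2 * Suc j)) =
        of_real (v ^ Suc j) * fact (2 * Suc j) / of_real (2 ^ Suc j * fact (Suc j))"
      by (simp add: gaussian_moment_def del: power_Suc fact_Suc mult_Suc_right)
    moreover have "complex_of_real ((- v / 2) ^ Suc j / fact (Suc j)) =
        (- 1) ^ Suc j * of_real (v ^ Suc j) / of_real (2 ^ Suc j * fact (Suc j))"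
    proof -
      have "(- v / 2) ^ Suc j = (- 1) ^ Suc j * v ^ Suc j / 2 ^ Suc j"
        by (metis (no_types) mult_minus1 power_divide power_mult_distrib)
      then show ?thesis by (simp del: power_Suc fact_Suc)
    qed
    ultimately show ?thesis by (simp del: power_Suc fact_Suc mult_Suc_right)
  qed
  have "{..2 * Suc j} = insert (2 * Suc j) (insert (Suc (2 * j)) {..2 * j})" by auto
  then have "(\<Sum>k\<le>2 * Suc j. \<i> ^ k / fact k * complex_of_real (gaussian_moment v k)) =
      \<i> ^ (2 * Suc j) / fact (2 * Suc j) * complex_of_real (gaussian_moment v (2 * Suc j)) +
      (\<i> ^ Suc (2 * j) / fact (Suc (2 * j)) * complex_of_real (gaussian_moment v (Suc (2 * j))) +
       (\<Sum>k\<le>2 * j. \<i> ^ k / fact k * complex_of_real (gaussian_moment v k)))"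
    by simp
  then show ?case unfolding e Suc.IH by (simp add: gaussian_moment_def)
qed

text \<open>The Taylor remainder of order \<open>2 * j\<close> is at most
  \<open>2 / fact (2 * j)\<close> times the moment of order \<open>2 * j\<close>. As
  \<open>n\<close> grows this bound tends to \<open>2 * (v / 2) ^ j / fact j\<close>, which is small
  for large \<open>j\<close>; so \<open>j\<close> is fixed first and \<open>n\<close> grows
  afterwards.\<close>

lemma moments_imp_char_tendsto:
  fixes X :: "nat \<Rightarrow> 'b \<Rightarrow> real"
  assumes M: "\<And>n. prob_space (M n)" "\<And>n. X n \<in> borel_measurable (M n)"
    and int: "\<And>n k. integrable (M n) (\<lambda>x. X n x ^ k)"
    and lim: "\<And>k. (\<lambda>n. LINT x|M n. X n x ^ k) \<longlonglongrightarrow> gaussian_moment v k"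
  shows "(\<lambda>n. CLINT x|M n. iexp (X n x)) \<longlonglongrightarrow> of_real (exp (- v / 2))"
proof (rule tendstoI)
  fix \<epsilon> :: real assume \<epsilon>: "\<epsilon> > 0"
  define T where "T j = (\<Sum>l\<le>j. complex_of_real ((- v / 2) ^ l / fact l))" for j
  define r where "r j = 2 / fact (2 * j) * gaussian_moment v (2 * j)" for j
  have r: "r j = 2 * (inverse (fact j) * (v / 2) ^ j)" for j
    by (simp add: r_def gaussian_moment_def power_divide field_simps)
  have "r \<longlonglongrightarrow> 2 * 0"
    unfolding r using summable_exp[of "v / 2"] by (intro tendsto_mult tendsto_const summable_LIMSEQ_zero)
  then have r0: "\<forall>\<^sub>F j in sequentially. r j < \<epsilon> / 3" using \<epsilon> by (intro order_tendstoD) auto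
  have "(\<lambda>l. (- v / 2) ^ l / fact l) sums exp (- v / 2)"
    using exp_converges[of "- v / 2"] by (simp add: field_simps)
  then have "(\<lambda>j. \<Sum>l\<le>j. (- v / 2) ^ l / fact l) \<longlonglongrightarrow> exp (- v / 2)" by (simp add: sums_def_le)
  then have "T \<longlonglongrightarrow> of_real (exp (- v / 2))"
    unfolding T_def of_real_sum[symmetric] by (rule tendsto_of_real)
  then have "\<forall>\<^sub>F j in sequentially. dist (T j) (of_real (exp (- v / 2))) < \<epsilon> / 3"
    using \<epsilon> by (intro tendstoD) auto
  then have "\<forall>\<^sub>F j in sequentially. r j < \<epsilon> / 3 \<and> dist (T j) (of_real (exp (- v / 2))) < \<epsilon> / 3"
    using r0 by (rule eventually_conj[rotated])
  then obtain j where j: "r j < \<epsilon> / 3" "dist (T j) (of_real (exp (- v / 2))) < \<epsilon> / 3"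
    by (auto simp: eventually_sequentially)
  define S where "S n = (\<Sum>k\<le>2 * j. \<i> ^ k / fact k * complex_of_real (LINT x|M n. X n x ^ k))" for n
  have approx: "cmod ((CLINT x|M n. iexp (X n x)) - S n) \<le> 2 / fact (2 * j) * (LINT x|M n. X n x ^ (2 * j))" for n
  proof -
    interpret prob_space "M n" by (rule M)
    have "(CLINT x|M n. iexp (X n x)) = char (distr (M n) borel (X n)) 1"
      unfolding char_def using M(2) by (subst integral_distr) auto
    moreover have "cmod (char (distr (M n) borel (X n)) 1 - (\<Sum>k \<le> 2 * j. ((\<i> * of_real 1)^k / fact k) * expectation (\<lambda>x. X n x ^ k))) \<le>
      (2 * \<bar>1\<bar>^(2 * j) / fact (2 * j)) * expectation (\<lambda>x. \<bar>X n x\<bar>^(2 * j))"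
      by (rule char_approx1') (use int M(2) in auto)
    ultimately show ?thesis by (simp add: S_def power_even_abs)
  qed
  have "(\<lambda>n. 2 / fact (2 * j) * (LINT x|M n. X n x ^ (2 * j))) \<longlonglongrightarrow> r j"
    unfolding r_def by (intro tendsto_mult tendsto_const lim)
  then have e1: "\<forall>\<^sub>F n in sequentially. 2 / fact (2 * j) * (LINT x|M n. X n x ^ (2 * j)) < \<epsilon> / 3"
    using j(1) by (intro order_tendstoD) auto
  have "S \<longlonglongrightarrow> (\<Sum>k\<le>2 * j. \<i> ^ k / fact k * complex_of_real (gaussian_moment v k))"
    unfolding S_def by (intro tendsto_sum tendsto_mult tendsto_const tendsto_of_real lim)
  then have "S \<longlonglongrightarrow> T j" unfolding sum_gaussian_moment T_def .
  then have e2: "\<forall>\<^sub>F n in sequentially. dist (S n) (T j) < \<epsilon> / 3" using \<epsilon> by (intro tendstoD) auto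
  show "\<forall>\<^sub>F n in sequentially. dist (CLINT x|M n. iexp (X n x)) (of_real (exp (- v / 2))) < \<epsilon>"
    using e1 e2
  proof eventually_elim
    case (elim n)
    have "dist (CLINT x|M n. iexp (X n x)) (S n) < \<epsilon> / 3" using approx[of n] elim(1) by (simp add: dist_norm)
    then show ?case using elim(2) j(2)
      using dist_triangle[of "CLINT x|M n. iexp (X n x)" "of_real (exp (- v / 2))" "S n"]
        dist_triangle[of "S n" "of_real (exp (- v / 2))" "T j"] by linarith
  qed
qed

lemma gaussian_second_moment:
  fixes N :: "'a::euclidean_space measure"
  assumes N: "prob_space N" and s[measurable_cong]: "sets N = sets borel"
    and g: "distr N borel (\<lambda>x. u \<bullet> x) = distr std_normal_distribution borel (\<lambda>z. sqrt q * z)" and q: "q \<ge> 0"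
  shows "integrable N (\<lambda>x. u \<bullet> x)" "(LINT x|N. u \<bullet> x) = 0" "integrable N (\<lambda>x. (u \<bullet> x)\<^sup>2)" "(LINT x|N. (u \<bullet> x)\<^sup>2) = q"
proof -
  have i1: "integrable std_normal_distribution (\<lambda>z. z)" "integral\<^sup>L std_normal_distribution (\<lambda>z. z) = 0"
    using integrable_std_normal_distribution_moment[of 1] integral_std_normal_distribution_moment_odd[of 1] by simp_all
  have i2: "integrable std_normal_distribution (\<lambda>z. z\<^sup>2)" "integral\<^sup>L std_normal_distribution (\<lambda>z. z\<^sup>2) = 1"
    using integrable_std_normal_distribution_moment[of 2] std_normal_distribution_even_moments(1)[of 1]
    by (simp_all add: fact_numeral)
  let ?S = std_normal_distribution
  have t: "integrable N (\<lambda>x. f (u \<bullet> x)) \<longleftrightarrow> integrable ?S (\<lambda>z. f (sqrt q * z))"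
      "(LINT x|N. f (u \<bullet> x)) = (LINT z|?S. f (sqrt q * z))"
    if f[measurable]: "f \<in> borel_measurable borel" for f :: "real \<Rightarrow> real"
  proof -
    have "integrable N (\<lambda>x. f (u \<bullet> x)) \<longleftrightarrow> integrable (distr N borel (\<lambda>x. u \<bullet> x)) f"
      by (subst integrable_distr_eq) auto
    also have "\<dots> \<longleftrightarrow> integrable ?S (\<lambda>z. f (sqrt q * z))"
      unfolding g by (subst integrable_distr_eq) auto
    finally show "integrable N (\<lambda>x. f (u \<bullet> x)) \<longleftrightarrow> integrable ?S (\<lambda>z. f (sqrt q * z))" .
    have "(LINT x|N. f (u \<bullet> x)) = (LINT y|distr N borel (\<lambda>x. u \<bullet> x). f y)"
      by (subst integral_distr) auto
    also have "\<dots> = (LINT z|?S. f (sqrt q * z))"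
      unfolding g by (subst integral_distr) auto
    finally show "(LINT x|N. f (u \<bullet> x)) = (LINT z|?S. f (sqrt q * z))" .
  qed
  show "integrable N (\<lambda>x. u \<bullet> x)"
    by (subst t(1)[of "\<lambda>y. y"]) (auto intro: integrable_mult_right i1)
  have "(LINT x|N. u \<bullet> x) = (LINT z|?S. sqrt q * z)" by (rule t(2)) simp
  also have "\<dots> = sqrt q * (LINT z|?S. z)" by (rule integral_mult_right_zero)
  finally show "(LINT x|N. u \<bullet> x) = 0" unfolding i1(2) by simp
  have sq: "(sqrt q * z)\<^sup>2 = q * z\<^sup>2" for z using q by (simp add: power_mult_distrib)
  show "integrable N (\<lambda>x. (u \<bullet> x)\<^sup>2)"
    by (subst t(1)[of "\<lambda>y. y\<^sup>2"]) (auto simp: sq intro: integrable_mult_right i2)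
  have "(LINT x|N. (u \<bullet> x)\<^sup>2) = (LINT z|?S. (sqrt q * z)\<^sup>2)" by (rule t(2)) simp
  also have "\<dots> = q * (LINT z|?S. z\<^sup>2)" unfolding sq by (rule integral_mult_right_zero)
  finally show "(LINT x|N. (u \<bullet> x)\<^sup>2) = q" unfolding i2(2) by simp
qed

lemma norm_vec_square: "(norm (x :: real ^ 'r))\<^sup>2 = (\<Sum>i\<in>UNIV. (axis i 1 \<bullet> x)\<^sup>2)"
  unfolding power2_norm_eq_inner inner_axis' by (simp add: inner_vec_def power2_eq_square)

text \<open>The Cramer-Wold argument with moments: every functional \<open>u \<bullet> X n\<close>
  has Gaussian limit moments, so its characteristic function converges at 1, and as \<open>u\<close>
  varies these are all the values of the characteristic function of the vector.\<close>

lemma moments_imp_gaussian_limit: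
  fixes P :: "nat \<Rightarrow> 'b pmf" and X :: "nat \<Rightarrow> 'b \<Rightarrow> real ^ 'r" and C :: "'r \<Rightarrow> 'r \<Rightarrow> real"
  assumes fin: "\<And>n. finite (set_pmf (P n))"
    and sym: "\<And>i j. C i j = C j i"
    and lim: "\<And>u k. (\<lambda>n. measure_pmf.expectation (P n) (\<lambda>l. (u \<bullet> X n l) ^ k)) \<longlonglongrightarrow>
      gaussian_moment (\<Sum>i\<in>UNIV. \<Sum>j\<in>UNIV. u $ i * u $ j * C i j) k"
  shows "\<exists>N. centered_gaussian_vector N \<and>
    converges_in_law (\<lambda>n. distr (measure_pmf (P n)) borel (X n)) N \<and>
    (\<forall>i j. covariance N (\<lambda>x. x $ i) (\<lambda>x. x $ j) = C i j)"
proof -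
  define B where "B u w = (\<Sum>i\<in>UNIV. \<Sum>j\<in>UNIV. u $ i * w $ j * C i j)" for u w :: "real ^ 'r"
  have int: "integrable (measure_pmf (P n)) (f :: 'b \<Rightarrow> real)" for f n
    by (rule integrable_measure_pmf_finite[OF fin])
  have bil: "bilinear B"
    unfolding bilinear_def B_def
    by (auto intro!: linearI simp: algebra_simps sum.distrib sum_distrib_left)
  have symB: "B u w = B w u" for u w
    unfolding B_def by (subst sum.swap) (simp add: mult_ac sym)
  have lim': "(\<lambda>n. measure_pmf.expectation (P n) (\<lambda>l. (u \<bullet> X n l) ^ k)) \<longlonglongrightarrow> gaussian_moment (B u u) k" for u k
    using lim by (simp add: B_def)
  have lim2: "(\<lambda>n. measure_pmf.expectation (P n) (\<lambda>l. (u \<bullet> X n l)\<^sup>2)) \<longlonglongrightarrow> B u u" for u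
    using lim'[of u 2] by (simp add: gaussian_moment_def)
  \<comment> \<open>A limit of second moments is nonnegative; so the form given by \<open>C\<close>
    is positive semidefinite and belongs to a Gaussian vector.\<close>
  have psd: "B u u \<ge> 0" for u
    by (rule tendsto_lowerbound[OF lim2]) (auto intro!: always_eventually integral_nonneg_AE)
  obtain N where N: "prob_space N" "sets N = sets borel"
    and g: "\<And>u. distr N borel (\<lambda>x. u \<bullet> x) = distr std_normal_distribution borel (\<lambda>z. sqrt (B u u) * z)"
    using ex_gaussian_vector[OF bil symB psd] by blast
  note [measurable_cong] = N(2)
  note mom = gaussian_second_moment[OF N g psd]
  have cg: "centered_gaussian_vector N"
    unfolding centered_gaussian_vector_def using N by (simp add: g centered_gaussian_scaled_std_normal psd)
  have charN: "(CLINT x|N. iexp (u \<bullet> x)) = of_real (exp (- B u u / 2))" for u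
  proof -
    have "(CLINT x|N. iexp (u \<bullet> x)) = char (distr N borel (\<lambda>x. u \<bullet> x)) 1"
      unfolding char_def by (subst integral_distr) auto
    then show ?thesis unfolding g char_scaled_std_normal by (simp add: psd)
  qed
  let ?M = "\<lambda>n. distr (measure_pmf (P n)) borel (X n)"
  \<comment> \<open>The same second moments, summed over the coordinates, give the uniform bound for
    \<open>converges_in_law_charI\<close>.\<close>
  have lim_norm: "(\<lambda>n. measure_pmf.expectation (P n) (\<lambda>l. (norm (X n l))\<^sup>2)) \<longlonglongrightarrow> (\<Sum>i\<in>UNIV. B (axis i 1) (axis i 1))"
    unfolding norm_vec_square by (simp add: int) (intro tendsto_sum lim2)
  have N2: "integrable N (\<lambda>x. (norm x)\<^sup>2)" "(LINT x|N. (norm x)\<^sup>2) = (\<Sum>i\<in>UNIV. B (axis i 1) (axis i 1))"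
    unfolding norm_vec_square using mom by simp_all
  have conv: "converges_in_law ?M N"
  proof (rule converges_in_law_charI[where K = "(\<Sum>i\<in>UNIV. B (axis i 1) (axis i 1)) + 1"])
    show "prob_space (?M n)" for n by (rule measure_pmf.prob_space_distr) simp
    show "(\<lambda>n. CLINT x|?M n. iexp (u \<bullet> x)) \<longlonglongrightarrow> (CLINT x|N. iexp (u \<bullet> x))" for u
    proof -
      have "(CLINT x|?M n. iexp (u \<bullet> x)) = (CLINT l|measure_pmf (P n). iexp (u \<bullet> X n l))" for n
        by (subst integral_distr) auto
      then show ?thesis unfolding charN
        using moments_imp_char_tendsto[of "\<lambda>n. measure_pmf (P n)" "\<lambda>n l. u \<bullet> X n l", OF _ _ int lim']
        by (simp add: measure_pmf.prob_space_axioms)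
    qed
    show "integrable (?M n) (\<lambda>x. (norm x)\<^sup>2)" for n
      by (subst integrable_distr_eq) (auto intro: int)
    have "\<forall>\<^sub>F n in sequentially. measure_pmf.expectation (P n) (\<lambda>l. (norm (X n l))\<^sup>2) < (\<Sum>i\<in>UNIV. B (axis i 1) (axis i 1)) + 1"
      by (rule order_tendstoD(2)[OF lim_norm]) simp
    then show "\<forall>\<^sub>F n in sequentially. (LINT x|?M n. (norm x)\<^sup>2) \<le> (\<Sum>i\<in>UNIV. B (axis i 1) (axis i 1)) + 1"
      by eventually_elim (subst integral_distr, auto)
  qed (use N N2 in auto)
  have "covariance N (\<lambda>x. x $ i) (\<lambda>x. x $ j) = C i j" for i j
  proof -
    have m0: "(LINT x|N. x $ i) = 0" for i using mom(2)[of "axis i 1"] by (simp add: inner_axis')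
    have BC: "B (axis i 1) (axis j 1) = C i j" for i j
    proof -
      have "B (axis i 1) (axis j 1) = (\<Sum>k\<in>UNIV. \<Sum>l\<in>UNIV. if k = i then if l = j then C i j else 0 else 0)"
        unfolding B_def by (intro sum.cong refl) (auto simp: axis_def)
      also have "\<dots> = (\<Sum>k\<in>UNIV. if k = i then \<Sum>l\<in>UNIV. if l = j then C i j else 0 else 0)"
        by (intro sum.cong) auto
      finally show ?thesis by simp
    qed
    let ?a = "axis i 1 :: real ^ 'r" and ?b = "axis j 1 :: real ^ 'r"
    \<comment> \<open>Polarization, as \<open>mom\<close> gives the second moments of linear
      functionals.\<close>
    have e: "x $ i * x $ j = (((?a + ?b) \<bullet> x)\<^sup>2 - (?a \<bullet> x)\<^sup>2 - (?b \<bullet> x)\<^sup>2) / 2" for x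
      by (simp add: inner_axis' inner_left_distrib power2_eq_square algebra_simps)
    have "(LINT x|N. x $ i * x $ j) = (B (?a + ?b) (?a + ?b) - B ?a ?a - B ?b ?b) / 2"
      unfolding e using mom by simp
    also have "\<dots> = B ?a ?b"
      using symB[of ?b ?a] by (simp add: bilinear_ladd[OF bil] bilinear_radd[OF bil])
    finally show ?thesis by (simp add: covariance_def m0 BC)
  qed
  then show ?thesis using cg conv by blast
qed


section \<open>The covariance of two characters\<close>

text \<open>Composition with the transposition of \<open>x\<close> and \<open>y\<close> exchanges
  the fibres over \<open>x\<close> and \<open>y\<close>, so all fibres have the same size.\<close>

lemma card_fiber:
  fixes A :: "('a \<Rightarrow> 'b) set"
  assumes A: "finite A" and X: "finite X" "x \<in> X" "\<And>g. g \<in> A \<Longrightarrow> g t \<in> X"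
    and tr: "\<And>g y z. g \<in> A \<Longrightarrow> y \<in> X \<Longrightarrow> z \<in> X \<Longrightarrow> Transposition.transpose y z \<circ> g \<in> A"
  shows "card {g\<in>A. g t = x} * card X = card A"
proof -
  have eq: "card {g\<in>A. g t = y} = card {g\<in>A. g t = x}" if y: "y \<in> X" for y
  proof (rule bij_betw_same_card)
    let ?f = "\<lambda>g. Transposition.transpose x y \<circ> g"
    have inv: "?f (?f g) = g" for g :: "'a \<Rightarrow> 'b"
      by (simp only: comp_assoc[symmetric] transpose_comp_involutory id_comp)
    show "bij_betw ?f {g\<in>A. g t = y} {g\<in>A. g t = x}"
    proof (rule bij_betw_byWitness[where f' = ?f])
      show "\<forall>g\<in>{g\<in>A. g t = y}. ?f (?f g) = g" "\<forall>g\<in>{g\<in>A. g t = x}. ?f (?f g) = g"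
        using inv by blast+
      show "?f ` {g\<in>A. g t = y} \<subseteq> {g\<in>A. g t = x}" "?f ` {g\<in>A. g t = x} \<subseteq> {g\<in>A. g t = y}"
        using tr[OF _ X(2) y] by auto
    qed
  qed
  have "A = (\<Union>y\<in>X. {g\<in>A. g t = y})" using X(3) by blast
  then have "card A = card (\<Union>y\<in>X. {g\<in>A. g t = y})" by (rule arg_cong)
  also have "\<dots> = (\<Sum>y\<in>X. card {g\<in>A. g t = y})" by (rule card_UN_disjoint) (use A X in auto)
  also have "\<dots> = (\<Sum>y\<in>X. card {g\<in>A. g t = x})" by (rule sum.cong[OF refl eq])
  finally show ?thesis by simp
qed

lemma transpose_sym_group:
  "g \<in> sym_group n \<Longrightarrow> y \<in> {1..n} \<Longrightarrow> z \<in> {1..n} \<Longrightarrow> Transposition.transpose y z \<circ> g \<in> sym_group n"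
  unfolding sym_group_def by (auto intro!: permutes_compose permutes_swap_id)

section \<open>Averages over the symmetric group\<close>

definition avg :: "nat \<Rightarrow> ((nat \<Rightarrow> nat) \<Rightarrow> real) \<Rightarrow> real" where
  "avg n F = (\<Sum>g\<in>sym_group n. F g) / fact n"

lemma avg_mono: "(\<And>g. g \<in> sym_group n \<Longrightarrow> F g \<le> G g) \<Longrightarrow> avg n F \<le> avg n G"
  by (simp add: avg_def divide_right_mono sum_mono)

lemma avg_sum: "avg n (\<lambda>g. \<Sum>i\<in>I. F i g) = (\<Sum>i\<in>I. avg n (F i))"
  unfolding avg_def by (subst sum.swap) (simp add: sum_divide_distrib)

lemma avg_diff: "avg n (\<lambda>g. F g - G g) = avg n F - avg n G"
  by (simp add: avg_def sum_subtractf diff_divide_distrib)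

lemma avg_mult: "avg n (\<lambda>g. c * F g) = c * avg n F"
  by (simp add: avg_def sum_distrib_left)

lemma avg_const: "avg n (\<lambda>g. c) = c"
  by (simp add: avg_def card_sym_group)

lemma abs_avg_le: "\<bar>avg n F\<bar> \<le> avg n (\<lambda>g. \<bar>F g\<bar>)"
  by (simp add: avg_def divide_right_mono sum_abs)

lemma avg_of_bool: "avg n (\<lambda>g. of_bool (Q g)) = card {g\<in>sym_group n. Q g} / fact n"
  by (simp add: avg_def finite_sym_group Int_def)

lemma avg_point:
  assumes "s \<in> {1..n}" "t \<in> {1..n}" shows "avg n (\<lambda>g. of_bool (g t = s)) = 1 / n"
proof -
  have "card {g\<in>sym_group n. g t = s} * card {1..n} = card (sym_group n)"
    by (rule card_fiber[OF finite_sym_group]) (use assms sym_group_mem transpose_sym_group in blast)+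
  then have "real (card {g\<in>sym_group n. g t = s}) * real n = fact n"
    unfolding card_sym_group by (metis card_atLeastAtMost diff_Suc_1 of_nat_fact of_nat_mult)
  moreover have "n > 0" using assms by auto
  ultimately show ?thesis unfolding avg_of_bool by (simp add: field_simps)
qed

text \<open>Fibres are counted twice: once \<open>g t = s\<close> is fixed, \<open>g t'\<close>
  ranges over the other \<open>n - 1\<close> points, and transpositions of these preserve the
  condition at \<open>t\<close>.\<close>

lemma avg_two_points:
  assumes "s \<in> {1..n}" "t \<in> {1..n}" "s' \<in> {1..n}" "t' \<in> {1..n}" "s \<noteq> s'" "t \<noteq> t'"
  shows "avg n (\<lambda>g. of_bool (g t = s \<and> g t' = s')) = 1 / (real n * real (n - 1))"
proof -
  let ?A = "{g\<in>sym_group n. g t = s}"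
  have inj: "g t' \<noteq> g t" if "g \<in> sym_group n" for g
    using sym_group_bij[OF that] assms(6) by (auto simp: bij_def inj_eq)
  have "card {g\<in>?A. g t' = s'} * card ({1..n} - {s}) = card ?A"
  proof (rule card_fiber)
    show "finite ?A" using finite_sym_group by simp
    show "g t' \<in> {1..n} - {s}" if "g \<in> ?A" for g
      using that inj[of g] sym_group_mem[of g n t'] assms(4) by auto
    show "Transposition.transpose y z \<circ> g \<in> ?A" if "g \<in> ?A" "y \<in> {1..n} - {s}" "z \<in> {1..n} - {s}" for g y z
      using that transpose_sym_group[of g n y z] by (auto simp: Transposition.transpose_def)
  qed (use assms in auto)
  moreover have "card ({1..n} - {s}) = n - 1" using assms(1) by simp
  moreover have "{g\<in>?A. g t' = s'} = {g\<in>sym_group n. g t = s \<and> g t' = s'}" by blast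
  ultimately have "card {g\<in>sym_group n. g t = s \<and> g t' = s'} * (n - 1) = card ?A" by simp
  then have "real (card {g\<in>sym_group n. g t = s \<and> g t' = s'}) * real (n - 1) = real (card ?A)"
    unfolding of_nat_mult[symmetric] by (rule arg_cong)
  moreover have n: "n > 1" using assms by auto
  ultimately have "real (card {g\<in>sym_group n. g t = s \<and> g t' = s'}) = real (card ?A) / real (n - 1)"
    by (simp add: eq_divide_eq)
  then have "avg n (\<lambda>g. of_bool (g t = s \<and> g t' = s')) = real (card ?A) / fact n / real (n - 1)"
    unfolding avg_of_bool by simp
  also have "real (card ?A) / fact n = 1 / n"
    using avg_point[OF assms(1,2)] by (simp only: avg_of_bool)
  finally show ?thesis by simp
qed

lemma perm_supp_sym_group: "\<sigma> \<in> sym_group n \<Longrightarrow> perm_supp \<sigma> \<subseteq> {1..n}"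
  by (auto simp: sym_group_def perm_supp_def permutes_def simp del: atLeastAtMost_iff)

lemma sym_group_mono: "m \<le> n \<Longrightarrow> sym_group m \<subseteq> sym_group n"
  by (auto simp: sym_group_def intro: permutes_subset)

text \<open>\<open>Q\<close> lists the possible incidences of the two supports. With no incidence
  the difference of characters is 0, with exactly one it is \<open>D q\<close> by
  \<open>thoma_character_merge\<close>, and the sum over \<open>Q\<close> reproduces both cases.
  With two or more, the indicator sum is at least 1 and all terms are bounded crudely by the
  constant in front of it.\<close>

lemma pair_expansion:
  fixes \<sigma> \<tau> g
  assumes \<omega>: "\<omega> \<in> thoma_simplex" and \<sigma>: "permutation \<sigma>" and \<tau>: "permutation \<tau>" and g: "bij g"
  defines "Q \<equiv> perm_supp \<sigma> \<times> perm_supp \<tau>"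
  defines "D \<equiv> \<lambda>q. thoma_p_part \<omega> (nontrivial_cycle_type \<sigma> + nontrivial_cycle_type \<tau>
      - {#card (orbit \<sigma> (fst q)), card (orbit \<tau> (snd q))#}) *
    (thoma_p \<omega> (card (orbit \<sigma> (fst q)) + card (orbit \<tau> (snd q)) - 1)
      - thoma_p \<omega> (card (orbit \<sigma> (fst q))) * thoma_p \<omega> (card (orbit \<tau> (snd q))))"
  shows "\<bar>thoma_character \<omega> (\<sigma> \<circ> conj_by g \<tau>) - thoma_character \<omega> \<sigma> * thoma_character \<omega> \<tau>
      - (\<Sum>q\<in>Q. D q * of_bool (g (snd q) = fst q))\<bar> \<le>
    (2 + (\<Sum>q\<in>Q. \<bar>D q\<bar>)) * (\<Sum>q\<in>Q. \<Sum>q'\<in>Q. of_bool (fst q \<noteq> fst q' \<and> snd q \<noteq> snd q' \<and>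
      g (snd q) = fst q \<and> g (snd q') = fst q'))" (is "\<bar>?Y - ?S\<bar> \<le> ?B * ?N")
proof -
  let ?\<chi> = "thoma_character \<omega>"
  let ?\<tau> = "conj_by g \<tau>"
  have fin: "finite Q" using \<sigma> \<tau> by (simp add: Q_def finite_perm_supp)
  have \<tau>': "permutation ?\<tau>" by (rule permutation_conj_by[OF \<tau> g])
  have supp: "perm_supp ?\<tau> = g ` perm_supp \<tau>" by (rule perm_supp_conj_by[OF g])
  have \<chi>\<tau>: "?\<chi> ?\<tau> = ?\<chi> \<tau>" by (rule thoma_character_conj_by[OF \<tau> g])
  have N0: "?N \<ge> 0" by (intro sum_nonneg) simp
  have B0: "?B \<ge> 0" by (intro add_nonneg_nonneg sum_nonneg) auto
  have inj: "g x = g y \<longleftrightarrow> x = y" for x y using g by (auto simp: bij_def inj_eq)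
  show ?thesis
  proof (cases "\<exists>q\<in>Q. \<exists>q'\<in>Q. fst q \<noteq> fst q' \<and> snd q \<noteq> snd q' \<and> g (snd q) = fst q \<and> g (snd q') = fst q'")
    case True
    then obtain q q' where q: "q \<in> Q" "q' \<in> Q" "fst q \<noteq> fst q'" "snd q \<noteq> snd q'" "g (snd q) = fst q" "g (snd q') = fst q'"
      by blast
    let ?n = "\<lambda>q q'. of_bool (fst q \<noteq> fst q' \<and> snd q \<noteq> snd q' \<and> g (snd q) = fst q \<and> g (snd q') = fst q') :: real"
    have "1 = ?n q q'" using q by simp
    also have "\<dots> \<le> (\<Sum>q'\<in>Q. ?n q q')" by (rule member_le_sum) (use q fin in auto)
    also have "\<dots> \<le> ?N"
      by (rule member_le_sum[of q Q "\<lambda>q. \<Sum>q'\<in>Q. ?n q q'"]) (use q fin in \<open>auto intro: sum_nonneg\<close>)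
    finally have N1: "1 \<le> ?N" .
    have "\<bar>?\<chi> (\<sigma> \<circ> ?\<tau>)\<bar> \<le> 1"
      by (rule abs_thoma_character_le_1[OF \<omega> permutation_compose[OF \<sigma> \<tau>']])
    moreover have "\<bar>?\<chi> \<sigma> * ?\<chi> \<tau>\<bar> \<le> 1"
      using abs_thoma_character_le_1[OF \<omega> \<sigma>] abs_thoma_character_le_1[OF \<omega> \<tau>]
      unfolding abs_mult using mult_mono[of "\<bar>?\<chi> \<sigma>\<bar>" 1 "\<bar>?\<chi> \<tau>\<bar>" 1] by simp
    moreover have "\<bar>?S\<bar> \<le> (\<Sum>q\<in>Q. \<bar>D q\<bar>)"
      by (rule order_trans[OF sum_abs]) (rule sum_mono, simp add: abs_mult)
    moreover have "\<bar>a - b - c\<bar> \<le> (2 + d) * 1" if "\<bar>a\<bar> \<le> 1" "\<bar>b\<bar> \<le> 1" "\<bar>c\<bar> \<le> d" for a b c d :: real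
      using that unfolding abs_le_iff mult_1_right by linarith
    ultimately have "\<bar>?Y - ?S\<bar> \<le> ?B * 1" by blast
    also have "\<dots> \<le> ?B * ?N" by (rule mult_left_mono[OF N1 B0])
    finally show ?thesis .
  next
    case False
    \<comment> \<open>As \<open>g\<close> is injective, two different incidences differ in both
      coordinates, which is the form that the indicators count.\<close>
    then have uniq: "q = q'" if "q \<in> Q" "q' \<in> Q" "g (snd q) = fst q" "g (snd q') = fst q'" for q q'
      using that inj by (metis prod_eqI)
    have "?Y = ?S"
    proof (cases "\<exists>q\<in>Q. g (snd q) = fst q")
      case True
      then obtain q where q: "q \<in> Q" "g (snd q) = fst q" by blast
      have "perm_supp \<sigma> \<inter> perm_supp ?\<tau> = {fst q}"
      proof
        show "{fst q} \<subseteq> perm_supp \<sigma> \<inter> perm_supp ?\<tau>" using q by (auto simp: Q_def supp)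
        show "perm_supp \<sigma> \<inter> perm_supp ?\<tau> \<subseteq> {fst q}"
        proof
          fix s assume "s \<in> perm_supp \<sigma> \<inter> perm_supp ?\<tau>"
          then obtain t where "s \<in> perm_supp \<sigma>" "t \<in> perm_supp \<tau>" "s = g t" by (auto simp: supp)
          then have "(s, t) = q" using uniq[of "(s, t)" q] q by (simp add: Q_def)
          then show "s \<in> {fst q}" by auto
        qed
      qed
      from thoma_character_merge[OF \<sigma> \<tau>' this, of \<omega>]
      have "?Y = D q"
        using g q(2) \<chi>\<tau> card_image[OF inj_on_subset[OF bij_is_inj[OF g] subset_UNIV], of "orbit \<tau> (snd q)"]
          orbit_conj_by[OF \<tau> g, of "snd q"]
        by (simp only: D_def nontrivial_cycle_type_conj_by[OF \<tau> g])
      moreover have "?S = (\<Sum>q'\<in>Q. if q' = q then D q else 0)"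
      proof (rule sum.cong[OF refl])
        fix q' assume q': "q' \<in> Q"
        show "D q' * of_bool (g (snd q') = fst q') = (if q' = q then D q else 0)"
          using uniq[OF q' q(1) _ q(2)] q(2) by (cases "g (snd q') = fst q'") auto
      qed
      ultimately show ?thesis using fin q by simp
    next
      case False
      have "perm_supp \<sigma> \<inter> perm_supp ?\<tau> = {}" using False by (auto simp: supp Q_def)
      then have "?Y = 0" using thoma_character_disjoint[OF \<sigma> \<tau>'] \<chi>\<tau> by simp
      moreover have "?S = 0" by (rule sum.neutral) (use False in auto)
      ultimately show ?thesis by simp
    qed
    then show ?thesis using mult_nonneg_nonneg[OF B0 N0] by simp
  qed
qed

text \<open>One prescribed incidence has probability \<open>1 / n\<close>, two have
  \<open>1 / (n * (n - 1))\<close>; after multiplication by \<open>n\<close> only the sum of the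
  \<open>D q\<close> remains in the limit.\<close>

lemma pair_covariance_limit:
  assumes \<omega>: "\<omega> \<in> thoma_simplex" and \<sigma>n: "\<sigma> \<in> sym_group n0" and \<tau>n: "\<tau> \<in> sym_group n0"
  shows "(\<lambda>n. real n * (avg n (\<lambda>g. thoma_character \<omega> (\<sigma> \<circ> conj_by g \<tau>)) - thoma_character \<omega> \<sigma> * thoma_character \<omega> \<tau>))
    \<longlonglongrightarrow> thoma_covariance \<omega> (nontrivial_cycle_type \<sigma>) (nontrivial_cycle_type \<tau>)"
proof -
  let ?\<chi> = "thoma_character \<omega>"
  have \<sigma>: "permutation \<sigma>" and \<tau>: "permutation \<tau>" using assms by (auto intro: sym_group_permutation)
  define Q where "Q = perm_supp \<sigma> \<times> perm_supp \<tau>"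
  define D where "D q = thoma_p_part \<omega> (nontrivial_cycle_type \<sigma> + nontrivial_cycle_type \<tau>
      - {#card (orbit \<sigma> (fst q)), card (orbit \<tau> (snd q))#}) *
    (thoma_p \<omega> (card (orbit \<sigma> (fst q)) + card (orbit \<tau> (snd q)) - 1)
      - thoma_p \<omega> (card (orbit \<sigma> (fst q))) * thoma_p \<omega> (card (orbit \<tau> (snd q))))" for q
  let ?B = "2 + (\<Sum>q\<in>Q. \<bar>D q\<bar>)"
  have fin: "finite Q" using \<sigma> \<tau> by (simp add: Q_def finite_perm_supp)
  have B0: "?B \<ge> 0" by (intro add_nonneg_nonneg sum_nonneg) auto
  \<comment> \<open>\<open>D\<close> depends only on the lengths of the cycles through the two
    points, so \<open>sum_perm_supp\<close> collects the points of each cycle into the factors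
    \<open>a\<close> and \<open>b\<close>.\<close>
  have cov: "thoma_covariance \<omega> (nontrivial_cycle_type \<sigma>) (nontrivial_cycle_type \<tau>) = (\<Sum>q\<in>Q. D q)"
  proof -
    let ?F = "\<lambda>a b. thoma_p_part \<omega> (nontrivial_cycle_type \<sigma> + nontrivial_cycle_type \<tau> - {#a, b#}) *
      (thoma_p \<omega> (a + b - 1) - thoma_p \<omega> a * thoma_p \<omega> b)"
    have "(\<Sum>q\<in>Q. D q) = (\<Sum>s\<in>perm_supp \<sigma>. \<Sum>t\<in>perm_supp \<tau>. ?F (card (orbit \<sigma> s)) (card (orbit \<tau> t)))"
      unfolding Q_def D_def sum.cartesian_product by (simp only: case_prod_unfold)
    also have "\<dots> = (\<Sum>a\<in>#nontrivial_cycle_type \<sigma>. real a * (\<Sum>b\<in>#nontrivial_cycle_type \<tau>. real b * ?F a b))"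
    proof -
      have "(\<Sum>t\<in>perm_supp \<tau>. ?F a (card (orbit \<tau> t))) = (\<Sum>b\<in>#nontrivial_cycle_type \<tau>. real b * ?F a b)" for a
        by (rule sum_perm_supp[OF \<tau>])
      then show ?thesis
        using sum_perm_supp[OF \<sigma>, of "\<lambda>a. \<Sum>b\<in>#nontrivial_cycle_type \<tau>. real b * ?F a b"] by (simp only:)
    qed
    finally show ?thesis by (simp add: thoma_covariance_def sum_mset_distrib_left mult_ac)
  qed
  have bound: "norm (real n * (avg n (\<lambda>g. ?\<chi> (\<sigma> \<circ> conj_by g \<tau>)) - ?\<chi> \<sigma> * ?\<chi> \<tau>) - (\<Sum>q\<in>Q. D q)) \<le>
      (2 * (?B * real (card Q) * real (card Q))) / real n" if n: "n \<ge> n0 + 2" for n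
  proof -
    have S: "perm_supp \<sigma> \<subseteq> {1..n}" "perm_supp \<tau> \<subseteq> {1..n}"
      using perm_supp_sym_group subsetD[OF sym_group_mono[of n0 n]] n assms(2,3) by simp_all
    let ?Y = "\<lambda>g. ?\<chi> (\<sigma> \<circ> conj_by g \<tau>) - ?\<chi> \<sigma> * ?\<chi> \<tau>"
    let ?S = "\<lambda>g. \<Sum>q\<in>Q. D q * of_bool (g (snd q) = fst q)"
    let ?n = "\<lambda>q q' g. of_bool (fst q \<noteq> fst q' \<and> snd q \<noteq> snd q' \<and> g (snd q) = fst q \<and> g (snd q') = fst q') :: real"
    have "\<bar>avg n (\<lambda>g. ?Y g - ?S g)\<bar> \<le> avg n (\<lambda>g. \<bar>?Y g - ?S g\<bar>)" by (rule abs_avg_le)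
    also have "\<dots> \<le> avg n (\<lambda>g. ?B * (\<Sum>q\<in>Q. \<Sum>q'\<in>Q. ?n q q' g))"
      by (rule avg_mono) (unfold Q_def D_def, rule pair_expansion[OF \<omega> \<sigma> \<tau> sym_group_bij])
    also have "\<dots> = ?B * (\<Sum>q\<in>Q. \<Sum>q'\<in>Q. avg n (?n q q'))"
      by (simp only: avg_mult avg_sum)
    also have "\<dots> \<le> ?B * (\<Sum>q\<in>Q. \<Sum>q'\<in>Q. 1 / (real n * real (n - 1)))"
    proof (intro mult_left_mono[OF _ B0] sum_mono)
      fix q q' assume q: "q \<in> Q" "q' \<in> Q"
      show "avg n (?n q q') \<le> 1 / (real n * real (n - 1))"
      proof (cases "fst q \<noteq> fst q' \<and> snd q \<noteq> snd q'")
        case True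
        then have "avg n (?n q q') = avg n (\<lambda>g. of_bool (g (snd q) = fst q \<and> g (snd q') = fst q'))" by simp
        also have "\<dots> = 1 / (real n * real (n - 1))"
          by (rule avg_two_points) (use True q S in \<open>auto simp: Q_def simp del: atLeastAtMost_iff\<close>)
        finally show ?thesis by simp
      next
        case False
        then have "(\<lambda>g. ?n q q' g) = (\<lambda>g. 0)" by auto
        then have "avg n (?n q q') = 0" by (simp only: avg_const)
        then show ?thesis by simp
      qed
    qed
    also have "\<dots> = ?B * real (card Q) * real (card Q) / (real n * real (n - 1))" by simp
    finally have 1: "\<bar>avg n (\<lambda>g. ?Y g - ?S g)\<bar> \<le> ?B * real (card Q) * real (card Q) / (real n * real (n - 1))" .
    have "avg n ?S = (\<Sum>q\<in>Q. D q * (1 / n))"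
      unfolding avg_sum avg_mult
    proof (rule sum.cong[OF refl])
      fix q assume q: "q \<in> Q"
      have "fst q \<in> {1..n}" "snd q \<in> {1..n}" using q S by (auto simp: Q_def simp del: atLeastAtMost_iff)
      then show "D q * avg n (\<lambda>g. of_bool (g (snd q) = fst q)) = D q * (1 / n)" by (simp only: avg_point)
    qed
    then have "avg n (\<lambda>g. ?Y g - ?S g) = avg n (\<lambda>g. ?\<chi> (\<sigma> \<circ> conj_by g \<tau>)) - ?\<chi> \<sigma> * ?\<chi> \<tau> - (\<Sum>q\<in>Q. D q) / n"
      by (simp add: avg_diff avg_const sum_divide_distrib)
    then have eq: "real n * avg n (\<lambda>g. ?Y g - ?S g) =
        real n * (avg n (\<lambda>g. ?\<chi> (\<sigma> \<circ> conj_by g \<tau>)) - ?\<chi> \<sigma> * ?\<chi> \<tau>) - (\<Sum>q\<in>Q. D q)"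
      using n by (simp add: right_diff_distrib)
    have "norm (real n * (avg n (\<lambda>g. ?\<chi> (\<sigma> \<circ> conj_by g \<tau>)) - ?\<chi> \<sigma> * ?\<chi> \<tau>) - (\<Sum>q\<in>Q. D q)) =
        real n * \<bar>avg n (\<lambda>g. ?Y g - ?S g)\<bar>"
      unfolding eq[symmetric] real_norm_def abs_mult by simp
    also have "\<dots> \<le> real n * (?B * real (card Q) * real (card Q) / (real n * real (n - 1)))"
      by (rule mult_left_mono[OF 1]) simp
    also have "\<dots> = ?B * real (card Q) * real (card Q) / real (n - 1)" using n by simp
    \<comment> \<open>\<open>n - 1\<close> is at least \<open>n / 2\<close> because
      \<open>n \<ge> 2\<close>, which is why the bound on \<open>n\<close> is
      \<open>n0 + 2\<close>.\<close>
    also have "\<dots> \<le> ?B * real (card Q) * real (card Q) / (real n / 2)"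
      using n B0 by (intro divide_left_mono mult_nonneg_nonneg) auto
    also have "\<dots> = 2 * (?B * real (card Q) * real (card Q)) / real n"
      by (simp only: divide_divide_eq_right mult.commute[of 2])
    finally show ?thesis .
  qed
  have "(\<lambda>n. real n * (avg n (\<lambda>g. ?\<chi> (\<sigma> \<circ> conj_by g \<tau>)) - ?\<chi> \<sigma> * ?\<chi> \<tau>) - (\<Sum>q\<in>Q. D q)) \<longlonglongrightarrow> 0"
  proof (rule Lim_null_comparison)
    show "\<forall>\<^sub>F n in sequentially. norm (real n * (avg n (\<lambda>g. ?\<chi> (\<sigma> \<circ> conj_by g \<tau>)) - ?\<chi> \<sigma> * ?\<chi> \<tau>) - (\<Sum>q\<in>Q. D q)) \<le>
      (2 * (?B * real (card Q) * real (card Q))) / real n"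
      using eventually_ge_at_top[of "n0 + 2"] by eventually_elim (rule bound)
  qed (rule lim_const_over_n)
  then show ?thesis unfolding cov by (rule LIM_zero_cancel)
qed


section \<open>Convergence of the moments\<close>

lemma gaussian_moment_rec: "gaussian_moment v (k + 2) = real (k + 1) * v * gaussian_moment v k"
proof (cases "even k")
  case True
  then obtain j where j: "k = 2 * j" by (elim evenE)
  have "(k + 2) div 2 = Suc j" "k div 2 = j" using j by simp_all
  moreover have "(fact (k + 2) :: real) = real (k + 2) * (real (k + 1) * fact k)" by (simp add: fact_Suc algebra_simps)
  moreover have "real (k + 2) = 2 * real (Suc j)" using j by simp
  ultimately show ?thesis using True by (simp add: gaussian_moment_def field_simps del: of_nat_Suc)
qed (simp add: gaussian_moment_def)

text \<open>The limit recursion has steps of two, so with the starting values at 0 and 1 it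
  determines all limits; \<open>gaussian_moment_rec\<close> is the same recursion.\<close>

lemma gaussian_moments_limit:
  fixes m :: "nat \<Rightarrow> nat \<Rightarrow> real"
  assumes m0: "(\<lambda>n. m n 0) \<longlonglongrightarrow> 1" and m1: "(\<lambda>n. m n 1) \<longlonglongrightarrow> 0" and m2: "(\<lambda>n. m n 2) \<longlonglongrightarrow> v"
    and rec: "\<And>k. (\<lambda>n. m n (k + 2) - real (k + 1) * m n 2 * m n k) \<longlonglongrightarrow> 0"
  shows "(\<lambda>n. m n k) \<longlonglongrightarrow> gaussian_moment v k"
proof (induction k rule: less_induct)
  case (less k)
  consider "k = 0" | "k = 1" | j where "k = j + 2" by (metis One_nat_def add_2_eq_Suc' not0_implies_Suc)
  then show ?case
  proof cases
    case 1
    then show ?thesis using m0 by (simp add: gaussian_moment_def)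
  next
    case 2
    then show ?thesis using m1 by (simp add: gaussian_moment_def)
  next
    case 3
    have "(\<lambda>n. (m n (j + 2) - real (j + 1) * m n 2 * m n j) + real (j + 1) * m n 2 * m n j)
        \<longlonglongrightarrow> 0 + real (j + 1) * v * gaussian_moment v j"
      by (intro tendsto_add rec tendsto_mult tendsto_const m2 less.IH) (simp add: 3)
    then show ?thesis unfolding 3 gaussian_moment_rec by simp
  qed
qed

text \<open>Parts are positive, so a partition of \<open>n\<close> has at most \<open>n\<close> of
  them.\<close>

lemma finite_partitions: "finite (partitions n)"
proof -
  have "partitions n \<subseteq> mset ` {xs. set xs \<subseteq> {..n} \<and> length xs \<le> n}"
  proof
    fix \<mu> assume \<mu>: "\<mu> \<in> partitions n"
    obtain xs where xs: "\<mu> = mset xs" by (metis ex_mset)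
    have s: "sum_list xs = n" and pos: "\<And>x. x \<in> set xs \<Longrightarrow> 1 \<le> x"
      using \<mu> by (auto simp: partitions_def xs sum_mset_sum_list Suc_le_eq intro: gr0I)
    have "set xs \<subseteq> {..n}" using member_le_sum_list[of _ xs] s by auto
    moreover have "length xs \<le> sum_list xs"
      using sum_list_mono[of xs "\<lambda>_. 1" "\<lambda>x. x"] pos by (simp add: sum_list_triv)
    ultimately show "\<mu> \<in> mset ` {xs. set xs \<subseteq> {..n} \<and> length xs \<le> n}" using s xs by auto
  qed
  then show ?thesis by (rule finite_subset) (intro finite_imageI finite_lists_length_le, simp)
qed

section \<open>Moments of the characters under a central measure of fixed degree\<close>

locale central_measure_model =
  fixes \<omega> :: "(nat \<Rightarrow> real) \<times> (nat \<Rightarrow> real)" and \<sigma> :: "'r::finite \<Rightarrow> nat \<Rightarrow> nat" and n :: nat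
    and P :: "nat multiset pmf"
  assumes \<omega>: "\<omega> \<in> thoma_simplex" and \<sigma>: "\<And>i. \<sigma> i \<in> sym_group n" and n: "n \<ge> 1"
    and P: "is_central_measure n \<omega> P"
begin

lemma sum_partition: "lam \<in> partitions n \<Longrightarrow> \<Sum>\<^sub># lam = n"
  by (simp add: partitions_def)

lemma perm: "permutation (\<sigma> i)"
  by (rule sym_group_permutation[OF \<sigma>])

lemma expectation_eq:
  "measure_pmf.expectation P f = (\<Sum>lam\<in>partitions n. pmf P lam * (f lam :: real))"
  by (subst integral_measure_pmf_real[OF finite_partitions])
     (use P in \<open>auto simp: is_central_measure_def mult.commute\<close>)

lemma thoma_character_eq:
  assumes "\<rho> \<in> sym_group n"
  shows "thoma_character \<omega> \<rho> = (\<Sum>lam\<in>partitions n. pmf P lam * char_value lam \<rho>)"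
proof -
  have "complex_of_real (thoma_character \<omega> \<rho>) = (\<Sum>lam\<in>partitions n. complex_of_real (pmf P lam) * norm_character lam \<rho>)"
    using P assms by (simp add: is_central_measure_def)
  also have "\<dots> = (\<Sum>lam\<in>partitions n. of_real (pmf P lam * char_value lam \<rho>))"
    by (intro sum.cong refl) (use assms in \<open>simp add: norm_character_char_value sum_partition\<close>)
  finally show ?thesis by (simp only: of_real_sum[symmetric] of_real_eq_iff)
qed

lemma char_value_mult_avg:
  "lam \<in> partitions n \<Longrightarrow> \<rho> \<in> sym_group n \<Longrightarrow> \<tau> \<in> sym_group n \<Longrightarrow>
    char_value lam \<rho> * char_value lam \<tau> = avg n (\<lambda>g. char_value lam (\<rho> \<circ> conj_by g \<tau>))"
  using char_value_mult[of \<rho> lam \<tau>] by (simp add: sum_partition avg_def)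

definition Z :: "real ^ 'r \<Rightarrow> nat multiset \<Rightarrow> real" where
  "Z u lam = (\<Sum>i\<in>UNIV. u $ i * (char_value lam (\<sigma> i) - thoma_character \<omega> (\<sigma> i)))"

text \<open>\<open>char_value_mult_avg\<close> turns the product of two characters into an average
  of single ones, whose expectations are values of the Thoma character by the definition of the
  central measure.\<close>

lemma second_moment:
  "measure_pmf.expectation P (\<lambda>lam. Z u lam ^ 2) = (\<Sum>i\<in>UNIV. \<Sum>j\<in>UNIV. u $ i * u $ j *
    (avg n (\<lambda>g. thoma_character \<omega> (\<sigma> i \<circ> conj_by g (\<sigma> j))) - thoma_character \<omega> (\<sigma> i) * thoma_character \<omega> (\<sigma> j)))"
proof -
  let ?x = "\<lambda>i. thoma_character \<omega> (\<sigma> i)" and ?X = "\<lambda>lam i. char_value lam (\<sigma> i)"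
  let ?E = "\<lambda>f. \<Sum>lam\<in>partitions n. pmf P lam * f lam"
  have one: "?E (\<lambda>_. 1) = 1"
    using thoma_character_eq[OF sym_group_id] by (simp add: char_value_id thoma_character_id)
  have EX: "?E (\<lambda>lam. ?X lam i) = ?x i" for i by (rule thoma_character_eq[OF \<sigma>, symmetric])
  have EXX: "?E (\<lambda>lam. ?X lam i * ?X lam j) = avg n (\<lambda>g. thoma_character \<omega> (\<sigma> i \<circ> conj_by g (\<sigma> j)))" for i j
  proof -
    have "?E (\<lambda>lam. ?X lam i * ?X lam j) = avg n (\<lambda>g. \<Sum>lam\<in>partitions n. pmf P lam * char_value lam (\<sigma> i \<circ> conj_by g (\<sigma> j)))"
      unfolding avg_sum avg_mult by (rule sum.cong[OF refl]) (simp add: char_value_mult_avg \<sigma>)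
    also have "\<dots> = avg n (\<lambda>g. thoma_character \<omega> (\<sigma> i \<circ> conj_by g (\<sigma> j)))"
      unfolding avg_def
      by (intro arg_cong2[where f = "(/)"] sum.cong refl thoma_character_eq[symmetric] sym_group_comp sym_group_conj \<sigma>)
    finally show ?thesis .
  qed
  have "measure_pmf.expectation P (\<lambda>lam. Z u lam ^ 2) =
    ?E (\<lambda>lam. \<Sum>i\<in>UNIV. \<Sum>j\<in>UNIV. u $ i * u $ j * ((?X lam i - ?x i) * (?X lam j - ?x j)))"
    unfolding expectation_eq Z_def power2_eq_square sum_product by (simp only: mult_ac)
  also have "\<dots> = (\<Sum>i\<in>UNIV. \<Sum>j\<in>UNIV. u $ i * u $ j * ?E (\<lambda>lam. (?X lam i - ?x i) * (?X lam j - ?x j)))"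
    unfolding sum_distrib_left
    by (subst sum.swap, rule sum.cong[OF refl], subst sum.swap) (simp only: mult_ac)
  also have "\<dots> = (\<Sum>i\<in>UNIV. \<Sum>j\<in>UNIV. u $ i * u $ j *
    (avg n (\<lambda>g. thoma_character \<omega> (\<sigma> i \<circ> conj_by g (\<sigma> j))) - ?x i * ?x j))"
  proof (intro sum.cong refl arg_cong2[where f = "(*)"])
    fix i j
    have "?E (\<lambda>lam. (?X lam i - ?x i) * (?X lam j - ?x j)) =
      ?E (\<lambda>lam. ?X lam i * ?X lam j) - ?x j * ?E (\<lambda>lam. ?X lam i) - ?x i * ?E (\<lambda>lam. ?X lam j) + ?x i * ?x j * ?E (\<lambda>_. 1)"
      by (simp add: algebra_simps sum.distrib sum_subtractf sum_distrib_left)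
    then show "?E (\<lambda>lam. (?X lam i - ?x i) * (?X lam j - ?x j)) =
      avg n (\<lambda>g. thoma_character \<omega> (\<sigma> i \<circ> conj_by g (\<sigma> j))) - ?x i * ?x j"
      unfolding EXX EX one by simp
  qed
  finally show ?thesis .
qed

definition supp_total :: real where
  "supp_total = (\<Sum>i\<in>UNIV. real (card (perm_supp (\<sigma> i))))"

lemma card_supp_le: "real (card (perm_supp (\<sigma> i))) \<le> supp_total"
  unfolding supp_total_def by (rule member_le_sum) auto

text \<open>The instance of the graph model: a vertex is a pair \<open>(i, g)\<close> of weight
  \<open>u $ i / fact n\<close> and carries the conjugate of \<open>\<sigma> i\<close> by
  \<open>g\<close>. \<open>T\<close> is the total absolute weight, and \<open>K\<close> comes from a
  union bound over pairs of points of two supports.\<close>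

lemma moment_recursion_bound:
  fixes u :: "real ^ 'r"
  defines "T \<equiv> \<Sum>i\<in>UNIV. \<bar>u $ i\<bar>"
  defines "K \<equiv> T * supp_total * supp_total"
  shows "measure_pmf.expectation P (\<lambda>lam. Z u lam ^ 1) = 0"
    and "\<bar>measure_pmf.expectation P (\<lambda>lam. Z u lam ^ (k + 2)) -
      real (k + 1) * measure_pmf.expectation P (\<lambda>lam. Z u lam ^ 2) * measure_pmf.expectation P (\<lambda>lam. Z u lam ^ k)\<bar> \<le>
      permutation_model.rec_const T K (k + 2) * (1 / sqrt n) ^ (k + 3)"
proof -
  define W where "W = (UNIV :: 'r set) \<times> sym_group n"
  define wt where "wt = (\<lambda>(i, g :: nat \<Rightarrow> nat). u $ i / fact n)"
  define \<pi> where "\<pi> = (\<lambda>(i, g). conj_by g (\<sigma> i))"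
  have sumW: "(\<Sum>a\<in>W. F a) = (\<Sum>i\<in>UNIV. \<Sum>g\<in>sym_group n. F (i, g))" for F :: "_ \<Rightarrow> real"
    unfolding W_def sum.cartesian_product by simp
  have st0: "supp_total \<ge> 0" unfolding supp_total_def by (intro sum_nonneg) simp
  have T0: "T \<ge> 0" unfolding T_def by (intro sum_nonneg) simp
  have memW: "snd a \<in> sym_group n" if "a \<in> W" for a using that by (auto simp: W_def)
  have \<pi>S: "\<pi> a \<in> sym_group n" if "a \<in> W" for a
    using memW[OF that] \<sigma> by (simp add: \<pi>_def case_prod_unfold sym_group_conj)
  interpret pm: permutation_model W wt \<pi> T K "1 / sqrt n" \<omega>
  proof
    show "finite W" by (simp add: W_def finite_sym_group)
    show "(perm_supp (\<pi> a) \<inter> perm_supp (\<pi> b) \<noteq> {}) = (perm_supp (\<pi> b) \<inter> perm_supp (\<pi> a) \<noteq> {})" for a b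
      by (simp only: Int_commute)
    show "(\<Sum>a\<in>W. \<bar>wt a\<bar>) \<le> T" by (simp add: sumW wt_def T_def card_sym_group)
    show "0 \<le> K" using T0 st0 by (simp add: K_def)
    show "0 \<le> 1 / sqrt (real n)" "1 / sqrt (real n) \<le> 1" using n by simp_all
    show "\<omega> \<in> thoma_simplex" by (rule \<omega>)
    show "permutation (\<pi> a)" if "a \<in> W" for a by (rule sym_group_permutation[OF \<pi>S[OF that]])
    show "(\<Sum>a\<in>W. \<bar>wt a\<bar> * of_bool (perm_supp (\<pi> a) \<inter> perm_supp (\<pi> b) \<noteq> {})) \<le> K * (1 / sqrt (real n))\<^sup>2" if b: "b \<in> W" for b
    proof -
      let ?B = "perm_supp (\<pi> b)"
      have Bn: "?B \<subseteq> {1..n}" by (rule perm_supp_sym_group[OF \<pi>S[OF b]])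
      then have finB: "finite ?B" by (rule finite_subset) simp
      have gb: "bij (snd b)" by (rule sym_group_bij[OF memW[OF b]])
      have "?B = snd b ` perm_supp (\<sigma> (fst b))"
        by (simp add: \<pi>_def case_prod_unfold perm_supp_conj_by[OF gb])
      then have cB: "real (card ?B) \<le> supp_total"
        using card_supp_le[of "fst b"] card_image_le[OF finite_perm_supp[OF perm], of "snd b" "fst b"] by simp
      \<comment> \<open>If the supports meet, \<open>g\<close> sends some point of the support of
        \<open>\<sigma> i\<close> into \<open>?B\<close>, and for each pair of points this has
        probability \<open>1 / n\<close>.\<close>
      have hit: "avg n (\<lambda>g. of_bool (perm_supp (conj_by g (\<sigma> i)) \<inter> ?B \<noteq> {})) \<le> supp_total * supp_total / n" for i
      proof -
        let ?S = "perm_supp (\<sigma> i)"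
        have Sn: "?S \<subseteq> {1..n}" by (rule perm_supp_sym_group[OF \<sigma>])
        have "avg n (\<lambda>g. of_bool (perm_supp (conj_by g (\<sigma> i)) \<inter> ?B \<noteq> {})) \<le> avg n (\<lambda>g. \<Sum>t\<in>?S. \<Sum>s\<in>?B. of_bool (g t = s))"
        proof (rule avg_mono)
          fix g assume g: "g \<in> sym_group n"
          show "of_bool (perm_supp (conj_by g (\<sigma> i)) \<inter> ?B \<noteq> {}) \<le> (\<Sum>t\<in>?S. \<Sum>s\<in>?B. of_bool (g t = s) :: real)"
          proof (cases "perm_supp (conj_by g (\<sigma> i)) \<inter> ?B = {}")
            case False
            then obtain t where t: "t \<in> ?S" "g t \<in> ?B"
              unfolding perm_supp_conj_by[OF sym_group_bij[OF g]] by blast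
            have "1 \<le> (\<Sum>s\<in>?B. of_bool (g t = s) :: real)"
              using member_le_sum[of "g t" ?B "\<lambda>s. of_bool (g t = s) :: real"] t finB by simp
            also have "\<dots> \<le> (\<Sum>t\<in>?S. \<Sum>s\<in>?B. of_bool (g t = s))"
              by (rule member_le_sum[of t ?S "\<lambda>t. \<Sum>s\<in>?B. of_bool (g t = s) :: real"])
                 (use t finite_perm_supp[OF perm] in \<open>auto intro: sum_nonneg\<close>)
            finally show ?thesis using False by simp
          qed (simp add: sum_nonneg)
        qed
        also have "\<dots> = (\<Sum>t\<in>?S. \<Sum>s\<in>?B. 1 / n)"
          unfolding avg_sum
          by (intro sum.cong refl avg_point) (use Bn Sn in blast)+
        also have "\<dots> = real (card ?S) * real (card ?B) / n" by simp
        also have "\<dots> \<le> supp_total * supp_total / n"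
          by (intro divide_right_mono mult_mono card_supp_le cB st0) auto
        finally show ?thesis .
      qed
      have "(\<Sum>a\<in>W. \<bar>wt a\<bar> * of_bool (perm_supp (\<pi> a) \<inter> ?B \<noteq> {})) =
        (\<Sum>i\<in>UNIV. \<bar>u $ i\<bar> * avg n (\<lambda>g. of_bool (perm_supp (conj_by g (\<sigma> i)) \<inter> ?B \<noteq> {})))"
        unfolding sumW avg_def wt_def \<pi>_def
        by (intro sum.cong refl) (simp add: sum_distrib_left sum_divide_distrib del: sum_of_bool_mult_eq sum_mult_of_bool_eq sum_of_bool_eq)
      also have "\<dots> \<le> (\<Sum>i\<in>UNIV. \<bar>u $ i\<bar> * (supp_total * supp_total / n))"
        by (intro sum_mono mult_left_mono hit) auto
      also have "\<dots> = K * (1 / sqrt (real n))\<^sup>2"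
        by (simp add: K_def T_def sum_distrib_right power_divide sum_divide_distrib mult.assoc)
      finally show ?thesis .
    qed
  qed
  \<comment> \<open>For fixed \<open>lam\<close> the sum over independent conjugates is
    \<open>Z u lam ^ card V\<close>, by the functional equation; the mixture over \<open>lam\<close>
    replaces the character of \<open>lam\<close> by the Thoma character inside the centered
    product.\<close>
  have m: "wsum W wt V (pm.M V) w0 = measure_pmf.expectation P (\<lambda>lam. Z u lam ^ card V)" if V: "finite V" for V w0
  proof -
    let ?M = "\<lambda>lam w. centered_prod (char_value lam) (\<lambda>i. thoma_character \<omega> (\<pi> (w i))) (\<lambda>i. \<pi> (w i)) V"
    have "wsum W wt V (pm.M V) w0 = wsum W wt V (\<lambda>w. \<Sum>lam\<in>partitions n. pmf P lam * ?M lam w) w0"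
    proof (rule wsum_cong)
      fix w assume w: "\<And>i. i \<in> V \<Longrightarrow> w i \<in> W"
      show "pm.M V w = (\<Sum>lam\<in>partitions n. pmf P lam * ?M lam w)"
        unfolding pm.M_def
      proof (rule centered_prod_sum, rule thoma_character_eq, rule ordered_prod_mem)
        fix A assume A: "A \<subseteq> V"
        show "finite A" by (rule finite_subset[OF A V])
        show "f \<circ> \<pi> (w i) \<in> sym_group n" if "f \<in> sym_group n" "i \<in> A" for f i
          by (rule sym_group_comp[OF that(1) \<pi>S[OF w]]) (use that A in blast)
      qed (rule sym_group_id)
    qed
    also have "\<dots> = (\<Sum>lam\<in>partitions n. pmf P lam * wsum W wt V (?M lam) w0)"
      by (simp only: wsum_sum wsum_mult_const)
    also have "\<dots> = (\<Sum>lam\<in>partitions n. pmf P lam * Z u lam ^ card V)"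
    proof (rule sum.cong[OF refl])
      fix lam assume lam: "lam \<in> partitions n"
      have "wsum W wt V (?M lam) w0 = Z u lam ^ card V * char_value lam id"
      proof (rule wsum_centered_prod[where x = "\<lambda>a. thoma_character \<omega> (\<pi> a)" and S = "sym_group n"])
        show "finite V" "finite W" "id \<in> sym_group n" using V by (auto simp: W_def finite_sym_group sym_group_id)
        show "\<rho> \<circ> \<pi> a \<in> sym_group n" if "\<rho> \<in> sym_group n" "a \<in> W" for \<rho> a
          using that \<pi>S by (simp add: sym_group_comp)
        fix \<rho> assume \<rho>: "\<rho> \<in> sym_group n"
        have "(\<Sum>a\<in>W. wt a * (char_value lam (\<rho> \<circ> \<pi> a) - thoma_character \<omega> (\<pi> a) * char_value lam \<rho>)) =
          (\<Sum>i\<in>UNIV. \<Sum>g\<in>sym_group n. u $ i / fact n * (char_value lam (\<rho> \<circ> conj_by g (\<sigma> i)) - thoma_character \<omega> (\<sigma> i) * char_value lam \<rho>))"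
          unfolding sumW wt_def \<pi>_def
          by (intro sum.cong refl) (simp add: thoma_character_conj_by[OF perm] sym_group_bij)
        also have "\<dots> = (\<Sum>i\<in>UNIV. u $ i * avg n (\<lambda>g. char_value lam (\<rho> \<circ> conj_by g (\<sigma> i)) - thoma_character \<omega> (\<sigma> i) * char_value lam \<rho>))"
          unfolding avg_def by (simp add: sum_distrib_left sum_divide_distrib)
        also have "\<dots> = Z u lam * char_value lam \<rho>"
          unfolding avg_diff avg_const char_value_mult_avg[OF lam \<rho> \<sigma>, symmetric] Z_def sum_distrib_right
          by (simp add: algebra_simps)
        finally show "(\<Sum>a\<in>W. wt a * (char_value lam (\<rho> \<circ> \<pi> a) - thoma_character \<omega> (\<pi> a) * char_value lam \<rho>)) = Z u lam * char_value lam \<rho>" .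
      qed
      then show "pmf P lam * wsum W wt V (?M lam) w0 = pmf P lam * Z u lam ^ card V" by (simp add: char_value_id)
    qed
    finally show ?thesis by (simp only: expectation_eq)
  qed
  show "\<bar>measure_pmf.expectation P (\<lambda>lam. Z u lam ^ (k + 2)) -
      real (k + 1) * measure_pmf.expectation P (\<lambda>lam. Z u lam ^ 2) * measure_pmf.expectation P (\<lambda>lam. Z u lam ^ k)\<bar> \<le>
      pm.rec_const (k + 2) * (1 / sqrt n) ^ (k + 3)"
    by (rule pm.moment_recursion) (rule m)
  \<comment> \<open>The first moment is the case of a single vertex, where the centered product is
    zero.\<close>
  have "wsum W wt {0} (pm.M {0}) w0 = wsum W wt {0} (\<lambda>_. 0) w0" for w0
    by (rule wsum_cong) (simp only: pm.M_def centered_prod_single)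
  then show "measure_pmf.expectation P (\<lambda>lam. Z u lam ^ 1) = 0"
    using m[of "{0}"] by (simp add: wsum_def)
qed

end

section \<open>The central limit theorem\<close>

lemma thoma_covariance_cycle_type:
  "has_cycle_type \<sigma> \<mu> \<Longrightarrow> has_cycle_type \<tau> \<nu> \<Longrightarrow>
    thoma_covariance \<omega> \<mu> \<nu> = thoma_covariance \<omega> (nontrivial_cycle_type \<sigma>) (nontrivial_cycle_type \<tau>)"
  using thoma_covariance_filter[of \<omega> \<mu> \<nu>] by (simp add: has_cycle_type_def)

text \<open>Rescaling multiplies the moment of order \<open>k + 2\<close> by
  \<open>sqrt n ^ (k + 2)\<close>, while the error in its recursion has the order
  \<open>(1 / sqrt n) ^ (k + 3)\<close>; one factor \<open>1 / sqrt n\<close> is left.\<close>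

lemma moments_Delta_limit:
  fixes \<sigma> :: "'r::finite \<Rightarrow> nat \<Rightarrow> nat" and u :: "real ^ 'r"
  assumes \<omega>: "\<omega> \<in> thoma_simplex" and \<sigma>: "\<And>i. \<sigma> i \<in> sym_group n0" and P: "\<And>n. is_central_measure n \<omega> (P n)"
  shows "(\<lambda>n. measure_pmf.expectation (P n) (\<lambda>lam. (u \<bullet> (\<chi> i. Delta n \<omega> lam (\<sigma> i))) ^ k)) \<longlonglongrightarrow>
    gaussian_moment (\<Sum>i\<in>UNIV. \<Sum>j\<in>UNIV. u $ i * u $ j *
      thoma_covariance \<omega> (nontrivial_cycle_type (\<sigma> i)) (nontrivial_cycle_type (\<sigma> j))) k"
proof -
  let ?Z = "central_measure_model.Z \<omega> \<sigma> u"
  define E where "E n k = measure_pmf.expectation (P n) (\<lambda>lam. ?Z lam ^ k)" for n k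
  define m where "m n k = measure_pmf.expectation (P n) (\<lambda>lam. (u \<bullet> (\<chi> i. Delta n \<omega> lam (\<sigma> i))) ^ k)" for n k
  have model: "central_measure_model \<omega> \<sigma> n (P n)" if "n \<ge> n0 + 1" for n
    by unfold_locales (use \<omega> \<sigma> P that subsetD[OF sym_group_mono[of n0 n]] in auto)
  have mE: "m n k = sqrt n ^ k * E n k" if n: "n \<ge> n0 + 1" for n k
  proof -
    interpret central_measure_model \<omega> \<sigma> n "P n" by (rule model[OF n])
    have "u \<bullet> (\<chi> i. Delta n \<omega> lam (\<sigma> i)) = sqrt n * ?Z lam" for lam
      unfolding Z_def inner_vec_def Delta_def char_value_def sum_distrib_left
      by (rule sum.cong[OF refl]) simp
    then show ?thesis by (simp add: m_def E_def power_mult_distrib)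
  qed
  \<comment> \<open>From this degree on all the \<open>\<sigma> i\<close> lie in the group, and the
    1 makes the degree positive; smaller degrees do not affect the limit.\<close>
  have ev: "\<forall>\<^sub>F n in sequentially. n \<ge> n0 + 1" by (rule eventually_ge_at_top)
  have "(\<lambda>n. m n k) \<longlonglongrightarrow> gaussian_moment (\<Sum>i\<in>UNIV. \<Sum>j\<in>UNIV. u $ i * u $ j *
      thoma_covariance \<omega> (nontrivial_cycle_type (\<sigma> i)) (nontrivial_cycle_type (\<sigma> j))) k"
  proof (rule gaussian_moments_limit)
    show "(\<lambda>n. m n 0) \<longlonglongrightarrow> 1" by (simp add: m_def)
    show "(\<lambda>n. m n 1) \<longlonglongrightarrow> 0"
    proof (rule tendsto_eventually)
      show "\<forall>\<^sub>F n in sequentially. m n 1 = 0"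
        using ev
      proof eventually_elim
        case (elim n)
        interpret central_measure_model \<omega> \<sigma> n "P n" by (rule model[OF elim])
        have "E n 1 = 0" unfolding E_def by (rule moment_recursion_bound(1))
        then show ?case by (simp add: mE[OF elim])
      qed
    qed
    let ?V = "\<lambda>n. \<Sum>i\<in>UNIV. \<Sum>j\<in>UNIV. u $ i * u $ j * (real n *
      (avg n (\<lambda>g. thoma_character \<omega> (\<sigma> i \<circ> conj_by g (\<sigma> j))) - thoma_character \<omega> (\<sigma> i) * thoma_character \<omega> (\<sigma> j)))"
    have V: "\<forall>\<^sub>F n in sequentially. m n 2 = ?V n"
      using ev
    proof eventually_elim
      case (elim n)
      interpret central_measure_model \<omega> \<sigma> n "P n" by (rule model[OF elim])
      have "m n 2 = real n * E n 2" by (simp add: mE[OF elim])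
      then show ?case unfolding E_def second_moment by (simp add: sum_distrib_left mult_ac)
    qed
    have "?V \<longlonglongrightarrow> (\<Sum>i\<in>UNIV. \<Sum>j\<in>UNIV. u $ i * u $ j *
      thoma_covariance \<omega> (nontrivial_cycle_type (\<sigma> i)) (nontrivial_cycle_type (\<sigma> j)))"
      by (intro tendsto_sum tendsto_mult tendsto_const pair_covariance_limit[OF \<omega> \<sigma> \<sigma>])
    then show "(\<lambda>n. m n 2) \<longlonglongrightarrow> (\<Sum>i\<in>UNIV. \<Sum>j\<in>UNIV. u $ i * u $ j *
      thoma_covariance \<omega> (nontrivial_cycle_type (\<sigma> i)) (nontrivial_cycle_type (\<sigma> j)))"
      by (rule Lim_transform_eventually) (use V in \<open>simp add: eq_commute\<close>)
    show "(\<lambda>n. m n (k + 2) - real (k + 1) * m n 2 * m n k) \<longlonglongrightarrow> 0" for k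
    proof (rule Lim_null_comparison)
      define T where "T = (\<Sum>i\<in>UNIV. \<bar>u $ i\<bar>)"
      define K where "K = T * central_measure_model.supp_total \<sigma> * central_measure_model.supp_total \<sigma>"
      let ?c = "permutation_model.rec_const T K (k + 2)"
      show "\<forall>\<^sub>F n in sequentially. norm (m n (k + 2) - real (k + 1) * m n 2 * m n k) \<le> ?c * sqrt (1 / real n)"
        using ev
      proof eventually_elim
        case (elim n)
        interpret central_measure_model \<omega> \<sigma> n "P n" by (rule model[OF elim])
        have s: "sqrt n > 0" using elim by simp
        have "m n (k + 2) - real (k + 1) * m n 2 * m n k = sqrt n ^ (k + 2) * (E n (k + 2) - real (k + 1) * E n 2 * E n k)"
          unfolding mE[OF elim] power_add by (simp only: right_diff_distrib mult_ac)
        then have "norm (m n (k + 2) - real (k + 1) * m n 2 * m n k) = sqrt n ^ (k + 2) * \<bar>E n (k + 2) - real (k + 1) * E n 2 * E n k\<bar>"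
          by (simp only: real_norm_def abs_mult) simp
        also have "\<dots> \<le> sqrt n ^ (k + 2) * (?c * (1 / sqrt n) ^ (k + 3))"
          unfolding E_def T_def K_def by (intro mult_left_mono moment_recursion_bound(2)) simp
        also have "\<dots> = ?c * (sqrt n * (1 / sqrt n)) ^ (k + 2) * (1 / sqrt n)"
          unfolding power_mult_distrib by (simp add: numeral_eq_Suc)
        also have "\<dots> = ?c * sqrt (1 / real n)" using s by (simp add: real_sqrt_divide)
        finally show ?case .
      qed
      show "(\<lambda>n. ?c * sqrt (1 / real n)) \<longlonglongrightarrow> 0"
        using tendsto_mult[OF tendsto_const[of ?c] tendsto_real_sqrt[OF lim_1_over_n]] by simp
    qed
  qed
  then show ?thesis by (simp only: m_def)
qed

theorem theorem17:
  fixes \<omega> :: "(nat \<Rightarrow> real) \<times> (nat \<Rightarrow> real)"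
    and \<sigma> :: "'r::finite \<Rightarrow> nat \<Rightarrow> nat"
    and \<mu> :: "'r \<Rightarrow> nat multiset"
    and P :: "nat \<Rightarrow> nat multiset pmf"
  assumes "\<omega> \<in> thoma_simplex"
    and "\<And>i. \<sigma> i \<in> sym_inf"
    and "\<And>i. has_cycle_type (\<sigma> i) (\<mu> i)"
    and "\<And>n. is_central_measure n \<omega> (P n)"
  shows "\<exists>N :: (real ^ 'r) measure.
    centered_gaussian_vector N \<and>
    converges_in_law (\<lambda>n. distr (measure_pmf (P n)) borel (\<lambda>lam. \<chi> i. Delta n \<omega> lam (\<sigma> i))) N \<and>
    (\<forall>i j. covariance N (\<lambda>x. x $ i) (\<lambda>x. x $ j) =
       (\<Sum>a\<in>#\<mu> i. \<Sum>b\<in>#\<mu> j. real a * real b * thoma_p_part \<omega> (\<mu> i + \<mu> j - {#a, b#}) *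
          (thoma_p \<omega> (a + b - 1) - thoma_p \<omega> a * thoma_p \<omega> b))) \<and>
    (\<forall>i j l m. has_cycle_type (\<sigma> i) {#l#} \<and> has_cycle_type (\<sigma> j) {#m#} \<longrightarrow>
       covariance N (\<lambda>x. x $ i) (\<lambda>x. x $ j) =
         real l * real m * (thoma_p \<omega> (l + m - 1) - thoma_p \<omega> l * thoma_p \<omega> m))"
proof -
  have "\<forall>i. \<exists>n. \<sigma> i \<in> sym_group n" using assms(2) by (auto simp: sym_inf_def)
  then obtain f where f: "\<And>i. \<sigma> i \<in> sym_group (f i)" by metis
  \<comment> \<open>The sum is a common bound for the finitely many degrees.\<close>
  define n0 where "n0 = (\<Sum>i\<in>UNIV. f i)"
  have \<sigma>: "\<sigma> i \<in> sym_group n0" for i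
  proof -
    have "f i \<le> n0" unfolding n0_def by (rule member_le_sum) auto
    then show ?thesis using f[of i] subsetD[OF sym_group_mono] by blast
  qed
  define C where "C i j = thoma_covariance \<omega> (\<mu> i) (\<mu> j)" for i j
  have C: "C i j = thoma_covariance \<omega> (nontrivial_cycle_type (\<sigma> i)) (nontrivial_cycle_type (\<sigma> j))" for i j
    unfolding C_def by (rule thoma_covariance_cycle_type[OF assms(3) assms(3)])
  have "\<exists>N. centered_gaussian_vector N \<and>
    converges_in_law (\<lambda>n. distr (measure_pmf (P n)) borel (\<lambda>lam. \<chi> i. Delta n \<omega> lam (\<sigma> i))) N \<and>
    (\<forall>i j. covariance N (\<lambda>x. x $ i) (\<lambda>x. x $ j) = C i j)"
  proof (rule moments_imp_gaussian_limit)
    show "finite (set_pmf (P n))" for n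
      using assms(4)[of n] finite_subset[OF _ finite_partitions] by (auto simp: is_central_measure_def)
    show "C i j = C j i" for i j unfolding C_def by (rule thoma_covariance_commute)
    show "(\<lambda>n. measure_pmf.expectation (P n) (\<lambda>lam. (u \<bullet> (\<chi> i. Delta n \<omega> lam (\<sigma> i))) ^ k)) \<longlonglongrightarrow>
      gaussian_moment (\<Sum>i\<in>UNIV. \<Sum>j\<in>UNIV. u $ i * u $ j * C i j) k" for u k
      unfolding C by (rule moments_Delta_limit[OF assms(1) \<sigma> assms(4)])
  qed
  then obtain N where N: "centered_gaussian_vector N"
    "converges_in_law (\<lambda>n. distr (measure_pmf (P n)) borel (\<lambda>lam. \<chi> i. Delta n \<omega> lam (\<sigma> i))) N"
    "\<And>i j. covariance N (\<lambda>x. x $ i) (\<lambda>x. x $ j) = C i j" by blast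
  have cycles: "covariance N (\<lambda>x. x $ i) (\<lambda>x. x $ j) = real l * real m * (thoma_p \<omega> (l + m - 1) - thoma_p \<omega> l * thoma_p \<omega> m)"
    if "has_cycle_type (\<sigma> i) {#l#}" "has_cycle_type (\<sigma> j) {#m#}" for i j l m
    unfolding N(3) C thoma_covariance_cycle_type[OF that, symmetric] by (rule thoma_covariance_single)
  show ?thesis
  proof (intro exI[of _ N] conjI allI impI N(1,2))
    show "covariance N (\<lambda>x. x $ i) (\<lambda>x. x $ j) =
       (\<Sum>a\<in>#\<mu> i. \<Sum>b\<in>#\<mu> j. real a * real b * thoma_p_part \<omega> (\<mu> i + \<mu> j - {#a, b#}) *
          (thoma_p \<omega> (a + b - 1) - thoma_p \<omega> a * thoma_p \<omega> b))" for i j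
      unfolding N(3) C_def thoma_covariance_def ..
  qed (elim conjE, rule cycles)
qed

end
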